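(* Let $G$ be a countable group, and let $\mathcal{N}$ be a non-empty countable subset of $\mathcal{N}_G(\mathcal{F})$. Then there exist a normal subgroup $M$ of $G$ and a comeager subset $\mathcal{H}_0\subseteq\mathcal{A}_G$ such that $\mathrm{cl}_{\mathcal{N}}(H)=M$ for every $H\in\mathcal{H}_0$.
   Context: For a set $\mathcal{N}$ of normal subgroups of $G$ and a subgroup $H$ of $G$, $\mathrm{cl}_{\mathcal{N}}(H):=\bigcap_{N\in\mathcal{N}}HN$. All groups are discrete, compact spaces are Hausdorff, and $G$-spaces are non-empty spaces with a $G$-action by homeomorphisms. $\mathrm{Sub}(G)$ is the set of subgroups of $G$ with the topology induced from the product topology on $\{0,1\}^G$, with the conjugation action of $G$. A URS of $G$ is a non-empty closed $G$-invariant minimal subset of $\mathrm{Sub}(G)$. If $X$ is a minimal compact $G$-space, the closure in $\mathrm{Sub}(G)$ of the set of point stabilizers $\{G_x:x\in X\}$ contains a unique URS, denoted $S_G(X)$. A compact $G$-space $X$ is strongly proximal if the orbit closure of every probability measure on $X$ in $\mathrm{Prob}(X)$ (weak-$*$ topology) contains a Dirac measure. The Furstenberg boundary $\partial_F G$ is the universal minimal and strongly proximal compact $G$-space (every minimal strongly proximal compact $G$-space is a continuous $G$-equivariant image of it). The Furstenberg URS of $G$ is $\mathcal{A}_G:=S_G(\partial_F G)$, with the topology induced from $\mathrm{Sub}(G)$. $\mathcal{F}$ is the class of groups $Q$ such that $\mathcal{A}_Q$ is a singleton. $\mathcal{N}_G(\mathcal{F})$ is the set of normal subgroups $N$ of $G$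 such that $G/N\in\mathcal{F}$. A subset of a space is comeager if it contains a countable intersection of dense open subsets. *)

theory Defs
  imports "HOL-Probability.Probability" "HOL-Algebra.Group_Action"
begin

text \<open>Clashes with \<^const>\<open>Abstract_Topology.closure_of\<close>.\<close>
no_notation eq_closure_of ("closure'_of\<index>")

section \<open>Compact G-spaces\<close>

text \<open>
  As in \<^locale>\<open>group_action\<close>, the map \<^term>\<open>\<phi> g\<close> is extensional outside the underlying set.
\<close>

definition compact_G_space ::
    "('a, 'c) monoid_scheme \<Rightarrow> 'x topology \<Rightarrow> ('a \<Rightarrow> 'x \<Rightarrow> 'x) \<Rightarrow> bool" where
  "compact_G_space G X \<phi> \<longleftrightarrow>
     compact_space X \<and> Hausdorff_space X \<and> topspace X \<noteq> {} \<and>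
     group_action G (topspace X) \<phi> \<and> (\<forall>g\<in>carrier G. homeomorphic_map X X (\<phi> g))"

definition invariant_set ::
    "('a, 'c) monoid_scheme \<Rightarrow> ('a \<Rightarrow> 'x \<Rightarrow> 'x) \<Rightarrow> 'x set \<Rightarrow> bool" where
  "invariant_set G \<phi> A \<longleftrightarrow> (\<forall>g\<in>carrier G. \<phi> g ` A \<subseteq> A)"

definition minimal_closed_invariant ::
    "('a, 'c) monoid_scheme \<Rightarrow> 'x topology \<Rightarrow> ('a \<Rightarrow> 'x \<Rightarrow> 'x) \<Rightarrow> 'x set \<Rightarrow> bool" where
  "minimal_closed_invariant G X \<phi> A \<longleftrightarrow>
     closedin X A \<and> A \<noteq> {} \<and> invariant_set G \<phi> A \<and>
     (\<forall>B. closedin X B \<and> B \<noteq> {} \<and> invariant_set G \<phi> B \<and> B \<subseteq> A \<longrightarrow> B = A)"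

definition minimal_compact_G_space ::
    "('a, 'c) monoid_scheme \<Rightarrow> 'x topology \<Rightarrow> ('a \<Rightarrow> 'x \<Rightarrow> 'x) \<Rightarrow> bool" where
  "minimal_compact_G_space G X \<phi> \<longleftrightarrow>
     compact_G_space G X \<phi> \<and> minimal_closed_invariant G X \<phi> (topspace X)"

section \<open>Probability measures and strong proximality\<close>

definition borel_of :: "'x topology \<Rightarrow> 'x measure" where
  "borel_of X = sigma (topspace X) {U. openin X U}"

text \<open>
  Probability measures on a compact Hausdorff space are Radon, that is, inner regular Borel
  probability measures. The regularity condition cannot be dropped, because the spaces in question
  need not be metrizable.
\<close>

definition Prob :: "'x topology \<Rightarrow> 'x measure set" where
  "Prob X = {\<mu>. sets \<mu> = sets (borel_of X) \<and> prob_space \<mu> \<and>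
     (\<forall>A\<in>sets \<mu>. emeasure \<mu> A = (SUP K\<in>{K. compactin X K \<and> K \<subseteq> A}. emeasure \<mu> K))}"

text \<open>
  The weak-* topology is the coarsest one for which integration against each continuous
  real-valued function is continuous.
\<close>

definition weak_star :: "'x topology \<Rightarrow> 'x measure topology" where
  "weak_star X =
     pullback_topology (Prob X)
       (\<lambda>\<mu>. \<lambda>f\<in>{f. continuous_map X euclideanreal f}. \<integral>x. f x \<partial>\<mu>)
       (product_topology (\<lambda>_. euclideanreal) {f. continuous_map X euclideanreal f})"

definition strongly_proximal ::
    "('a, 'c) monoid_scheme \<Rightarrow> 'x topology \<Rightarrow> ('a \<Rightarrow> 'x \<Rightarrow> 'x) \<Rightarrow> bool" where
  "strongly_proximal G X \<phi> \<longleftrightarrow>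
     (\<forall>\<mu>\<in>Prob X. \<exists>x\<in>topspace X.
        return (borel_of X) x \<in>
          weak_star X closure_of {distr \<mu> (borel_of X) (\<phi> g) | g. g \<in> carrier G})"

definition G_boundary ::
    "('a, 'c) monoid_scheme \<Rightarrow> 'x topology \<Rightarrow> ('a \<Rightarrow> 'x \<Rightarrow> 'x) \<Rightarrow> bool" where
  "G_boundary G X \<phi> \<longleftrightarrow> minimal_compact_G_space G X \<phi> \<and> strongly_proximal G X \<phi>"

section \<open>The Furstenberg boundary\<close>

definition equivariant_quotient ::
    "('a, 'c) monoid_scheme \<Rightarrow> 'x topology \<Rightarrow> ('a \<Rightarrow> 'x \<Rightarrow> 'x) \<Rightarrow>
      'y topology \<Rightarrow> ('a \<Rightarrow> 'y \<Rightarrow> 'y) \<Rightarrow> ('x \<Rightarrow> 'y) \<Rightarrow> bool" where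
  "equivariant_quotient G X \<phi> Y \<psi> f \<longleftrightarrow>
     continuous_map X Y f \<and> f ` topspace X = topspace Y \<and>
     (\<forall>g\<in>carrier G. \<forall>x\<in>topspace X. f (\<phi> g x) = \<psi> g (f x))"

text \<open>
  A definition cannot quantify over all types, so the universal property is stated for spaces whose
  points have type \<^typ>\<open>'a set set\<close>, where \<^typ>\<open>'a\<close> is the type of the group elements. This loses
  nothing: a minimal compact G-space is the closure of an orbit and therefore injects into
  the power set of the power set of the group. Lemma \<open>furstenberg_boundary_universal\<close> below derives
  the universal property for spaces over arbitrary types. For the same reason the Furstenberg
  boundary itself can be realised on \<^typ>\<open>'a set set\<close> (\<open>furstenberg_boundary_small_model\<close>).
\<close>

definition is_furstenberg_boundary ::
    "('a, 'c) monoid_scheme \<Rightarrow> 'x topology \<Rightarrow> ('a \<Rightarrow> 'x \<Rightarrow> 'x) \<Rightarrow> bool" where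
  "is_furstenberg_boundary G X \<phi> \<longleftrightarrow>
     G_boundary G X \<phi> \<and>
     (\<forall>(Y :: 'a set set topology) \<psi>. G_boundary G Y \<psi> \<longrightarrow>
        (\<exists>f. equivariant_quotient G X \<phi> Y \<psi> f))"

definition furstenberg_boundary ::
    "('a, 'c) monoid_scheme \<Rightarrow> 'a set set topology \<times> ('a \<Rightarrow> 'a set set \<Rightarrow> 'a set set)" where
  "furstenberg_boundary G = (SOME (X, \<phi>). is_furstenberg_boundary G X \<phi>)"

lemma space_borel_of [simp]: "space (borel_of X) = topspace X"
  unfolding borel_of_def by (rule space_measure_of) (auto dest: openin_subset)

lemma sets_borel_of: "sets (borel_of X) = sigma_sets (topspace X) {U. openin X U}"
  unfolding borel_of_def by (rule sets_measure_of) (auto dest: openin_subset)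

lemma closedin_borel_of: "closedin X K \<Longrightarrow> K \<in> sets (borel_of X)"
proof -
  assume K: "closedin X K"
  then have "topspace X - K \<in> sets (borel_of X)"
    unfolding sets_borel_of by (intro sigma_sets.Basic) (auto simp: closedin_def)
  then have "space (borel_of X) - (topspace X - K) \<in> sets (borel_of X)"
    by (rule sets.compl_sets)
  with closedin_subset[OF K] show "K \<in> sets (borel_of X)"
    by (simp add: double_diff)
qed

lemma measurable_borel_of: "continuous_map X Y f \<Longrightarrow> f \<in> borel_of X \<rightarrow>\<^sub>M borel_of Y"
  unfolding borel_of_def[of Y]
proof (rule measurable_measure_of)
  assume f: "continuous_map X Y f"
  show "{U. openin Y U} \<subseteq> Pow (topspace Y)" by (auto dest: openin_subset)
  show "f \<in> space (borel_of X) \<rightarrow> topspace Y"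
    using f by (auto simp: continuous_map_def)
  fix U assume "U \<in> {U. openin Y U}"
  then have "openin X {x \<in> topspace X. f x \<in> U}"
    using f by (auto simp: continuous_map_def)
  moreover have "{x \<in> topspace X. f x \<in> U} = f -` U \<inter> space (borel_of X)" by auto
  ultimately show "f -` U \<inter> space (borel_of X) \<in> sets (borel_of X)"
    by (auto simp: sets_borel_of)
qed

lemma continuous_borel_measurable:
  assumes "continuous_map X euclideanreal f"
  shows "f \<in> borel_measurable (borel_of X)"
proof -
  have "sets (borel_of euclideanreal) = sets (borel :: real measure)"
    by (simp add: borel_of_def borel_def)
  then show ?thesis
    using measurable_borel_of[OF assms] by (simp cong: measurable_cong_sets)
qed

lemma Prob_distr:
  assumes f: "continuous_map X Y f" and Y: "Hausdorff_space Y" and \<mu>: "\<mu> \<in> Prob X"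
  shows "distr \<mu> (borel_of Y) f \<in> Prob Y"
proof -
  have s: "sets \<mu> = sets (borel_of X)" and p: "prob_space \<mu>"
    and r: "\<And>A. A \<in> sets \<mu> \<Longrightarrow>
      emeasure \<mu> A = (SUP K\<in>{K. compactin X K \<and> K \<subseteq> A}. emeasure \<mu> K)"
    using \<mu> unfolding Prob_def by blast+
  have sp: "space \<mu> = topspace X"
    using sets_eq_imp_space_eq[OF s] by simp
  have m: "f \<in> \<mu> \<rightarrow>\<^sub>M borel_of Y"
    using measurable_borel_of[OF f] s by (simp cong: measurable_cong_sets)
  let ?\<nu> = "distr \<mu> (borel_of Y) f"
  have "emeasure ?\<nu> A = (SUP K\<in>{K. compactin Y K \<and> K \<subseteq> A}. emeasure ?\<nu> K)"
    if A: "A \<in> sets ?\<nu>" for A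
  proof (rule antisym)
    have A': "A \<in> sets (borel_of Y)" using A by simp
    have A'': "f -` A \<inter> space \<mu> \<in> sets \<mu>" using m A' by (rule measurable_sets)
    have "emeasure ?\<nu> A = emeasure \<mu> (f -` A \<inter> space \<mu>)"
      using m A' by (rule emeasure_distr)
    also have "\<dots> = (SUP K\<in>{K. compactin X K \<and> K \<subseteq> f -` A \<inter> space \<mu>}. emeasure \<mu> K)"
      by (rule r[OF A''])
    also have "\<dots> \<le> (SUP K\<in>{K. compactin Y K \<and> K \<subseteq> A}. emeasure ?\<nu> K)"
    proof (rule SUP_least)
      fix K assume "K \<in> {K. compactin X K \<and> K \<subseteq> f -` A \<inter> space \<mu>}"
      then have K: "compactin X K" "K \<subseteq> f -` A \<inter> space \<mu>" by auto
      have c: "compactin Y (f ` K)" using K(1) f by (rule image_compactin)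
      have b: "f ` K \<in> sets (borel_of Y)"
        using compactin_imp_closedin[OF Y c] by (rule closedin_borel_of)
      have "emeasure \<mu> K \<le> emeasure \<mu> (f -` (f ` K) \<inter> space \<mu>)"
        using K(2) measurable_sets[OF m b] by (intro emeasure_mono) auto
      also have "\<dots> = emeasure ?\<nu> (f ` K)"
        using m b by (rule emeasure_distr[symmetric])
      also have "\<dots> \<le> (SUP K\<in>{K. compactin Y K \<and> K \<subseteq> A}. emeasure ?\<nu> K)"
        using c K(2) by (intro SUP_upper) auto
      finally show "emeasure \<mu> K \<le> (SUP K\<in>{K. compactin Y K \<and> K \<subseteq> A}. emeasure ?\<nu> K)" .
    qed
    finally show "emeasure ?\<nu> A \<le> (SUP K\<in>{K. compactin Y K \<and> K \<subseteq> A}. emeasure ?\<nu> K)" .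
    show "(SUP K\<in>{K. compactin Y K \<and> K \<subseteq> A}. emeasure ?\<nu> K) \<le> emeasure ?\<nu> A"
      using A by (intro SUP_least emeasure_mono) auto
  qed
  then show ?thesis
    using prob_space.prob_space_distr[OF p m] by (simp add: Prob_def)
qed

lemma topspace_weak_star [simp]: "topspace (weak_star X) = Prob X"
  unfolding weak_star_def topspace_pullback_topology by auto

lemma continuous_map_distr:
  assumes f: "continuous_map X Y f" and Y: "Hausdorff_space Y"
  shows "continuous_map (weak_star X) (weak_star Y) (\<lambda>\<mu>. distr \<mu> (borel_of Y) f)"
proof -
  let ?C = "\<lambda>Z. {h. continuous_map Z euclideanreal h}"
  let ?I = "\<lambda>\<mu>. \<lambda>h\<in>?C X. \<integral>x. h x \<partial>\<mu>"
  have 1: "continuous_map (weak_star X) (product_topology (\<lambda>_. euclideanreal) (?C X)) ?I"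
    unfolding weak_star_def
    using continuous_map_pullback[OF continuous_map_id] by (simp add: comp_def)
  have 2: "continuous_map (weak_star X) euclideanreal (\<lambda>\<mu>. \<integral>x. h x \<partial>\<mu>)"
    if "h \<in> ?C X" for h
  proof -
    have "continuous_map (weak_star X) euclideanreal (\<lambda>\<mu>. ?I \<mu> h)"
      using 1 that unfolding continuous_map_componentwise by blast
    then show ?thesis using that by simp
  qed
  have 3: "(\<integral>y. h y \<partial>distr \<mu> (borel_of Y) f) = (\<integral>x. h (f x) \<partial>\<mu>)"
    if "h \<in> ?C Y" "\<mu> \<in> Prob X" for h \<mu>
  proof (rule integral_distr)
    show "f \<in> \<mu> \<rightarrow>\<^sub>M borel_of Y"
      using measurable_borel_of[OF f] that(2) by (simp add: Prob_def cong: measurable_cong_sets)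
    show "h \<in> borel_measurable (borel_of Y)"
      using that(1) by (simp add: continuous_borel_measurable)
  qed
  have "continuous_map (weak_star X) euclideanreal (\<lambda>\<mu>. \<integral>y. h y \<partial>distr \<mu> (borel_of Y) f)"
    if h: "h \<in> ?C Y" for h
  proof -
    have "(\<lambda>x. h (f x)) \<in> ?C X"
      using h continuous_map_compose[OF f, of euclideanreal h] by (simp add: comp_def)
    from 2[OF this] show ?thesis
      by (rule continuous_map_eq) (simp add: 3[OF h])
  qed
  then have "continuous_map (weak_star X) (product_topology (\<lambda>_. euclideanreal) (?C Y))
      ((\<lambda>\<mu>. \<lambda>h\<in>?C Y. \<integral>y. h y \<partial>\<mu>) \<circ> (\<lambda>\<mu>. distr \<mu> (borel_of Y) f))"
    unfolding continuous_map_componentwise by (auto simp: comp_def)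
  moreover have "topspace (weak_star X) \<subseteq> (\<lambda>\<mu>. distr \<mu> (borel_of Y) f) -` Prob Y"
    using Prob_distr[OF f Y] by auto
  ultimately show ?thesis
    unfolding weak_star_def[of Y] by (intro continuous_map_pullback') auto
qed

lemma return_distr_borel_of:
  assumes "continuous_map X Y f" "x \<in> topspace X"
  shows "distr (return (borel_of X) x) (borel_of Y) f = return (borel_of Y) (f x)"
  using distr_return[OF measurable_borel_of[OF assms(1)]] assms(2) by simp

lemma compact_G_space_transport:
  fixes G (structure)
  assumes X: "compact_G_space G X \<phi>" and ed: "homeomorphic_maps X Z e d"
  shows "compact_G_space G Z (\<lambda>g. \<lambda>z\<in>topspace Z. e (\<phi> g (d z)))" (is "compact_G_space G Z ?\<theta>")
proof -
  have ga: "group_action G (topspace X) \<phi>" using X by (simp add: compact_G_space_def)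
  interpret ga: group_action G "topspace X" \<phi> by (rule ga)
  interpret hom: group_hom G "BijGroup (topspace X)" \<phi> by (rule ga.group_hom)
  have e: "homeomorphic_map X Z e" and d: "homeomorphic_map Z X d"
    using ed homeomorphic_maps_map homeomorphic_maps_sym by blast+
  have hs: "X homeomorphic_space Z" using ed by (auto simp: homeomorphic_space_def)
  have ee: "e x \<in> topspace Z" "d (e x) = x" if "x \<in> topspace X" for x
    using ed that unfolding homeomorphic_maps_def by (auto simp: continuous_map_def)
  have dd: "d z \<in> topspace X" "e (d z) = z" if "z \<in> topspace Z" for z
    using ed that unfolding homeomorphic_maps_def by (auto simp: continuous_map_def)
  have hg: "homeomorphic_map Z Z (?\<theta> g)" if g: "g \<in> carrier G" for g
  proof -
    have "homeomorphic_map X X (\<phi> g)" using X g by (simp add: compact_G_space_def)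
    then have "homeomorphic_map Z Z (e \<circ> (\<phi> g \<circ> d))"
      by (intro homeomorphic_map_compose[OF homeomorphic_map_compose[OF d] e])
    then show ?thesis
      by (rule homeomorphic_map_eq) simp
  qed
  have bij: "?\<theta> g \<in> Bij (topspace Z)" if "g \<in> carrier G" for g
  proof -
    have "bij_betw (?\<theta> g) (topspace Z) (topspace Z)"
      using hg[OF that] homeomorphic_imp_surjective_map homeomorphic_imp_injective_map
      unfolding bij_betw_def by blast
    then show ?thesis by (simp add: Bij_def)
  qed
  have mult: "?\<theta> (g \<otimes> h) = compose (topspace Z) (?\<theta> g) (?\<theta> h)"
    if "g \<in> carrier G" "h \<in> carrier G" for g h
  proof
    fix z
    show "?\<theta> (g \<otimes> h) z = compose (topspace Z) (?\<theta> g) (?\<theta> h) z"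
    proof (cases "z \<in> topspace Z")
      case True
      have "\<phi> h (d z) \<in> topspace X"
        using ga.element_image[OF that(2) dd(1)[OF True] refl] .
      then show ?thesis
        using True that ga.composition_rule[OF dd(1)[OF True] that] by (simp add: compose_def ee)
    qed (simp add: compose_def)
  qed
  have "?\<theta> \<in> hom G (BijGroup (topspace Z))"
  proof (rule homI)
    fix g h assume gh: "g \<in> carrier G" "h \<in> carrier G"
    show "?\<theta> g \<in> carrier (BijGroup (topspace Z))"
      using bij[OF gh(1)] by (simp add: BijGroup_def)
    show "?\<theta> (g \<otimes> h) = ?\<theta> g \<otimes>\<^bsub>BijGroup (topspace Z)\<^esub> ?\<theta> h"
      unfolding mult[OF gh] using bij[OF gh(1)] bij[OF gh(2)] by (simp add: BijGroup_def)
  qed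
  then have "group_action G (topspace Z) ?\<theta>"
    using hom.G.is_group group_BijGroup
    by (simp add: group_action_def group_hom_def group_hom_axioms_def)
  moreover have "topspace Z \<noteq> {}"
    using X ee(1) unfolding compact_G_space_def by blast
  moreover have "compact_space Z" "Hausdorff_space Z"
    using X homeomorphic_compact_space[OF hs] homeomorphic_Hausdorff_space[OF hs]
    by (simp_all add: compact_G_space_def)
  ultimately show ?thesis
    using hg by (simp add: compact_G_space_def)
qed

lemma G_boundary_transport:
  assumes X: "G_boundary G X \<phi>" and ed: "homeomorphic_maps X Z e d"
  shows "G_boundary G Z (\<lambda>g. \<lambda>z\<in>topspace Z. e (\<phi> g (d z)))" (is "G_boundary G Z ?\<theta>")
proof -
  have cX: "compact_G_space G X \<phi>"
    and mX: "minimal_closed_invariant G X \<phi> (topspace X)"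
    and pX: "strongly_proximal G X \<phi>"
    using X by (auto simp: G_boundary_def minimal_compact_G_space_def)
  have cZ: "compact_G_space G Z ?\<theta>" using cX ed by (rule compact_G_space_transport)
  have HX: "Hausdorff_space X" and HZ: "Hausdorff_space Z"
    using cX cZ by (auto simp: compact_G_space_def)
  have ec: "continuous_map X Z e" and dc: "continuous_map Z X d"
    using ed by (auto simp: homeomorphic_maps_def)
  have d: "homeomorphic_map Z X d"
    using ed homeomorphic_maps_map homeomorphic_maps_sym by blast
  have ee: "e x \<in> topspace Z" "d (e x) = x" if "x \<in> topspace X" for x
    using ed that unfolding homeomorphic_maps_def by (auto simp: continuous_map_def)
  have dd: "d z \<in> topspace X" "e (d z) = z" if "z \<in> topspace Z" for z
    using ed that unfolding homeomorphic_maps_def by (auto simp: continuous_map_def)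
  have act: "continuous_map X X (\<phi> g)" "continuous_map Z Z (?\<theta> g)" if "g \<in> carrier G" for g
    using cX cZ that by (auto simp: compact_G_space_def homeomorphic_imp_continuous_map)
  have actX: "\<phi> g x \<in> topspace X" if "g \<in> carrier G" "x \<in> topspace X" for g x
    using act(1)[OF that(1)] that(2) by (auto simp: continuous_map_def)
  have "minimal_closed_invariant G Z ?\<theta> (topspace Z)"
    unfolding minimal_closed_invariant_def
  proof (intro conjI allI impI)
    show "closedin Z (topspace Z)" by simp
    show "topspace Z \<noteq> {}" using cZ by (simp add: compact_G_space_def)
    show "invariant_set G ?\<theta> (topspace Z)"
      using actX dd ee by (auto simp: invariant_set_def)
    fix B assume B: "closedin Z B \<and> B \<noteq> {} \<and> invariant_set G ?\<theta> B \<and> B \<subseteq> topspace Z"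
    have cB: "closedin X (d ` B)"
      using B d homeomorphic_map_closedness by blast
    have iB: "invariant_set G \<phi> (d ` B)"
      unfolding invariant_set_def
    proof (intro ballI subsetI)
      fix g x assume g: "g \<in> carrier G" and "x \<in> \<phi> g ` d ` B"
      then obtain z where z: "z \<in> B" "x = \<phi> g (d z)" by auto
      have zZ: "z \<in> topspace Z" using B z by auto
      have "?\<theta> g z \<in> B" using B g z by (auto simp: invariant_set_def)
      moreover have "d (?\<theta> g z) = x"
        using zZ z(2) ee(2)[OF actX[OF g dd(1)[OF zZ]]] by simp
      ultimately show "x \<in> d ` B" by (metis image_eqI)
    qed
    have dB: "d ` B = topspace X"
      using mX cB iB B closedin_subset[OF cB] unfolding minimal_closed_invariant_def by blast
    then show "B = topspace Z"
    proof (intro antisym subsetI)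
      fix z assume z: "z \<in> topspace Z"
      from dd(1)[OF this] dB have "d z \<in> d ` B" by simp
      then obtain b where b: "b \<in> B" "d z = d b" by (rule imageE)
      then have "b \<in> topspace Z" using B by blast
      have "z = e (d z)" by (rule dd(2)[OF z, symmetric])
      also have "\<dots> = b" unfolding b(2) by (rule dd(2)) fact
      finally show "z \<in> B" using b(1) by simp
    qed (use B in blast)
  qed
  moreover have "strongly_proximal G Z ?\<theta>"
    unfolding strongly_proximal_def
  proof
    fix \<nu> assume \<nu>: "\<nu> \<in> Prob Z"
    let ?\<mu> = "distr \<nu> (borel_of X) d"
    let ?T = "\<lambda>\<mu>. distr \<mu> (borel_of Z) e"
    let ?O = "{distr ?\<mu> (borel_of X) (\<phi> g) | g. g \<in> carrier G}"
    obtain x where x: "x \<in> topspace X" "return (borel_of X) x \<in> weak_star X closure_of ?O"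
      using pX Prob_distr[OF dc HX \<nu>] by (auto simp: strongly_proximal_def)
    have sets: "sets \<nu> = sets (borel_of Z)" using \<nu> by (simp add: Prob_def)
    have "?T ` ?O \<subseteq> {distr \<nu> (borel_of Z) (?\<theta> g) | g. g \<in> carrier G}"
    proof
      fix \<kappa> assume "\<kappa> \<in> ?T ` ?O"
      then obtain g where g: "g \<in> carrier G"
        and l: "\<kappa> = ?T (distr ?\<mu> (borel_of X) (\<phi> g))" by auto
      have m: "d \<in> \<nu> \<rightarrow>\<^sub>M borel_of X" "\<phi> g \<in> borel_of X \<rightarrow>\<^sub>M borel_of X" "e \<in> borel_of X \<rightarrow>\<^sub>M borel_of Z"
        using measurable_borel_of[OF dc] measurable_borel_of[OF ec]
          measurable_borel_of[OF act(1)[OF g]] sets by (simp_all cong: measurable_cong_sets)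
      have "\<kappa> = distr \<nu> (borel_of Z) (e \<circ> (\<phi> g \<circ> d))"
        unfolding l using m by (simp add: distr_distr measurable_comp)
      also have "\<dots> = distr \<nu> (borel_of Z) (?\<theta> g)"
        using sets_eq_imp_space_eq[OF sets] by (intro distr_cong) auto
      finally show "\<kappa> \<in> {distr \<nu> (borel_of Z) (?\<theta> g) | g. g \<in> carrier G}" using g by blast
    qed
    then have "?T ` (weak_star X closure_of ?O) \<subseteq>
        weak_star Z closure_of {distr \<nu> (borel_of Z) (?\<theta> g) | g. g \<in> carrier G}"
      using continuous_map_image_closure_subset[OF continuous_map_distr[OF ec HZ], of ?O]
        closure_of_mono by blast
    moreover have "?T (return (borel_of X) x) = return (borel_of Z) (e x)"
      using return_distr_borel_of[OF ec x(1)] .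
    ultimately have "return (borel_of Z) (e x) \<in>
        weak_star Z closure_of {distr \<nu> (borel_of Z) (?\<theta> g) | g. g \<in> carrier G}"
      using x(2) by (metis (no_types, lifting) image_subset_iff)
    then show "\<exists>z\<in>topspace Z. return (borel_of Z) z \<in>
        weak_star Z closure_of {distr \<nu> (borel_of Z) (?\<theta> g) | g. g \<in> carrier G}"
      using ee(1)[OF x(1)] by blast
  qed
  ultimately show ?thesis
    using cZ by (simp add: G_boundary_def minimal_compact_G_space_def)
qed

lemma minimal_compact_G_space_embedding:
  fixes G :: "('a, 'c) monoid_scheme" and X :: "'x topology"
  assumes X: "minimal_compact_G_space G X \<phi>"
  obtains e :: "'x \<Rightarrow> 'a set set" where "inj_on e (topspace X)"
proof -
  have cX: "compact_G_space G X \<phi>"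
    and mX: "minimal_closed_invariant G X \<phi> (topspace X)"
    using X by (auto simp: minimal_compact_G_space_def)
  interpret ga: group_action G "topspace X" \<phi>
    using cX by (simp add: compact_G_space_def)
  obtain x0 where x0: "x0 \<in> topspace X" using cX unfolding compact_G_space_def by blast
  define Orb where "Orb = orbit G \<phi> x0"
  have OX: "Orb \<subseteq> topspace X"
    using x0 ga.element_image by (auto simp: Orb_def orbit_def)
  have inv: "\<phi> g ` Orb \<subseteq> Orb" if "g \<in> carrier G" for g
  proof
    interpret hom: group_hom G "BijGroup (topspace X)" \<phi> by (rule ga.group_hom)
    fix y assume "y \<in> \<phi> g ` Orb"
    then obtain h where h: "h \<in> carrier G" "y = \<phi> g (\<phi> h x0)"
      by (auto simp: Orb_def orbit_def)
    then have "y = \<phi> (g \<otimes>\<^bsub>G\<^esub> h) x0"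
      using ga.composition_rule[OF x0 that h(1)] by simp
    then show "y \<in> Orb"
      using hom.G.m_closed[OF that h(1)] unfolding Orb_def orbit_def by blast
  qed
  have "invariant_set G \<phi> (X closure_of Orb)"
    unfolding invariant_set_def
  proof
    fix g assume g: "g \<in> carrier G"
    then have "continuous_map X X (\<phi> g)"
      using cX by (simp add: compact_G_space_def homeomorphic_imp_continuous_map)
    then show "\<phi> g ` (X closure_of Orb) \<subseteq> X closure_of Orb"
      using continuous_map_image_closure_subset closure_of_mono[OF inv[OF g]] by blast
  qed
  moreover have "X closure_of Orb \<noteq> {}"
    using closure_of_subset[OF OX] ga.orbit_refl[OF x0] by (auto simp: Orb_def)
  ultimately have dense: "X closure_of Orb = topspace X"
    using mX closure_of_subset_topspace[of X Orb] unfolding minimal_closed_invariant_def by auto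
  define e where "e x = {A. x \<in> X closure_of ((\<lambda>g. \<phi> g x0) ` (A \<inter> carrier G))}" for x
  have "inj_on e (topspace X)"
  proof (rule inj_onI, rule ccontr)
    fix x y assume x: "x \<in> topspace X" and y: "y \<in> topspace X" and eq: "e x = e y" and ne: "x \<noteq> y"
    obtain U V where UV: "openin X U" "openin X V" "x \<in> U" "y \<in> V" "disjnt U V"
      using cX x y ne unfolding compact_G_space_def Hausdorff_space_def by blast
    define A where "A = {g \<in> carrier G. \<phi> g x0 \<in> U}"
    have img: "(\<lambda>g. \<phi> g x0) ` (A \<inter> carrier G) = Orb \<inter> U"
      by (auto simp: A_def Orb_def orbit_def)
    have "x \<in> X closure_of (Orb \<inter> U)"
      unfolding in_closure_of
    proof (intro conjI allI impI)
      show "x \<in> topspace X" by fact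
      fix T assume "x \<in> T \<and> openin X T"
      then have "x \<in> U \<inter> T" "openin X (U \<inter> T)" using UV by auto
      moreover have "x \<in> X closure_of Orb" using dense x by simp
      ultimately have "\<exists>y. y \<in> Orb \<and> y \<in> U \<inter> T"
        unfolding in_closure_of by blast
      then show "\<exists>y. y \<in> Orb \<inter> U \<and> y \<in> T" by blast
    qed
    moreover have "y \<notin> X closure_of (Orb \<inter> U)"
      using UV unfolding in_closure_of disjnt_def by blast
    ultimately show False 
      using eq unfolding e_def set_eq_iff mem_Collect_eq img[symmetric] by blast
  qed
  then show thesis by (rule that)
qed

lemma G_boundary_small_model:
  fixes G :: "('a, 'c) monoid_scheme" and X :: "'x topology"
  assumes X: "G_boundary G X \<phi>"
  obtains Z :: "'a set set topology" and \<theta> e d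
    where "G_boundary G Z \<theta>" "equivariant_quotient G X \<phi> Z \<theta> e" "equivariant_quotient G Z \<theta> X \<phi> d"
proof -
  have mX: "minimal_compact_G_space G X \<phi>" using X by (simp add: G_boundary_def)
  then interpret ga: group_action G "topspace X" \<phi>
    by (simp add: minimal_compact_G_space_def compact_G_space_def)
  obtain e :: "'x \<Rightarrow> 'a set set" where inj: "inj_on e (topspace X)"
    using mX by (rule minimal_compact_G_space_embedding)
  define d where "d = inv_into (topspace X) e"
  define Z where "Z = pullback_topology (e ` topspace X) d X"
  have de: "d (e x) = x" if "x \<in> topspace X" for x
    using inj that by (simp add: d_def)
  have tZ: "topspace Z = e ` topspace X"
    by (auto simp: Z_def topspace_pullback_topology de)
  have dc: "continuous_map Z X d"
    unfolding Z_def using continuous_map_pullback[OF continuous_map_id] by (simp add: comp_def)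
  have ec: "continuous_map X Z e"
    unfolding Z_def
  proof (rule continuous_map_pullback')
    show "continuous_map X X (d \<circ> e)"
      using continuous_map_id by (rule continuous_map_eq) (simp add: de)
  qed auto
  have ed: "homeomorphic_maps X Z e d"
    using ec dc by (auto simp: homeomorphic_maps_def tZ de)
  let ?\<theta> = "\<lambda>g. \<lambda>z\<in>topspace Z. e (\<phi> g (d z))"
  have act: "\<phi> g x \<in> topspace X" if "g \<in> carrier G" "x \<in> topspace X" for g x
    using ga.element_image[OF that refl] .
  show thesis
  proof
    show "G_boundary G Z ?\<theta>" using X ed by (rule G_boundary_transport)
    show "equivariant_quotient G X \<phi> Z ?\<theta> e"
      using ec by (auto simp: equivariant_quotient_def tZ de)
    have "d ` topspace Z = topspace X"
      by (simp add: tZ image_image de)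
    then show "equivariant_quotient G Z ?\<theta> X \<phi> d"
      using dc by (auto simp: equivariant_quotient_def tZ de act)
  qed
qed

lemma equivariant_quotient_trans:
  assumes "equivariant_quotient G X \<phi> Y \<psi> f" "equivariant_quotient G Y \<psi> Z \<theta> h"
  shows "equivariant_quotient G X \<phi> Z \<theta> (h \<circ> f)"
proof -
  have "f x \<in> topspace Y" if "x \<in> topspace X" for x
    using assms(1) that by (auto simp: equivariant_quotient_def)
  then show ?thesis
    using assms continuous_map_compose[of X Y f Z h]
    unfolding equivariant_quotient_def image_comp[symmetric] by simp
qed

lemma furstenberg_boundary_universal:
  fixes G :: "('a, 'c) monoid_scheme" and X :: "'x topology" and Y :: "'y topology"
  assumes X: "is_furstenberg_boundary G X \<phi>" and Y: "G_boundary G Y \<psi>"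
  shows "\<exists>f. equivariant_quotient G X \<phi> Y \<psi> f"
proof -
  obtain Z :: "'a set set topology" and \<theta> d
    where Z: "G_boundary G Z \<theta>" "equivariant_quotient G Z \<theta> Y \<psi> d"
    using Y by (rule G_boundary_small_model)
  obtain f where "equivariant_quotient G X \<phi> Z \<theta> f"
    using X Z(1) by (auto simp: is_furstenberg_boundary_def)
  then show ?thesis using equivariant_quotient_trans Z(2) by blast
qed

lemma furstenberg_boundary_small_model:
  fixes G :: "('a, 'c) monoid_scheme" and X :: "'x topology"
  assumes X: "is_furstenberg_boundary G X \<phi>"
  shows "case furstenberg_boundary G of (Z, \<theta>) \<Rightarrow> is_furstenberg_boundary G Z \<theta>"
proof -
  have "G_boundary G X \<phi>" using X by (simp add: is_furstenberg_boundary_def)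
  then obtain Z :: "'a set set topology" and \<theta> d
    where Z: "G_boundary G Z \<theta>" "equivariant_quotient G Z \<theta> X \<phi> d"
    by (rule G_boundary_small_model)
  have "is_furstenberg_boundary G Z \<theta>"
    using X Z equivariant_quotient_trans unfolding is_furstenberg_boundary_def by blast
  then show ?thesis
    unfolding furstenberg_boundary_def
    using someI[of "\<lambda>(Z, \<theta>). is_furstenberg_boundary G Z \<theta>" "(Z, \<theta>)"] by simp
qed

section \<open>Uniformly recurrent subgroups\<close>

definition Sub :: "('a, 'c) monoid_scheme \<Rightarrow> 'a set topology" where
  "Sub G =
     pullback_topology {H. subgroup H G} (\<lambda>H. \<lambda>g\<in>carrier G. g \<in> H)
       (product_topology (\<lambda>_. discrete_topology (UNIV :: bool set)) (carrier G))"

definition conj_action :: "('a, 'c) monoid_scheme \<Rightarrow> 'a \<Rightarrow> 'a set \<Rightarrow> 'a set" where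
  "conj_action G = (\<lambda>g. \<lambda>H\<in>{H. subgroup H G}. g <#\<^bsub>G\<^esub> H #>\<^bsub>G\<^esub> (inv\<^bsub>G\<^esub> g))"

definition URS :: "('a, 'c) monoid_scheme \<Rightarrow> 'a set set \<Rightarrow> bool" where
  "URS G \<U> \<longleftrightarrow> minimal_closed_invariant G (Sub G) (conj_action G) \<U>"

text \<open>
  For a minimal compact G-space there is exactly one URS in the closure of the set of point
  stabilizers, so the definite description below is proper.
\<close>

definition stabilizer_URS ::
    "('a, 'c) monoid_scheme \<Rightarrow> 'x topology \<Rightarrow> ('a \<Rightarrow> 'x \<Rightarrow> 'x) \<Rightarrow> 'a set set" where
  "stabilizer_URS G X \<phi> =
     (THE \<U>. URS G \<U> \<and> \<U> \<subseteq> Sub G closure_of (stabilizer G \<phi> ` topspace X))"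

definition furstenberg_URS :: "('a, 'c) monoid_scheme \<Rightarrow> 'a set set" where
  "furstenberg_URS G = (case furstenberg_boundary G of (X, \<phi>) \<Rightarrow> stabilizer_URS G X \<phi>)"

definition class_F :: "('a, 'c) monoid_scheme \<Rightarrow> bool" where
  "class_F Q \<longleftrightarrow> is_singleton (furstenberg_URS Q)"

definition normal_F :: "('a, 'c) monoid_scheme \<Rightarrow> 'a set set" where
  "normal_F G = {N. N \<lhd> G \<and> class_F (G Mod N)}"

definition cl :: "('a, 'c) monoid_scheme \<Rightarrow> 'a set set \<Rightarrow> 'a set \<Rightarrow> 'a set" where
  "cl G \<N> H = (\<Inter>N\<in>\<N>. H <#>\<^bsub>G\<^esub> N)"

definition comeager_in :: "'x topology \<Rightarrow> 'x set \<Rightarrow> bool" where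
  "comeager_in X S \<longleftrightarrow>
     S \<subseteq> topspace X \<and>
     (\<exists>\<D>. countable \<D> \<and> (\<forall>U\<in>\<D>. openin X U \<and> X closure_of U = topspace X) \<and>
          topspace X \<inter> \<Inter>\<D> \<subseteq> S)"

end

theory Submission
  imports Defs "HOL-Algebra.Zassenhaus"
begin

text \<open>
  Fix a normal subgroup \<open>N\<close> of \<open>G\<close> such that the Furstenberg URS of \<open>G/N\<close> is a singleton. The
  product \<open>HN\<close> turns out to be the same for all \<open>H\<close> in the Furstenberg URS \<open>A\<close> of \<open>G\<close>, so that the
  comeager set of the theorem can be taken to be the whole of \<open>A\<close>. Since \<open>A\<close> is invariant under
  conjugation, the common value of \<open>HN\<close> is normal, and \<open>M\<close> is the intersection of these values.

  The product is constant because \<open>A\<close> is minimal already for the conjugation action of \<open>N\<close>: if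
  \<open>H\<close> and \<open>H\<^sub>1\<close> lie in \<open>A\<close>, then \<open>H\<^sub>1\<close> is a limit of \<open>N\<close>-conjugates of \<open>H\<close>, so every \<open>h \<in> H\<^sub>1\<close> lies in
  one of them, and hence in \<open>HN\<close>. This is \<open>furstenberg_URS_product_constant\<close>. The minimality comes from
  a second description of \<open>A\<close>. Write \<open>X\<close>, \<open>Y\<close>, \<open>Z\<close> for the Furstenberg boundaries of \<open>G\<close>, \<open>G/N\<close>
  and \<open>N\<close>.

  \<^item> \<open>Y\<close> is a boundary of \<open>G\<close>, and the hypothesis on \<open>G/N\<close> says that the kernel \<open>R\<close> of \<open>G\<close> acting on
    \<open>Y\<close> is the stabilizer of some point (\<open>normal_F_kernel\<close>). As \<open>X\<close> maps onto \<open>Y\<close>, all members of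
    \<open>A\<close> are contained in \<open>R\<close>.

  \<^item> Maps out of boundaries are unique, so the action of \<open>N\<close> on \<open>Z\<close> extends to \<open>G\<close>
    (\<open>normal_boundary_extends\<close>), and \<open>Z\<close> is a boundary of \<open>G\<close> that is minimal for \<open>N\<close>. Let \<open>V\<close> be
    the URS of the stabilizers \<open>R\<^sub>z\<close>, \<open>z \<in> Z\<close>. It is minimal for \<open>N\<close>, because \<open>Z\<close> is. Since \<open>X\<close>
    maps onto \<open>Z\<close>, some member of \<open>A\<close> is contained in a member of \<open>V\<close>.

  \<^item> Conversely, every \<open>R\<^sub>z\<close> fixes a state on the continuous functions on \<open>X\<close>
    (\<open>equivariant_states_exist\<close>). Strong proximality pushes this state to a point of \<open>X\<close>, whose
    stabilizer then contains a limit of conjugates of \<open>R\<^sub>z\<close>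
    (\<open>stabilizers_limit_in_stabilizer\<close>). So some member of \<open>V\<close> is contained in a member of \<open>A\<close>.

  \<^item> Two URSs related in both ways coincide (\<open>URS_antisym\<close>), so \<open>A = V\<close>.

  The third point rests on one construction, \<open>convex_contains_boundary\<close>: a compact convex set with an
  affine action of a group contains a boundary of that group. Applied to the states of \<open>X\<close> and the
  group \<open>N\<close>, it gives an \<open>N\<close>-equivariant family of states over \<open>Z\<close>. Such families form a compact convex
  set on which \<open>G\<close> acts through \<open>G/N\<close>, so this set contains a boundary of \<open>G/N\<close>. That boundary is an
  image of \<open>Y\<close>, so \<open>R\<close> acts trivially on it, and its points are \<open>R\<close>-equivariant families. Applied to
  the states on the bounded functions on a group, the same construction yields the Furstenberg
  boundary (\<open>furstenberg_boundary_exists\<close>).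

  Strong proximality is a condition on Radon measures, whereas compactness arguments produce states.
  The two are linked by the Riesz representation theorem (\<open>Riesz_state\<close>).
\<close>


section \<open>States on function spaces\<close>

text \<open>
  The functions in \<open>A\<close> matter only through their values on \<open>S\<close>, hence the last condition. It lets
  functions be added and composed on the whole type, without restricting them to \<open>S\<close>.
\<close>

locale function_space =
  fixes S :: "'s set" and A :: "('s \<Rightarrow> real) set"
  assumes const_mem: "(\<lambda>_. c) \<in> A"
    and add_mem: "f \<in> A \<Longrightarrow> h \<in> A \<Longrightarrow> (\<lambda>x. f x + h x) \<in> A"
    and scale_mem: "f \<in> A \<Longrightarrow> (\<lambda>x. c * f x) \<in> A"
    and bdd_mem: "f \<in> A \<Longrightarrow> \<exists>M. \<forall>x\<in>S. \<bar>f x\<bar> \<le> M"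
    and cong_mem: "f \<in> A \<Longrightarrow> (\<And>x. x \<in> S \<Longrightarrow> f x = h x) \<Longrightarrow> h \<in> A"

text \<open>
  A state is set to zero outside \<open>A\<close>. It is then determined by its values on \<open>A\<close>, so that the product
  topology on functionals induces the weak topology on states.
\<close>

definition states :: "'s set \<Rightarrow> ('s \<Rightarrow> real) set \<Rightarrow> (('s \<Rightarrow> real) \<Rightarrow> real) set" where
  "states S A = {q.
     (\<forall>f\<in>A. \<forall>h\<in>A. q (\<lambda>x. f x + h x) = q f + q h) \<and>
     (\<forall>f\<in>A. \<forall>c. q (\<lambda>x. c * f x) = c * q f) \<and>
     (\<forall>f\<in>A. (\<forall>x\<in>S. 0 \<le> f x) \<longrightarrow> 0 \<le> q f) \<and>
     q (\<lambda>_. 1) = 1 \<and>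
     (\<forall>f. f \<notin> A \<longrightarrow> q f = 0)}"

context function_space
begin

lemma minus_mem: "f \<in> A \<Longrightarrow> (\<lambda>x. - f x) \<in> A"
  using scale_mem[of f "-1"] by simp

lemma diff_mem: "f \<in> A \<Longrightarrow> h \<in> A \<Longrightarrow> (\<lambda>x. f x - h x) \<in> A"
  using add_mem[OF _ minus_mem, of f h] by simp

lemma sum_mem: "finite I \<Longrightarrow> (\<And>i. i \<in> I \<Longrightarrow> f i \<in> A) \<Longrightarrow> (\<lambda>x. \<Sum>i\<in>I. f i x) \<in> A"
proof (induction I rule: finite_induct)
  case empty
  then show ?case using const_mem[of 0] by simp
next
  case (insert i I)
  then show ?case using add_mem[of "f i" "\<lambda>x. \<Sum>i\<in>I. f i x"] by simp
qed

context
  fixes q assumes q: "q \<in> states S A"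
begin

lemma state_add: "f \<in> A \<Longrightarrow> h \<in> A \<Longrightarrow> q (\<lambda>x. f x + h x) = q f + q h"
  using q by (simp add: states_def)

lemma state_scale: "f \<in> A \<Longrightarrow> q (\<lambda>x. c * f x) = c * q f"
  using q by (simp add: states_def)

lemma state_nonneg: "f \<in> A \<Longrightarrow> (\<And>x. x \<in> S \<Longrightarrow> 0 \<le> f x) \<Longrightarrow> 0 \<le> q f"
  using q by (simp add: states_def)

lemma state_off: "f \<notin> A \<Longrightarrow> q f = 0"
  using q by (simp add: states_def)

lemma state_const: "q (\<lambda>_. c) = c"
proof -
  have "q (\<lambda>x. c * (\<lambda>_. 1) x) = c * q (\<lambda>_. 1)"
    by (rule state_scale[OF const_mem])
  then show ?thesis using q by (simp add: states_def)
qed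

lemma state_diff:
  assumes "f \<in> A" "h \<in> A"
  shows "q (\<lambda>x. f x - h x) = q f - q h"
proof -
  have "q (\<lambda>x. f x + (-1) * h x) = q f + (-1) * q h"
    using state_add[OF assms(1) scale_mem[OF assms(2), of "-1"]] state_scale[OF assms(2), of "-1"]
    by simp
  then show ?thesis by simp
qed

lemma state_mono:
  assumes "f \<in> A" "h \<in> A" "\<And>x. x \<in> S \<Longrightarrow> f x \<le> h x"
  shows "q f \<le> q h"
  using state_nonneg[OF diff_mem[OF assms(2,1)]] state_diff[OF assms(2,1)] assms(3) by simp

lemma state_cong:
  assumes "\<And>x. x \<in> S \<Longrightarrow> f x = h x"
  shows "q f = q h"
proof (cases "f \<in> A")
  case True
  then have h: "h \<in> A" by (rule cong_mem) (rule assms)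
  show ?thesis
    using state_mono[OF True h] state_mono[OF h True] assms by (intro antisym) auto
next
  case False
  then have "h \<notin> A" using cong_mem[of h f] assms by metis
  then show ?thesis using False by (simp add: state_off)
qed

lemma state_sum:
  "finite I \<Longrightarrow> (\<And>i. i \<in> I \<Longrightarrow> f i \<in> A) \<Longrightarrow> q (\<lambda>x. \<Sum>i\<in>I. f i x) = (\<Sum>i\<in>I. q (f i))"
proof (induction I rule: finite_induct)
  case empty
  then show ?case using state_const[of 0] by simp
next
  case (insert i I)
  then show ?case using state_add[of "f i" "\<lambda>x. \<Sum>i\<in>I. f i x"] sum_mem[of I f] by simp
qed

lemma state_le: "f \<in> A \<Longrightarrow> (\<And>x. x \<in> S \<Longrightarrow> f x \<le> c) \<Longrightarrow> q f \<le> c"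
  using state_mono[OF _ const_mem, of f c] by (simp add: state_const)

lemma state_ge: "f \<in> A \<Longrightarrow> (\<And>x. x \<in> S \<Longrightarrow> c \<le> f x) \<Longrightarrow> c \<le> q f"
  using state_mono[OF const_mem, of f c] by (simp add: state_const)

end

end

definition Cont :: "'x topology \<Rightarrow> ('x \<Rightarrow> real) set" where
  "Cont X = {f. continuous_map X euclideanreal f}"

lemma function_space_Cont:
  assumes X: "compact_space X"
  shows "function_space (topspace X) (Cont X)"
proof
  fix f h :: "'a \<Rightarrow> real" and c :: real
  show "(\<lambda>_. c) \<in> Cont X" by (simp add: Cont_def)
  show "f \<in> Cont X \<Longrightarrow> h \<in> Cont X \<Longrightarrow> (\<lambda>x. f x + h x) \<in> Cont X"
    by (auto simp: Cont_def intro: continuous_intros)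
  show "f \<in> Cont X \<Longrightarrow> (\<lambda>x. c * f x) \<in> Cont X"
    by (auto simp: Cont_def intro: continuous_intros)
  show "h \<in> Cont X" if "f \<in> Cont X" "\<And>x. x \<in> topspace X \<Longrightarrow> f x = h x"
    using that continuous_map_eq[of X euclideanreal f h] by (simp add: Cont_def)
  assume f: "f \<in> Cont X"
  have "compactin euclideanreal (f ` topspace X)"
    using f X unfolding Cont_def compact_space_def by (metis image_compactin mem_Collect_eq)
  then have "bounded (f ` topspace X)" by (simp add: compact_imp_bounded)
  then show "\<exists>M. \<forall>x\<in>topspace X. \<bar>f x\<bar> \<le> M" by (auto simp: bounded_iff)
qed

section \<open>Representing states by Radon measures\<close>

locale compact_Hausdorff_state =
  fixes X :: "'x topology" and q :: "('x \<Rightarrow> real) \<Rightarrow> real"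
  assumes compact: "compact_space X" and Hausdorff: "Hausdorff_space X"
    and state: "q \<in> states (topspace X) (Cont X)"
begin

sublocale C: function_space "topspace X" "Cont X"
  by (rule function_space_Cont[OF compact])

lemma normal: "normal_space X"
  using compact Hausdorff compact_Hausdorff_or_regular_imp_normal_space by blast

text \<open>
  The content of an open set is the supremum of the state over these functions. Vanishing outside \<open>U\<close>
  is weaker than having support inside \<open>U\<close>, but \<open>below_trunc\<close> makes up for the difference.
\<close>

definition below :: "'x set \<Rightarrow> ('x \<Rightarrow> real) set" where
  "below U = {f\<in>Cont X. (\<forall>x\<in>topspace X. 0 \<le> f x \<and> f x \<le> 1) \<and> (\<forall>x\<in>topspace X - U. f x = 0)}"

definition content :: "'x set \<Rightarrow> ennreal" where
  "content U = (SUP f\<in>below U. ennreal (q f))"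

definition outer_content :: "'x set \<Rightarrow> ennreal" where
  "outer_content A = (INF U\<in>{U. openin X U \<and> A \<subseteq> U}. content U)"

lemma belowI:
  "continuous_map X euclideanreal f \<Longrightarrow> (\<And>x. x \<in> topspace X \<Longrightarrow> 0 \<le> f x \<and> f x \<le> 1) \<Longrightarrow>
    (\<And>x. x \<in> topspace X \<Longrightarrow> x \<notin> U \<Longrightarrow> f x = 0) \<Longrightarrow> f \<in> below U"
  by (simp add: below_def Cont_def)

lemma below_mem: "f \<in> below U \<Longrightarrow> f \<in> Cont X"
  by (simp add: below_def)

lemma below_q: "f \<in> below U \<Longrightarrow> 0 \<le> q f \<and> q f \<le> 1"
  using C.state_le[OF state, of f 1] C.state_ge[OF state, of f 0]
  by (simp add: below_def)

lemma zero_below: "(\<lambda>_. 0) \<in> below U"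
  by (rule belowI) auto

lemma content_upper: "f \<in> below U \<Longrightarrow> ennreal (q f) \<le> content U"
  unfolding content_def by (rule SUP_upper)

lemma content_mono: "U \<subseteq> V \<Longrightarrow> content U \<le> content V"
  unfolding content_def by (rule SUP_subset_mono) (auto simp: below_def)

lemma content_le_1: "content U \<le> 1"
  unfolding content_def by (rule SUP_least) (use below_q in auto)

lemma content_finite: "content U < \<infinity>"
  using content_le_1[of U] by (simp add: le_less_trans)

lemma content_space: "content (topspace X) = 1"
proof (rule antisym[OF content_le_1])
  have "ennreal (q (\<lambda>_. 1)) \<le> content (topspace X)"
    by (rule content_upper) (auto intro: belowI)
  then show "1 \<le> content (topspace X)" by (simp add: C.state_const[OF state])
qed

lemma content_empty: "content {} = 0"
proof -
  have "q f = 0" if "f \<in> below {}" for f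
    using C.state_cong[OF state, of f "\<lambda>_. 0"] that C.state_const[OF state, of 0]
    by (simp add: below_def)
  then have "content {} \<le> 0"
    unfolding content_def by (intro SUP_least) simp
  then show ?thesis by simp
qed

text \<open>
  Cutting a function off at height \<open>e\<close> changes the state by at most \<open>e\<close> and moves the support into the
  closed set where the function is at least \<open>e\<close>. This set is compact, so a countable open cover of it
  has a finite subcover; \<open>content_UN\<close> depends on this.
\<close>

lemma below_trunc:
  assumes f: "f \<in> below U" and e: "0 < e"
  obtains h K where "h \<in> below U" "closedin X K" "K \<subseteq> U" "q f \<le> q h + e"
    "\<And>x. x \<in> topspace X \<Longrightarrow> x \<notin> K \<Longrightarrow> h x = 0"
proof -
  define h where "h = (\<lambda>x. max (f x - e) 0)"
  define K where "K = {x \<in> topspace X. f x \<in> {e..}}"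
  have fc: "continuous_map X euclideanreal f" using below_mem[OF f] by (simp add: Cont_def)
  show thesis
  proof
    have hc: "continuous_map X euclideanreal h"
      unfolding h_def by (intro continuous_intros fc)
    have "0 \<le> h x \<and> h x \<le> 1" if "x \<in> topspace X" for x
    proof -
      have "0 \<le> f x \<and> f x \<le> 1" using f that unfolding below_def by blast
      then show ?thesis using e by (auto simp: h_def)
    qed
    then show hb: "h \<in> below U"
      using f e hc by (intro belowI) (auto simp: h_def below_def)
    show "closedin X K"
      unfolding K_def by (rule closedin_continuous_map_preimage[OF fc]) auto
    show "K \<subseteq> U" using f e by (force simp: K_def below_def)
    show "h x = 0" if "x \<in> topspace X" "x \<notin> K" for x
      using that by (auto simp: K_def h_def)
    have "q f \<le> q (\<lambda>x. h x + e)"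
      using below_mem[OF f] C.add_mem[OF below_mem[OF hb] C.const_mem[of e]]
      by (rule C.state_mono[OF state]) (auto simp: h_def)
    also have "\<dots> = q h + e"
      using C.state_add[OF state below_mem[OF hb] C.const_mem[of e]] C.state_const[OF state] by simp
    finally show "q f \<le> q h + e" .
  qed
qed

lemma Urysohn_below:
  assumes "closedin X K" "openin X U" "K \<subseteq> U"
  obtains h where "h \<in> below U" "\<And>x. x \<in> K \<Longrightarrow> h x = 1"
proof -
  have d: "disjnt (topspace X - U) K" using assms(3) by (auto simp: disjnt_def)
  have c: "closedin X (topspace X - U)" using assms(2) by blast
  obtain f where f: "continuous_map X (top_of_set {0..1::real}) f"
    "f ` (topspace X - U) \<subseteq> {0}" "f ` K \<subseteq> {1}"
    using Urysohn_lemma[OF normal c assms(1) d, of 0 1] by auto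
  show thesis
  proof
    show "f \<in> below U"
      using f by (intro belowI) (auto simp: continuous_map_in_subtopology image_subset_iff)
    show "f x = 1" if "x \<in> K" for x using f(3) that by auto
  qed
qed

text \<open>
  After truncation the support lies in a closed set \<open>K\<close>, and \<open>K - V\<close> is a closed subset of \<open>U\<close>. A
  Urysohn function for this pair splits the function into one part below \<open>U\<close> and one below \<open>V\<close>.
\<close>

lemma content_Un:
  assumes U: "openin X U" and V: "openin X V"
  shows "content (U \<union> V) \<le> content U + content V"
  unfolding content_def[of "U \<union> V"]
proof (rule SUP_least, rule ennreal_le_epsilon)
  fix f and e :: real assume f: "f \<in> below (U \<union> V)" and e: "0 < e"
  from f e obtain h K where h: "h \<in> below (U \<union> V)" "closedin X K" "K \<subseteq> U \<union> V" "q f \<le> q h + e"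
    "\<And>x. x \<in> topspace X \<Longrightarrow> x \<notin> K \<Longrightarrow> h x = 0" by (rule below_trunc) blast
  have "closedin X (K - V)" using h(2) V by (rule closedin_diff)
  moreover have "K - V \<subseteq> U" using h(3) by blast
  ultimately obtain k where k: "k \<in> below U" "\<And>x. x \<in> K - V \<Longrightarrow> k x = 1"
    using U by (metis Urysohn_below)
  have hb: "0 \<le> h x \<and> h x \<le> 1" if "x \<in> topspace X" for x using h(1) that by (simp add: below_def)
  have kb: "0 \<le> k x \<and> k x \<le> 1" if "x \<in> topspace X" for x using k(1) that by (simp add: below_def)
  have cont: "continuous_map X euclideanreal h" "continuous_map X euclideanreal k"
    using h(1) k(1) by (auto simp: below_def Cont_def)
  have 1: "(\<lambda>x. h x * k x) \<in> below U"
  proof (rule belowI)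
    show "continuous_map X euclideanreal (\<lambda>x. h x * k x)" by (intro continuous_intros cont)
    show "0 \<le> h x * k x \<and> h x * k x \<le> 1" if "x \<in> topspace X" for x
      using hb[OF that] kb[OF that] by (simp add: mult_le_one)
    show "h x * k x = 0" if "x \<in> topspace X" "x \<notin> U" for x
      using k(1) that by (simp add: below_def)
  qed
  have 2: "(\<lambda>x. h x * (1 - k x)) \<in> below V"
  proof (rule belowI)
    show "continuous_map X euclideanreal (\<lambda>x. h x * (1 - k x))" by (intro continuous_intros cont)
    show "0 \<le> h x * (1 - k x) \<and> h x * (1 - k x) \<le> 1" if "x \<in> topspace X" for x
      using hb[OF that] kb[OF that] by (simp add: mult_le_one)
    show "h x * (1 - k x) = 0" if "x \<in> topspace X" "x \<notin> V" for x
      using h(5)[OF that(1)] k(2)[of x] that by (cases "x \<in> K") auto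
  qed
  have "q h = q (\<lambda>x. h x * k x + h x * (1 - k x))" by (simp add: algebra_simps)
  also have "\<dots> = q (\<lambda>x. h x * k x) + q (\<lambda>x. h x * (1 - k x))"
    by (rule C.state_add[OF state below_mem[OF 1] below_mem[OF 2]])
  finally have "ennreal (q f) \<le> ennreal (q (\<lambda>x. h x * k x) + q (\<lambda>x. h x * (1 - k x)) + e)"
    using h(4) by (intro ennreal_leI) simp
  also have "\<dots> = ennreal (q (\<lambda>x. h x * k x)) + ennreal (q (\<lambda>x. h x * (1 - k x))) + ennreal e"
    using below_q[OF 1] below_q[OF 2] e by simp
  also have "\<dots> \<le> content U + content V + ennreal e"
    by (intro add_mono content_upper 1 2 order_refl)
  finally show "ennreal (q f) \<le> content U + content V + ennreal e" .
qed

lemma content_finite_UN: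
  "finite I \<Longrightarrow> (\<And>i. i \<in> I \<Longrightarrow> openin X (U i)) \<Longrightarrow> content (\<Union>i\<in>I. U i) \<le> (\<Sum>i\<in>I. content (U i))"
proof (induction I rule: finite_induct)
  case empty
  then show ?case by (simp add: content_empty)
next
  case (insert i I)
  have "content (\<Union>i\<in>insert i I. U i) \<le> content (U i) + content (\<Union>i\<in>I. U i)"
    using content_Un[of "U i" "\<Union>i\<in>I. U i"] insert by auto
  also have "\<dots> \<le> content (U i) + (\<Sum>i\<in>I. content (U i))"
    using insert by (intro add_mono) auto
  finally show ?case using insert by simp
qed

lemma content_UN:
  fixes U :: "nat \<Rightarrow> 'x set"
  assumes U: "\<And>n. openin X (U n)"
  shows "content (\<Union>n. U n) \<le> (\<Sum>n. content (U n))"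
  unfolding content_def[of "\<Union>n. U n"]
proof (rule SUP_least, rule ennreal_le_epsilon)
  fix f and e :: real assume f: "f \<in> below (\<Union>n. U n)" and e: "0 < e"
  from f e obtain h K where h: "h \<in> below (\<Union>n. U n)" "closedin X K" "K \<subseteq> (\<Union>n. U n)" "q f \<le> q h + e"
    "\<And>x. x \<in> topspace X \<Longrightarrow> x \<notin> K \<Longrightarrow> h x = 0" by (rule below_trunc) blast
  have "compactin X K" using closedin_compact_space[OF compact h(2)] .
  then obtain \<F> where \<F>: "finite \<F>" "\<F> \<subseteq> range U" "K \<subseteq> \<Union>\<F>"
    using U h(3) unfolding compactin_def by (metis (no_types, lifting) imageE)
  then obtain I where I: "finite I" "\<F> = U ` I"
    by (meson finite_subset_image)
  have "h \<in> below (\<Union>i\<in>I. U i)"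
    using h(1) h(5) \<F>(3) I(2) by (auto simp: below_def)
  then have "ennreal (q h) \<le> (\<Sum>i\<in>I. content (U i))"
    using content_finite_UN[OF I(1)] U by (metis content_upper order_trans)
  also have "\<dots> \<le> (\<Sum>n. content (U n))"
    using I(1) by (intro sum_le_suminf) auto
  finally have "ennreal (q h) + ennreal e \<le> (\<Sum>n. content (U n)) + ennreal e"
    by (rule add_right_mono)
  moreover have "ennreal (q f) \<le> ennreal (q h) + ennreal e"
    using h(4) below_q[OF h(1)] e by (simp flip: ennreal_plus) 
  ultimately show "ennreal (q f) \<le> (\<Sum>n. content (U n)) + ennreal e"
    by (rule order_trans[rotated])
qed

lemma outer_content_open: "openin X U \<Longrightarrow> outer_content U = content U"
  unfolding outer_content_def
  by (rule antisym) (auto intro!: INF_lower2[of U] INF_greatest content_mono)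

lemma outer_content_mono: "A \<subseteq> B \<Longrightarrow> outer_content A \<le> outer_content B"
  unfolding outer_content_def by (rule INF_superset_mono) auto

lemma outer_content_le_1: "outer_content A \<le> 1" if "A \<subseteq> topspace X"
  using outer_content_mono[OF that] content_le_1 outer_content_open[OF openin_topspace] by (metis order_trans)

lemma outer_content_close:
  assumes "A \<subseteq> topspace X" "0 < e"
  obtains U where "openin X U" "A \<subseteq> U" "content U \<le> outer_content A + ennreal e"
proof -
  have "outer_content A \<noteq> \<infinity>" using outer_content_le_1[OF assms(1)] by (auto simp: top_unique)
  then have "outer_content A < outer_content A + ennreal e" using assms(2)
    by (cases "outer_content A") (auto simp flip: ennreal_plus simp: ennreal_less_iff)
  then show thesis
    using that unfolding outer_content_def[of A] INF_less_iff by (auto intro: less_imp_le)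
qed

lemma outer_measure_outer_content: "outer_measure_space (Pow (topspace X)) outer_content"
  unfolding outer_measure_space_def
proof (intro conjI)
  show "positive (Pow (topspace X)) outer_content"
    by (simp add: positive_def outer_content_open content_empty)
  show "increasing (Pow (topspace X)) outer_content"
    by (auto simp: increasing_def outer_content_mono)
  show "countably_subadditive (Pow (topspace X)) outer_content"
    unfolding countably_subadditive_def
  proof (intro allI impI)
    fix A :: "nat \<Rightarrow> 'x set" assume A: "range A \<subseteq> Pow (topspace X)"
    show "outer_content (\<Union>i. A i) \<le> (\<Sum>n. outer_content (A n))"
    proof (rule ennreal_le_epsilon)
      fix e :: real assume e: "0 < e"
      have "\<exists>U. openin X U \<and> A n \<subseteq> U \<and> content U \<le> outer_content (A n) + ennreal (e * (1/2) ^ Suc n)" for n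
      proof -
        have "A n \<subseteq> topspace X" using A by auto
        moreover have "0 < e * (1/2) ^ Suc n" using e by simp
        ultimately show ?thesis by (rule outer_content_close) blast
      qed
      then obtain U where U: "\<And>n. openin X (U n)" "\<And>n. A n \<subseteq> U n"
        "\<And>n. content (U n) \<le> outer_content (A n) + ennreal (e * (1/2) ^ Suc n)" by metis
      have "outer_content (\<Union>i. A i) \<le> outer_content (\<Union>i. U i)" using U(2) by (intro outer_content_mono) blast
      also have "\<dots> = content (\<Union>i. U i)" using U(1) by (intro outer_content_open) auto
      also have "\<dots> \<le> (\<Sum>n. content (U n))" using U(1) by (rule content_UN)
      also have "\<dots> \<le> (\<Sum>n. outer_content (A n) + ennreal (e * (1/2) ^ Suc n))"
        by (intro suminf_le U(3)) auto
      also have "\<dots> = (\<Sum>n. outer_content (A n)) + (\<Sum>n. ennreal e * ennreal ((1/2) ^ Suc n))"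
        using e by (subst suminf_add[symmetric])
                   (auto simp del: ennreal_suminf_cmult simp add: ennreal_mult[symmetric])
      also have "\<dots> = (\<Sum>n. outer_content (A n)) + ennreal e"
        unfolding ennreal_suminf_cmult
        by (subst suminf_ennreal_eq[OF zero_le_power power_half_series]) auto
      finally show "outer_content (\<Union>i. A i) \<le> (\<Sum>n. outer_content (A n)) + ennreal e" .
    qed
  qed
qed

lemma outer_content_Un: "A \<subseteq> topspace X \<Longrightarrow> B \<subseteq> topspace X \<Longrightarrow> A \<inter> B = {} \<Longrightarrow> outer_content (A \<union> B) \<le> outer_content A + outer_content B"
proof -
  interpret Pow: sigma_algebra "topspace X" "Pow (topspace X)" by (rule sigma_algebra_Pow)
  have "subadditive (Pow (topspace X)) outer_content"
    using outer_measure_outer_content Pow.countably_subadditive_subadditive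
    by (simp add: outer_measure_space_def)
  then show "A \<subseteq> topspace X \<Longrightarrow> B \<subseteq> topspace X \<Longrightarrow> A \<inter> B = {} \<Longrightarrow> outer_content (A \<union> B) \<le> outer_content A + outer_content B"
    by (rule subadditiveD) auto
qed

text \<open>
  A function below \<open>V \<inter> U\<close>, truncated so that it is supported on \<open>K\<close>, and a function below \<open>V - K\<close>
  have disjoint supports, so their sum is still below \<open>V\<close>. This is Caratheodory's condition for \<open>U\<close>,
  tested on open sets.
\<close>

lemma content_split:
  assumes U: "openin X U" and V: "openin X V"
  shows "content (V \<inter> U) + outer_content (V - U) \<le> content V"
proof (rule ennreal_le_epsilon)
  fix e :: real assume e: "0 < e"
  have ne: "below W \<noteq> {}" for W using zero_below by blast
  obtain f where f: "f \<in> below (V \<inter> U)" "content (V \<inter> U) < ennreal (q f) + ennreal (e/3)"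
    using SUP_approx_ennreal[OF _ ne content_def[of "V \<inter> U"], of "e/3"] e content_finite[of "V \<inter> U"] by (auto simp: less_top[symmetric])
  obtain h K where h: "h \<in> below (V \<inter> U)" "closedin X K" "K \<subseteq> V \<inter> U" "q f \<le> q h + e/3"
    "\<And>x. x \<in> topspace X \<Longrightarrow> x \<notin> K \<Longrightarrow> h x = 0" using below_trunc[OF f(1), of "e/3"] e by auto
  obtain k where k: "k \<in> below (V - K)" "content (V - K) < ennreal (q k) + ennreal (e/3)"
    using SUP_approx_ennreal[OF _ ne content_def[of "V - K"], of "e/3"] e content_finite[of "V - K"] by (auto simp: less_top[symmetric])
  have hk: "(\<lambda>x. h x + k x) \<in> below V"
  proof (rule belowI)
    show "continuous_map X euclideanreal (\<lambda>x. h x + k x)"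
      using h(1) k(1) by (auto simp: below_def Cont_def intro: continuous_intros)
    show "0 \<le> h x + k x \<and> h x + k x \<le> 1" if x: "x \<in> topspace X" for x
    proof (cases "x \<in> K")
      case True
      then have "k x = 0" using k(1) x by (simp add: below_def)
      then show ?thesis using h(1) x by (simp add: below_def)
    next
      case False
      then have "h x = 0" using h(5) x by simp
      then show ?thesis using k(1) x by (simp add: below_def)
    qed
    show "h x + k x = 0" if "x \<in> topspace X" "x \<notin> V" for x
      using h(1) k(1) that by (simp add: below_def)
  qed
  have "openin X (V - K)" using V h(2) by (rule openin_diff)
  moreover have "V - U \<subseteq> V - K" using h(3) by blast
  ultimately have "outer_content (V - U) \<le> content (V - K)"
    using outer_content_mono outer_content_open by metis
  with f(2) k(2) have "content (V \<inter> U) + outer_content (V - U) \<le>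
      (ennreal (q f) + ennreal (e/3)) + (ennreal (q k) + ennreal (e/3))"
    by (intro add_mono) auto
  also have "\<dots> = ennreal ((q f + e/3) + (q k + e/3))"
    using below_q[OF f(1)] below_q[OF k(1)] e by (simp add: ennreal_plus[symmetric] del: ennreal_plus)
  also have "\<dots> \<le> ennreal (q (\<lambda>x. h x + k x) + e)"
    using h(4) C.state_add[OF state below_mem[OF h(1)] below_mem[OF k(1)]] by (intro ennreal_leI) auto
  also have "\<dots> = ennreal (q (\<lambda>x. h x + k x)) + ennreal e"
    using below_q[OF hk] e by simp
  also have "\<dots> \<le> content V + ennreal e"
    by (intro add_right_mono content_upper hk)
  finally show "content (V \<inter> U) + outer_content (V - U) \<le> content V + ennreal e" .
qed

lemma open_lambda:
  assumes U: "openin X U"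
  shows "U \<in> lambda_system (topspace X) (Pow (topspace X)) outer_content"
proof -
  interpret Pow: sigma_algebra "topspace X" "Pow (topspace X)" by (rule sigma_algebra_Pow)
  have "outer_content (U \<inter> A) + outer_content ((topspace X - U) \<inter> A) = outer_content A" if A: "A \<subseteq> topspace X" for A
  proof (rule antisym)
    show "outer_content (U \<inter> A) + outer_content ((topspace X - U) \<inter> A) \<le> outer_content A"
      unfolding outer_content_def[of A]
    proof (rule INF_greatest)
      fix V assume V: "V \<in> {V. openin X V \<and> A \<subseteq> V}"
      have "outer_content (U \<inter> A) \<le> content (V \<inter> U)"
        using outer_content_mono[of "U \<inter> A" "V \<inter> U"] outer_content_open[of "V \<inter> U"] U V by (auto simp: openin_Int)
      moreover have "outer_content ((topspace X - U) \<inter> A) \<le> outer_content (V - U)"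
        using V by (intro outer_content_mono) auto
      ultimately have "outer_content (U \<inter> A) + outer_content ((topspace X - U) \<inter> A) \<le> content (V \<inter> U) + outer_content (V - U)"
        by (rule add_mono)
      also have "\<dots> \<le> content V" using U V by (intro content_split) auto
      finally show "outer_content (U \<inter> A) + outer_content ((topspace X - U) \<inter> A) \<le> content V" .
    qed
    have "A = (U \<inter> A) \<union> ((topspace X - U) \<inter> A)" using A by auto
    then show "outer_content A \<le> outer_content (U \<inter> A) + outer_content ((topspace X - U) \<inter> A)"
      using outer_content_Un[of "U \<inter> A" "(topspace X - U) \<inter> A"] A by auto
  qed
  then show ?thesis using openin_subset[OF U] by (simp add: lambda_system_def)
qed

definition \<mu> :: "'x measure" where
  "\<mu> = measure_of (topspace X) (sets (borel_of X)) outer_content"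

lemma sets_\<mu>: "sets \<mu> = sets (borel_of X)"
  and space_\<mu>: "space \<mu> = topspace X"
  and emeasure_\<mu>: "A \<in> sets (borel_of X) \<Longrightarrow> emeasure \<mu> A = outer_content A"
proof -
  interpret Pow: sigma_algebra "topspace X" "Pow (topspace X)" by (rule sigma_algebra_Pow)
  let ?L = "lambda_system (topspace X) (Pow (topspace X)) outer_content"
  have L: "measure_space (topspace X) ?L outer_content"
    by (rule Pow.caratheodory_lemma[OF outer_measure_outer_content])
  have sub: "sets (borel_of X) \<subseteq> ?L"
    unfolding sets_borel_of
    using L open_lambda by (intro sigma_algebra.sigma_sets_subset) (auto simp: measure_space_def)
  have sa: "sigma_algebra (topspace X) (sets (borel_of X))"
    using sets.sigma_algebra_axioms[of "borel_of X"] by simp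
  have ms: "measure_space (topspace X) (sets (borel_of X)) outer_content"
    using measure_down[OF L sa sub] .
  have P: "sets (borel_of X) \<subseteq> Pow (topspace X)"
    using sets.space_closed[of "borel_of X"] by simp
  show "sets \<mu> = sets (borel_of X)" unfolding \<mu>_def
    using sa P by (simp add: sigma_algebra.sigma_sets_eq)
  show "space \<mu> = topspace X" unfolding \<mu>_def using P by (simp add: space_measure_of)
  show "A \<in> sets (borel_of X) \<Longrightarrow> emeasure \<mu> A = outer_content A"
    unfolding \<mu>_def using ms sa
    by (intro emeasure_measure_of_sigma) (auto simp: measure_space_def)
qed

lemma open_borel: "openin X U \<Longrightarrow> U \<in> sets (borel_of X)"
  by (auto simp: sets_borel_of)

lemma prob_\<mu>: "prob_space \<mu>"
  by (rule prob_spaceI) (simp add: space_\<mu> emeasure_\<mu> open_borel outer_content_open content_space)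

text \<open>
  The outer measure is outer regular by definition; passing to complements turns this into inner
  regularity, as closed subsets are compact.
\<close>

lemma \<mu>_Prob: "\<mu> \<in> Prob X"
  unfolding Prob_def
proof (intro CollectI conjI ballI)
  interpret prob_space \<mu> by (rule prob_\<mu>)
  show "sets \<mu> = sets (borel_of X)" by (rule sets_\<mu>)
  show "prob_space \<mu>" by (rule prob_\<mu>)
  fix A assume A: "A \<in> sets \<mu>"
  have AX: "A \<subseteq> topspace X" using sets.sets_into_space[OF A] by (simp add: space_\<mu>)
  show "emeasure \<mu> A = (SUP K\<in>{K. compactin X K \<and> K \<subseteq> A}. emeasure \<mu> K)"
  proof (rule antisym)
    show "(SUP K\<in>{K. compactin X K \<and> K \<subseteq> A}. emeasure \<mu> K) \<le> emeasure \<mu> A"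
      using A by (intro SUP_least emeasure_mono) auto
    show "emeasure \<mu> A \<le> (SUP K\<in>{K. compactin X K \<and> K \<subseteq> A}. emeasure \<mu> K)"
    proof (rule ennreal_le_epsilon)
      fix e :: real assume e: "0 < e"
      have cA: "topspace X - A \<in> sets \<mu>" using A space_\<mu> sets.compl_sets by metis
      obtain U where U: "openin X U" "topspace X - A \<subseteq> U" "content U \<le> outer_content (topspace X - A) + ennreal e"
        using outer_content_close[of "topspace X - A" e] e by auto
      have Um: "U \<in> sets \<mu>" using U(1) open_borel sets_\<mu> by simp
      have "measure \<mu> U \<le> measure \<mu> (space \<mu> - A) + e"
      proof -
        have "emeasure \<mu> U \<le> emeasure \<mu> (topspace X - A) + ennreal e"
          using U cA sets_\<mu> by (simp add: emeasure_\<mu> open_borel outer_content_open)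
        then show ?thesis using e
          by (simp add: emeasure_eq_measure space_\<mu> measure_nonneg flip: ennreal_plus)
      qed
      then have "measure \<mu> A \<le> measure \<mu> (space \<mu> - U) + e"
        using prob_compl[OF A] prob_compl[OF Um] by linarith
      then have "emeasure \<mu> A \<le> emeasure \<mu> (topspace X - U) + ennreal e"
        using e by (simp add: emeasure_eq_measure space_\<mu> measure_nonneg flip: ennreal_plus)
      also have "compactin X (topspace X - U)"
        using U(1) compact closedin_compact_space by blast
      then have "emeasure \<mu> (topspace X - U) \<le> (SUP K\<in>{K. compactin X K \<and> K \<subseteq> A}. emeasure \<mu> K)"
        using U(2) by (intro SUP_upper) auto
      finally show "emeasure \<mu> A \<le> (SUP K\<in>{K. compactin X K \<and> K \<subseteq> A}. emeasure \<mu> K) + ennreal e"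
        by (simp add: add_mono)
    qed
  qed
qed

lemma Cont_measurable: "f \<in> Cont X \<Longrightarrow> f \<in> borel_measurable \<mu>"
  using continuous_borel_measurable[of X f] sets_\<mu> by (simp add: Cont_def cong: measurable_cong_sets)

lemma Cont_integrable: "f \<in> Cont X \<Longrightarrow> integrable \<mu> f"
proof -
  interpret prob_space \<mu> by (rule prob_\<mu>)
  assume f: "f \<in> Cont X"
  then obtain M where "\<forall>x\<in>topspace X. \<bar>f x\<bar> \<le> M" using C.bdd_mem by blast
  then show ?thesis
    using Cont_measurable[OF f] by (intro integrable_const_bound[of _ M]) (auto simp: space_\<mu>)
qed

text \<open>
  Slice the function horizontally into \<open>n\<close> layers of height \<open>1/n\<close>. The layer above height \<open>k/n\<close>, scaled
  to height one, lies below the open set where the function exceeds \<open>k/n\<close>; the sum of the indicators of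
  these open sets exceeds \<open>n f\<close> by at most one.
\<close>

lemma state_le_integral:
  assumes f: "f \<in> Cont X" and f01: "\<And>x. x \<in> topspace X \<Longrightarrow> 0 \<le> f x \<and> f x \<le> 1"
  shows "q f \<le> (\<integral>x. f x \<partial>\<mu>)"
proof (rule field_le_epsilon)
  interpret prob_space \<mu> by (rule prob_\<mu>)
  fix e :: real assume e: "0 < e"
  obtain m where m: "1 / real (Suc m) < e" using e nat_approx_posE by auto
  define n where "n = Suc m"
  have n: "0 < real n" "1 / real n < e" using m by (auto simp: n_def)
  define U where "U k = {x \<in> topspace X. f x \<in> {real k / real n<..}}" for k
  define h where "h k x = max 0 (min 1 (real n * f x - real k))" for k x
  have fc: "continuous_map X euclideanreal f" using f by (simp add: Cont_def)
  have U: "openin X (U k)" for k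
    unfolding U_def by (rule openin_continuous_map_preimage[OF fc]) auto
  have Um: "U k \<in> sets \<mu>" for k using U open_borel sets_\<mu> by simp
  have hU: "h k \<in> below (U k)" for k
  proof (rule belowI)
    show "continuous_map X euclideanreal (h k)"
      unfolding h_def by (intro continuous_intros fc)
    show "h k x = 0" if "x \<in> topspace X" "x \<notin> U k" for x
      using that n(1) by (auto simp: h_def U_def field_simps)
  qed (auto simp: h_def)
  have hsum: "(\<Sum>k<j. h k x) = max 0 (min (real j) (real n * f x))" for j x
    by (induction j) (auto simp: h_def)
  have "real n * q f = q (\<lambda>x. real n * f x)"
    by (rule C.state_scale[OF state f, symmetric])
  also have "\<dots> = q (\<lambda>x. \<Sum>k<n. h k x)"
    using f01 n(1) by (intro C.state_cong[OF state]) (simp add: hsum)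
  also have "\<dots> = (\<Sum>k<n. q (h k))"
    using below_mem[OF hU] by (intro C.state_sum[OF state]) auto
  also have "\<dots> \<le> (\<Sum>k<n. measure \<mu> (U k))"
  proof (rule sum_mono)
    fix k
    have "ennreal (q (h k)) \<le> emeasure \<mu> (U k)"
      using content_upper[OF hU] by (simp add: emeasure_\<mu> open_borel U outer_content_open)
    then show "q (h k) \<le> measure \<mu> (U k)"
      by (simp add: emeasure_eq_measure)
  qed
  also have "\<dots> = (\<integral>x. (\<Sum>k<n. indicat_real (U k) x) \<partial>\<mu>)"
    using Um by (subst Bochner_Integration.integral_sum) (auto simp: integrable_indicator_iff emeasure_eq_measure)
  also have "\<dots> \<le> (\<integral>x. real n * f x + 1 \<partial>\<mu>)"
  proof (rule integral_mono)
    show "integrable \<mu> (\<lambda>x. \<Sum>k<n. indicat_real (U k) x)"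
      using Um by (intro Bochner_Integration.integrable_sum) (auto simp: integrable_indicator_iff emeasure_eq_measure)
    show "integrable \<mu> (\<lambda>x. real n * f x + 1)"
      using Cont_integrable[OF f] by simp
    fix x assume "x \<in> space \<mu>"
    then have x: "x \<in> topspace X" by (simp add: space_\<mu>)
    have "(\<Sum>k<j. indicat_real (U k) x) \<le> real n * f x + 1" for j
    proof (induction j)
      case 0
      then show ?case using f01[OF x] n(1) by simp
    next
      case (Suc j)
      show ?case
      proof (cases "x \<in> U j")
        case True
        then have "real j \<le> real n * f x" using n(1) by (simp add: U_def field_simps)
        moreover have "(\<Sum>k<Suc j. indicat_real (U k) x) \<le> (\<Sum>k<Suc j. 1)"
          by (intro sum_mono) (simp add: indicator_def)
        ultimately show ?thesis by simp
      qed (use Suc in simp)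
    qed
    then show "(\<Sum>k<n. indicat_real (U k) x) \<le> real n * f x + 1" .
  qed
  also have "\<dots> = real n * (\<integral>x. f x \<partial>\<mu>) + 1"
    using Cont_integrable[OF f] by (simp add: prob_space)
  finally have "q f \<le> (\<integral>x. f x \<partial>\<mu>) + 1 / real n"
    using n(1) by (simp add: field_simps)
  then show "q f \<le> (\<integral>x. f x \<partial>\<mu>) + e" using n(2) by linarith
qed

text \<open>
  The inequality \<open>state_le_integral\<close> extends to all continuous functions by rescaling their values
  into the unit interval. For linear functionals it then implies equality, by passing to \<open>- f\<close>.
\<close>

lemma state_eq_integral:
  assumes f: "f \<in> Cont X"
  shows "q f = (\<integral>x. f x \<partial>\<mu>)"
proof -
  interpret prob_space \<mu> by (rule prob_\<mu>)
  obtain M0 where M0: "\<forall>x\<in>topspace X. \<bar>f x\<bar> \<le> M0" using C.bdd_mem[OF f] by blast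
  define M where "M = max M0 1"
  have M: "0 < M" "\<And>x. x \<in> topspace X \<Longrightarrow> \<bar>f x\<bar> \<le> M" using M0 by (auto simp: M_def)
  have le: "q h \<le> (\<integral>x. h x \<partial>\<mu>)" if h: "h \<in> Cont X" and hM: "\<And>x. x \<in> topspace X \<Longrightarrow> \<bar>h x\<bar> \<le> M" for h
  proof -
    define k where "k x = (1 / (2 * M)) * (h x + M)" for x
    have hM': "(\<lambda>x. h x + M) \<in> Cont X" using C.add_mem[OF h C.const_mem] .
    have "k \<in> Cont X" unfolding k_def[abs_def] by (rule C.scale_mem[OF hM'])
    moreover have "0 \<le> k x \<and> k x \<le> 1" if "x \<in> topspace X" for x
      using hM[OF that] M(1) by (auto simp: k_def abs_le_iff field_simps)
    ultimately have "q k \<le> (\<integral>x. k x \<partial>\<mu>)" by (rule state_le_integral) 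
    moreover have "q k = (1 / (2 * M)) * (q h + M)"
      unfolding k_def[abs_def] C.state_scale[OF state hM'] C.state_add[OF state h C.const_mem]
        C.state_const[OF state] ..
    moreover have "(\<integral>x. k x \<partial>\<mu>) = (1 / (2 * M)) * ((\<integral>x. h x \<partial>\<mu>) + M)"
      unfolding k_def[abs_def] using Cont_integrable[OF h] by (simp add: prob_space)
    ultimately show ?thesis using M(1) by (simp add: field_simps)
  qed
  show ?thesis
  proof (rule antisym)
    show "q f \<le> (\<integral>x. f x \<partial>\<mu>)" using f M(2) by (rule le)
    have "q (\<lambda>x. - f x) \<le> (\<integral>x. - f x \<partial>\<mu>)" using C.minus_mem[OF f] M(2) by (intro le) auto
    then show "(\<integral>x. f x \<partial>\<mu>) \<le> q f"
      using C.state_scale[OF state f, of "-1"] by simp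
  qed
qed

end

theorem Riesz_state:
  assumes "compact_space X" "Hausdorff_space X" "q \<in> states (topspace X) (Cont X)"
  obtains \<mu> where "\<mu> \<in> Prob X" "\<And>f. f \<in> Cont X \<Longrightarrow> q f = (\<integral>x. f x \<partial>\<mu>)"
proof -
  interpret compact_Hausdorff_state X q by unfold_locales (use assms in auto)
  show thesis by (rule that[OF \<mu>_Prob state_eq_integral])
qed

section \<open>The product topology on real-valued functions\<close>

lemma openin_fun_basic:
  fixes x :: "'i \<Rightarrow> real"
  assumes "finite J"
  shows "openin euclidean {y. \<forall>i\<in>J. \<bar>y i - x i\<bar> < e}"
proof -
  have "open {y::'i \<Rightarrow> real. \<forall>i\<in>J. y i \<in> ball (x i) e}"
    using assms product_topology_basis'[of J "\<lambda>i. ball (x i) e" "\<lambda>i. i"] by simp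
  then show ?thesis by (simp add: dist_real_def abs_minus_commute)
qed

lemma openin_fun_contains_basic:
  fixes x :: "'i \<Rightarrow> real"
  assumes "openin euclidean U" "x \<in> U"
  obtains J :: "'i set" and e where "finite J" "0 < e" "{y. \<forall>i\<in>J. \<bar>y i - x i\<bar> < e} \<subseteq> U"
proof -
  have "openin (product_topology (\<lambda>_. euclideanreal) UNIV) U"
    using assms(1) by (simp add: euclidean_product_topology)
  from product_topology_open_contains_basis[OF this assms(2)]
  obtain Y where Y: "x \<in> (\<Pi>\<^sub>E i\<in>UNIV. Y i)" "\<And>i. open (Y i)" "finite {i. Y i \<noteq> UNIV}"
    "(\<Pi>\<^sub>E i\<in>UNIV. Y i) \<subseteq> U" by auto
  define J where "J = {i. Y i \<noteq> UNIV}"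
  have "\<exists>e>0. \<forall>t. \<bar>t - x i\<bar> < e \<longrightarrow> t \<in> Y i" for i
    using Y(1) Y(2)[of i] unfolding open_dist dist_real_def by auto
  then obtain e where e: "\<And>i. 0 < e i" "\<And>i t. \<bar>t - x i\<bar> < e i \<Longrightarrow> t \<in> Y i" by metis
  define d where "d = Min (insert 1 (e ` J))"
  have J: "finite J" using Y(3) by (simp add: J_def)
  have d: "0 < d" "\<And>i. i \<in> J \<Longrightarrow> d \<le> e i" using J e(1) by (auto simp: d_def)
  show thesis
  proof (rule that[OF J d(1)], rule subsetI)
    fix y assume y: "y \<in> {y. \<forall>i\<in>J. \<bar>y i - x i\<bar> < d}"
    have "y i \<in> Y i" for i
    proof (cases "i \<in> J")
      case True
      then show ?thesis using y d(2) by (intro e(2)) force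
    qed (simp add: J_def)
    then show "y \<in> U" using Y(4) by auto
  qed
qed

text \<open>
  Limits in the product topology are handled through finitely many coordinates and an error bound,
  which replaces nets throughout.
\<close>

lemma in_closure_fun:
  fixes x :: "'i \<Rightarrow> real"
  shows "x \<in> euclidean closure_of S \<longleftrightarrow> (\<forall>(J :: 'i set) e. finite J \<and> 0 < e \<longrightarrow> (\<exists>y\<in>S. \<forall>i\<in>J. \<bar>y i - x i\<bar> < e))"
proof (intro iffI allI impI)
  fix J :: "'i set" and e :: real assume x: "x \<in> euclidean closure_of S" and J: "finite J \<and> 0 < e"
  define U where "U = {y. \<forall>i\<in>J. \<bar>y i - x i\<bar> < e}"
  have "openin euclidean U" unfolding U_def using J by (intro openin_fun_basic) simp
  moreover have "x \<in> U" using J by (simp add: U_def)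
  ultimately obtain y where "y \<in> S" "y \<in> U"
    using x unfolding in_closure_of by blast
  then show "\<exists>y\<in>S. \<forall>i\<in>J. \<bar>y i - x i\<bar> < e" by (auto simp: U_def)
next
  assume R: "\<forall>(J :: 'i set) e. finite J \<and> 0 < e \<longrightarrow> (\<exists>y\<in>S. \<forall>i\<in>J. \<bar>y i - x i\<bar> < e)"
  show "x \<in> euclidean closure_of S"
    unfolding in_closure_of
  proof (intro conjI allI impI)
    fix T assume "x \<in> T \<and> openin euclidean T"
    then obtain J :: "'i set" and e where "finite J" "0 < e" "{y. \<forall>i\<in>J. \<bar>y i - x i\<bar> < e} \<subseteq> T"
      using openin_fun_contains_basic[of T x] by blast
    then show "\<exists>y. y \<in> S \<and> y \<in> T" using R by blast
  qed simp
qed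

lemma Hausdorff_fun: "Hausdorff_space (euclidean :: ('i \<Rightarrow> real) topology)"
  unfolding euclidean_product_topology[symmetric] Hausdorff_space_product_topology by simp

lemma continuous_map_coordinate: "continuous_map euclidean euclideanreal (\<lambda>q::'i \<Rightarrow> real. q i)"
  using continuous_map_product_projection[of i UNIV "\<lambda>_. euclideanreal"]
  by (simp add: euclidean_product_topology)

lemma continuous_map_coordinate_sub: "continuous_map (top_of_set Q) euclideanreal (\<lambda>q::'i \<Rightarrow> real. q i)"
  by (rule continuous_map_from_subtopology[OF continuous_map_coordinate])

lemma continuous_map_into_fun:
  fixes f :: "'x \<Rightarrow> 'i \<Rightarrow> real"
  assumes "\<And>i. continuous_map X euclideanreal (\<lambda>x. f x i)"
  shows "continuous_map X euclidean f"
  using assms continuous_map_componentwise_UNIV[of X "\<lambda>_. euclideanreal" f]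
  by (simp add: euclidean_product_topology)

lemma compactin_fun:
  fixes Q :: "('i \<Rightarrow> real) set"
  assumes "closedin euclidean Q" "\<And>i. \<exists>M. \<forall>q\<in>Q. \<bar>q i\<bar> \<le> M"
  shows "compactin euclidean Q"
proof -
  obtain M where M: "\<And>i q. q \<in> Q \<Longrightarrow> \<bar>q i\<bar> \<le> M i" using assms(2) by metis
  have "compactin euclidean (\<Pi>\<^sub>E i\<in>UNIV. {- M i..M i})"
    unfolding euclidean_product_topology[symmetric] compactin_PiE by simp
  moreover have "Q \<subseteq> (\<Pi>\<^sub>E i\<in>UNIV. {- M i..M i})"
    using M by (auto simp: abs_le_iff minus_le_iff)
  ultimately show ?thesis using assms(1) closed_compactin by blast
qed

section \<open>Compactness and minimal closed sets\<close>

lemma compactin_directed_Inter: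
  assumes K: "compactin T K" and D: "D \<noteq> {}"
    and C: "\<And>d. d \<in> D \<Longrightarrow> closedin T (C d)" "\<And>d. d \<in> D \<Longrightarrow> K \<inter> C d \<noteq> {}"
    and dir: "\<And>d e. d \<in> D \<Longrightarrow> e \<in> D \<Longrightarrow> \<exists>f\<in>D. C f \<subseteq> C d \<inter> C e"
  shows "\<exists>x\<in>K. \<forall>d\<in>D. x \<in> C d"
proof -
  have fin: "\<exists>d\<in>D. C d \<subseteq> \<Inter>(C ` E)" if "finite E" "E \<subseteq> D" for E
    using that
  proof (induction E rule: finite_induct)
    case empty
    then show ?case using D by auto
  next
    case (insert e E)
    then obtain d where d: "d \<in> D" "C d \<subseteq> \<Inter>(C ` E)" by auto
    obtain f where "f \<in> D" "C f \<subseteq> C d \<inter> C e" using dir[OF d(1), of e] insert by auto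
    then show ?case using d(2) by (intro bexI[of _ f]) auto
  qed
  have fip: "K \<inter> \<Inter>\<F> \<noteq> {}" if F: "finite \<F>" "\<F> \<subseteq> C ` D" for \<F>
  proof -
    obtain E where E: "finite E" "E \<subseteq> D" "\<F> = C ` E"
      using F by (meson finite_subset_image)
    obtain d where d: "d \<in> D" "C d \<subseteq> \<Inter>(C ` E)" using fin[OF E(1,2)] by blast
    then show ?thesis using C(2)[OF d(1)] E(3) by blast
  qed
  then have "K \<inter> \<Inter>(C ` D) \<noteq> {}"
    using K[unfolded compactin_fip, THEN conjunct2, rule_format, of "C ` D"] C(1) by blast
  then show ?thesis by blast
qed

text \<open>
  Zorn's lemma; compactness is what keeps the intersection of a chain non-empty.
\<close>

lemma minimal_closed_exists:
  assumes T: "compact_space T" and K: "closedin T K" "K \<noteq> {}" "P K"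
    and chain: "\<And>\<C>. \<C> \<noteq> {} \<Longrightarrow> (\<And>B. B \<in> \<C> \<Longrightarrow> closedin T B \<and> P B) \<Longrightarrow> P (\<Inter>\<C>)"
  obtains M where "closedin T M" "M \<noteq> {}" "P M" "M \<subseteq> K"
    "\<And>B. closedin T B \<Longrightarrow> B \<noteq> {} \<Longrightarrow> P B \<Longrightarrow> B \<subseteq> M \<Longrightarrow> B = M"
proof -
  define A where "A = {B. closedin T B \<and> B \<noteq> {} \<and> P B \<and> B \<subseteq> K}"
  define R where "R = (\<lambda>B C :: 'a set. C \<subseteq> B)"
  have "\<exists>m\<in>A. \<forall>a\<in>A. R m a \<longrightarrow> a = m"
  proof (rule predicate_Zorn)
    show "partial_order_on A (relation_of R A)"
      by (rule partial_order_on_relation_ofI) (auto simp: R_def)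
    fix \<C> assume ch: "\<C> \<in> Chains (relation_of R A)"
    then have CA: "\<C> \<subseteq> A" and lin: "\<And>B C. B \<in> \<C> \<Longrightarrow> C \<in> \<C> \<Longrightarrow> B \<subseteq> C \<or> C \<subseteq> B"
      by (auto simp: Chains_def relation_of_def R_def)
    show "\<exists>u\<in>A. \<forall>a\<in>\<C>. R a u"
    proof (cases "\<C> = {}")
      case True
      then show ?thesis using K by (auto simp: A_def)
    next
      case False
      have "\<exists>x\<in>topspace T. \<forall>d\<in>\<C>. x \<in> d"
      proof (rule compactin_directed_Inter[where C = "\<lambda>d. d"])
        show "compactin T (topspace T)" using T by (simp add: compact_space_def)
        show "\<C> \<noteq> {}" by fact
        show "closedin T d" if "d \<in> \<C>" for d using CA that by (auto simp: A_def)
        show "topspace T \<inter> d \<noteq> {}" if "d \<in> \<C>" for d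
          using CA that closedin_subset[of T d] unfolding A_def by blast
        show "\<exists>f\<in>\<C>. f \<subseteq> d \<inter> e" if "d \<in> \<C>" "e \<in> \<C>" for d e
          using lin[OF that] that by (metis inf.orderE inf_commute order_refl)
      qed
      then have "\<Inter>\<C> \<noteq> {}" by auto
      moreover have "closedin T (\<Inter>\<C>)" using False CA by (intro closedin_Inter) (auto simp: A_def)
      moreover have "P (\<Inter>\<C>)" using False CA by (intro chain) (auto simp: A_def)
      moreover have "\<Inter>\<C> \<subseteq> K" using False CA by (auto simp: A_def)
      ultimately have "\<Inter>\<C> \<in> A" by (simp add: A_def)
      then show ?thesis by (auto simp: R_def)
    qed
  qed
  then obtain M where M: "M \<in> A" "\<And>B. B \<in> A \<Longrightarrow> B \<subseteq> M \<Longrightarrow> B = M" by (auto simp: R_def)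
  show thesis
  proof (rule that[of M])
    fix B assume "closedin T B" "B \<noteq> {}" "P B" "B \<subseteq> M"
    then show "B = M" using M by (auto simp: A_def)
  qed (use M(1) in \<open>auto simp: A_def\<close>)
qed

section \<open>Compact G-spaces\<close>

text \<open>
  An action by arbitrary maps is automatically an action by bijections, the inverse of \<open>\<phi> g\<close> being given
  by the inverse of \<open>g\<close>.
\<close>

lemma group_actionI:
  fixes G (structure)
  assumes G: "group G"
    and closed: "\<And>g x. g \<in> carrier G \<Longrightarrow> x \<in> E \<Longrightarrow> \<phi> g x \<in> E"
    and ext: "\<And>g. g \<in> carrier G \<Longrightarrow> \<phi> g \<in> extensional E"
    and one: "\<And>x. x \<in> E \<Longrightarrow> \<phi> \<one> x = x"
    and mult: "\<And>g h x. g \<in> carrier G \<Longrightarrow> h \<in> carrier G \<Longrightarrow> x \<in> E \<Longrightarrow> \<phi> (g \<otimes> h) x = \<phi> g (\<phi> h x)"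
  shows "group_action G E \<phi>"
proof -
  interpret group G by fact
  have bij: "\<phi> g \<in> Bij E" if g: "g \<in> carrier G" for g
  proof -
    have "\<phi> (inv g) (\<phi> g x) = x" "\<phi> g (\<phi> (inv g) x) = x" if "x \<in> E" for x
      using mult[of "inv g" g x] mult[of g "inv g" x] g one[OF that] that by auto
    then have "bij_betw (\<phi> g) E E"
      using g closed by (intro bij_betw_byWitness[where f' = "\<phi> (inv g)"]) auto
    then show ?thesis using ext[OF g] by (simp add: Bij_def)
  qed
  have "\<phi> \<in> hom G (BijGroup E)"
  proof (rule homI)
    fix g h assume gh: "g \<in> carrier G" "h \<in> carrier G"
    show "\<phi> g \<in> carrier (BijGroup E)" using bij[OF gh(1)] by (simp add: BijGroup_def)
    have "\<phi> (g \<otimes> h) = compose E (\<phi> g) (\<phi> h)"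
    proof
      fix x
      show "\<phi> (g \<otimes> h) x = compose E (\<phi> g) (\<phi> h) x"
        using mult[OF gh, of x] ext[of "g \<otimes> h"] gh
        by (cases "x \<in> E") (auto simp: compose_def extensional_def)
    qed
    then show "\<phi> (g \<otimes> h) = \<phi> g \<otimes>\<^bsub>BijGroup E\<^esub> \<phi> h"
      using bij gh by (simp add: BijGroup_def)
  qed
  then show ?thesis
    using G group_BijGroup by (simp add: group_action_def group_hom_def group_hom_axioms_def)
qed

locale compact_action =
  fixes G (structure) and X :: "'x topology" and \<phi>
  assumes compact_G: "compact_G_space G X \<phi>"
begin

sublocale group_action G "topspace X" \<phi>
  using compact_G by (simp add: compact_G_space_def)

sublocale group G
  using group_hom by (simp add: group_hom_def)

lemma compact: "compact_space X" and Hausdorff: "Hausdorff_space X" and nonempty: "topspace X \<noteq> {}"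
  using compact_G by (auto simp: compact_G_space_def)

lemma continuous: "g \<in> carrier G \<Longrightarrow> continuous_map X X (\<phi> g)"
  using compact_G by (simp add: compact_G_space_def homeomorphic_imp_continuous_map)

lemma act_closed: "g \<in> carrier G \<Longrightarrow> x \<in> topspace X \<Longrightarrow> \<phi> g x \<in> topspace X"
  using element_image by blast

lemma act_mult:
  "g \<in> carrier G \<Longrightarrow> h \<in> carrier G \<Longrightarrow> x \<in> topspace X \<Longrightarrow> \<phi> (g \<otimes> h) x = \<phi> g (\<phi> h x)"
  using composition_rule by simp

lemma act_one: "x \<in> topspace X \<Longrightarrow> \<phi> \<one> x = x"
  using id_eq_one by (metis restrict_apply')

lemma act_inv:
  assumes "g \<in> carrier G" "x \<in> topspace X"
  shows "\<phi> (inv g) (\<phi> g x) = x" "\<phi> g (\<phi> (inv g) x) = x"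
  using act_mult[of "inv g" g x] act_mult[of g "inv g" x] assms act_one by auto

lemma act_ext: "g \<in> carrier G \<Longrightarrow> \<phi> g \<in> extensional (topspace X)"
  using bij_prop0 by (simp add: Bij_def)

sublocale C: function_space "topspace X" "Cont X"
  by (rule function_space_Cont[OF compact])

lemma Cont_act: "g \<in> carrier G \<Longrightarrow> f \<in> Cont X \<Longrightarrow> (\<lambda>x. f (\<phi> g x)) \<in> Cont X"
  using continuous_map_compose[OF continuous, of g euclideanreal f] by (simp add: Cont_def comp_def)

end

lemma compact_G_spaceI:
  fixes G (structure)
  assumes X: "compact_space X" "Hausdorff_space X" "topspace X \<noteq> {}"
    and act: "group_action G (topspace X) \<phi>"
    and cont: "\<And>g. g \<in> carrier G \<Longrightarrow> continuous_map X X (\<phi> g)"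
  shows "compact_G_space G X \<phi>"
proof -
  interpret group_action G "topspace X" \<phi> by fact
  interpret group G using group_hom by (simp add: group_hom_def)
  have "homeomorphic_map X X (\<phi> g)" if g: "g \<in> carrier G" for g
  proof (rule continuous_imp_homeomorphic_map[OF cont[OF g] X(1,2)])
    show "\<phi> g ` topspace X = topspace X" using surj_prop[OF g] .
    show "inj_on (\<phi> g) (topspace X)" using inj_prop[OF g] .
  qed
  then show ?thesis using X act by (simp add: compact_G_space_def)
qed

lemma compact_G_space_closed_invariant:
  assumes X: "compact_G_space G X \<phi>" and B: "closedin X B" "B \<noteq> {}" "invariant_set G \<phi> B"
  shows "compact_G_space G (subtopology X B) (\<lambda>g. restrict (\<phi> g) B)"
proof -
  interpret compact_action G X \<phi> by unfold_locales (rule X)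
  have BX: "B \<subseteq> topspace X" using closedin_subset[OF B(1)] .
  then have tB: "topspace (subtopology X B) = B" by auto
  have inv: "\<phi> g x \<in> B" if "g \<in> carrier G" "x \<in> B" for g x
    using B(3) that by (auto simp: invariant_set_def)
  show ?thesis
  proof (rule compact_G_spaceI)
    show "compact_space (subtopology X B)"
      using closedin_compact_space[OF compact B(1)] by (simp add: compact_space_subtopology)
    show "Hausdorff_space (subtopology X B)"
      using Hausdorff Hausdorff_space_subtopology by blast
    show "topspace (subtopology X B) \<noteq> {}" using B(2) tB by simp
    show "group_action G (topspace (subtopology X B)) (\<lambda>g. restrict (\<phi> g) B)"
      unfolding tB using inv act_one act_mult BX
      by (intro group_actionI) (auto simp: subset_eq group_axioms)
    fix g assume g: "g \<in> carrier G"
    have "continuous_map (subtopology X B) X (\<phi> g)"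
      using continuous[OF g] by (rule continuous_map_from_subtopology)
    then have "continuous_map (subtopology X B) (subtopology X B) (\<phi> g)"
      using inv[OF g] tB by (auto simp: continuous_map_in_subtopology)
    then show "continuous_map (subtopology X B) (subtopology X B) (restrict (\<phi> g) B)"
      by (rule continuous_map_eq) (simp add: tB)
  qed
qed

lemma minimal_subset_exists:
  assumes X: "compact_G_space G X \<phi>"
  obtains B where "minimal_closed_invariant G X \<phi> B"
proof -
  interpret compact_action G X \<phi> by unfold_locales (rule X)
  have "invariant_set G \<phi> (topspace X)" using act_closed by (auto simp: invariant_set_def)
  then obtain M where "closedin X M" "M \<noteq> {}" "invariant_set G \<phi> M"
    "\<And>B. closedin X B \<Longrightarrow> B \<noteq> {} \<Longrightarrow> invariant_set G \<phi> B \<Longrightarrow> B \<subseteq> M \<Longrightarrow> B = M"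
  proof (rule minimal_closed_exists[OF compact closedin_topspace nonempty, of "invariant_set G \<phi>"])
    show "invariant_set G \<phi> (\<Inter>\<C>)"
      if "\<C> \<noteq> {}" "\<And>B. B \<in> \<C> \<Longrightarrow> closedin X B \<and> invariant_set G \<phi> B" for \<C>
      using that(2) unfolding invariant_set_def by blast
  qed blast+
  then show thesis by (intro that[of M]) (auto simp: minimal_closed_invariant_def)
qed

lemma minimal_subset_is_minimal_space:
  assumes X: "compact_G_space G X \<phi>" and B: "minimal_closed_invariant G X \<phi> B"
  shows "minimal_compact_G_space G (subtopology X B) (\<lambda>g. restrict (\<phi> g) B)"
proof -
  have B': "closedin X B" "B \<noteq> {}" "invariant_set G \<phi> B"
    using B by (auto simp: minimal_closed_invariant_def)
  have tB: "topspace (subtopology X B) = B" using closedin_subset[OF B'(1)] by auto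
  have cl: "closedin (subtopology X B) C \<longleftrightarrow> closedin X C \<and> C \<subseteq> B" for C
    using closedin_closed_subtopology[OF B'(1)] by blast
  have inv: "invariant_set G (\<lambda>g. restrict (\<phi> g) B) C \<longleftrightarrow> invariant_set G \<phi> C" if "C \<subseteq> B" for C
    using that by (force simp: invariant_set_def)
  show ?thesis
    unfolding minimal_compact_G_space_def
  proof
    show "compact_G_space G (subtopology X B) (\<lambda>g. restrict (\<phi> g) B)"
      by (rule compact_G_space_closed_invariant[OF X B'])
    show "minimal_closed_invariant G (subtopology X B) (\<lambda>g. restrict (\<phi> g) B) (topspace (subtopology X B))"
      using B unfolding minimal_closed_invariant_def tB cl using inv by auto
  qed
qed

section \<open>Strong proximality through integrals\<close>

lemma weak_star_closure:
  assumes \<mu>: "\<mu> \<in> Prob X" and S: "S \<subseteq> Prob X"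
  shows "\<mu> \<in> weak_star X closure_of S \<longleftrightarrow>
    (\<forall>F e. finite F \<and> F \<subseteq> Cont X \<and> 0 < e \<longrightarrow>
      (\<exists>\<nu>\<in>S. \<forall>f\<in>F. \<bar>(\<integral>x. f x \<partial>\<nu>) - (\<integral>x. f x \<partial>\<mu>)\<bar> < e))" (is "_ \<longleftrightarrow> ?R")
proof -
  let ?C = "{f. continuous_map X euclideanreal f}"
  let ?I = "\<lambda>\<mu>. \<lambda>h\<in>?C. \<integral>x. h x \<partial>\<mu>"
  have I: "continuous_map (weak_star X) (product_topology (\<lambda>_. euclideanreal) ?C) ?I"
    unfolding weak_star_def
    using continuous_map_pullback[OF continuous_map_id] by (simp add: comp_def)
  have ev: "continuous_map (weak_star X) euclideanreal (\<lambda>\<mu>. \<integral>x. f x \<partial>\<mu>)" if "f \<in> Cont X" for f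
  proof -
    have "f \<in> ?C" using that by (simp add: Cont_def)
    then have "continuous_map (weak_star X) euclideanreal (\<lambda>\<mu>. ?I \<mu> f)"
      using I unfolding continuous_map_componentwise by blast
    then show ?thesis using \<open>f \<in> ?C\<close> by simp
  qed
  show ?thesis
  proof
    assume L: "\<mu> \<in> weak_star X closure_of S"
    show ?R
    proof (intro allI impI)
      fix F and e :: real assume F: "finite F \<and> F \<subseteq> Cont X \<and> 0 < e"
      let ?V = "\<lambda>f. {\<nu> \<in> topspace (weak_star X). (\<integral>x. f x \<partial>\<nu>) \<in> ball (\<integral>x. f x \<partial>\<mu>) e}"
      have "openin (weak_star X) (?V f)" if "f \<in> F" for f
        using F that by (intro openin_continuous_map_preimage[OF ev]) auto
      then have "openin (weak_star X) (topspace (weak_star X) \<inter> (\<Inter>f\<in>F. ?V f))"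
        using F openin_topspace[of "weak_star X"]
        by (cases "F = {}") (auto simp del: topspace_weak_star intro!: openin_Int openin_INT2)
      moreover have "\<mu> \<in> topspace (weak_star X) \<inter> (\<Inter>f\<in>F. ?V f)" using \<mu> F by auto
      ultimately obtain \<nu> where "\<nu> \<in> S" "\<nu> \<in> (\<Inter>f\<in>F. ?V f)"
        using L unfolding in_closure_of by blast
      then show "\<exists>\<nu>\<in>S. \<forall>f\<in>F. \<bar>(\<integral>x. f x \<partial>\<nu>) - (\<integral>x. f x \<partial>\<mu>)\<bar> < e"
        by (intro bexI[of _ \<nu>]) (auto simp: dist_real_def abs_minus_commute)
    qed
  next
    assume R: ?R
    show "\<mu> \<in> weak_star X closure_of S"
      unfolding in_closure_of
    proof (intro conjI allI impI)
      show "\<mu> \<in> topspace (weak_star X)" using \<mu> by simp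
      fix T assume "\<mu> \<in> T \<and> openin (weak_star X) T"
      then obtain W where W: "openin (product_topology (\<lambda>_. euclideanreal) ?C) W"
        "T = ?I -` W \<inter> Prob X" and \<mu>T: "\<mu> \<in> T"
        unfolding weak_star_def openin_pullback_topology by blast
      have "?I \<mu> \<in> W" using \<mu>T W(2) by simp
      from product_topology_open_contains_basis[OF W(1) this]
      obtain Y where Y: "?I \<mu> \<in> (\<Pi>\<^sub>E i\<in>?C. Y i)" "\<And>i. open (Y i)" "finite {i. Y i \<noteq> UNIV}"
        "(\<Pi>\<^sub>E i\<in>?C. Y i) \<subseteq> W" by auto
      define F where "F = {i \<in> ?C. Y i \<noteq> UNIV}"
      have F: "finite F" "F \<subseteq> Cont X" using Y(3) by (auto simp: F_def Cont_def)
      have "\<exists>e>0. \<forall>t. \<bar>t - (\<integral>x. f x \<partial>\<mu>)\<bar> < e \<longrightarrow> t \<in> Y f" if "f \<in> F" for f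
      proof -
        have "(\<integral>x. f x \<partial>\<mu>) \<in> Y f" using Y(1) that by (auto simp: F_def PiE_def Pi_def)
        then show ?thesis using Y(2)[of f] unfolding open_dist dist_real_def by auto
      qed
      then obtain e where e: "\<And>f. f \<in> F \<Longrightarrow> 0 < e f"
        "\<And>f t. f \<in> F \<Longrightarrow> \<bar>t - (\<integral>x. f x \<partial>\<mu>)\<bar> < e f \<Longrightarrow> t \<in> Y f" by metis
      define d where "d = Min (insert 1 (e ` F))"
      have d: "0 < d" "\<And>f. f \<in> F \<Longrightarrow> d \<le> e f" using F(1) e(1) by (auto simp: d_def)
      obtain \<nu> where \<nu>: "\<nu> \<in> S" "\<forall>f\<in>F. \<bar>(\<integral>x. f x \<partial>\<nu>) - (\<integral>x. f x \<partial>\<mu>)\<bar> < d"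
        using R F d(1) by blast
      have "?I \<nu> f \<in> Y f" if "f \<in> ?C" for f
      proof (cases "f \<in> F")
        case True
        then show ?thesis using \<nu>(2) d(2) that e(2)[OF True] by force
      next
        case False
        then show ?thesis using that by (simp add: F_def)
      qed
      then have "?I \<nu> \<in> (\<Pi>\<^sub>E i\<in>?C. Y i)" by (intro PiE_I) auto
      then show "\<exists>y. y \<in> S \<and> y \<in> T" using Y(4) W(2) \<nu>(1) S by blast
    qed
  qed
qed

lemma return_Prob:
  assumes "Hausdorff_space X" "x \<in> topspace X"
  shows "return (borel_of X) x \<in> Prob X"
  unfolding Prob_def
proof (intro CollectI conjI ballI)
  show "sets (return (borel_of X) x) = sets (borel_of X)" by simp
  show "prob_space (return (borel_of X) x)" using assms(2) by (intro prob_space_return) simp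
  fix A assume A: "A \<in> sets (return (borel_of X) x)"
  show "emeasure (return (borel_of X) x) A =
      (SUP K\<in>{K. compactin X K \<and> K \<subseteq> A}. emeasure (return (borel_of X) x) K)" (is "_ = ?s")
  proof (rule antisym)
    show "?s \<le> emeasure (return (borel_of X) x) A"
      using A by (intro SUP_least emeasure_mono) auto
    have c: "compactin X {x}" using assms(2) by simp
    have "{x} \<in> sets (borel_of X)"
      using compactin_imp_closedin[OF assms(1) c] by (rule closedin_borel_of)
    then have "x \<in> A \<Longrightarrow> 1 \<le> ?s"
      using c by (intro SUP_upper2[of "{x}"]) auto
    then show "emeasure (return (borel_of X) x) A \<le> ?s"
      using A by (cases "x \<in> A") auto
  qed
qed

lemma Prob_sets: "\<mu> \<in> Prob X \<Longrightarrow> sets \<mu> = sets (borel_of X)"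
  and Prob_space: "\<mu> \<in> Prob X \<Longrightarrow> space \<mu> = topspace X"
  and Prob_prob_space: "\<mu> \<in> Prob X \<Longrightarrow> prob_space \<mu>"
proof -
  assume "\<mu> \<in> Prob X"
  then show s: "sets \<mu> = sets (borel_of X)" and "prob_space \<mu>" by (auto simp: Prob_def)
  show "space \<mu> = topspace X" using sets_eq_imp_space_eq[OF s] by simp
qed

lemma Prob_Cont_measurable: "\<mu> \<in> Prob X \<Longrightarrow> f \<in> Cont X \<Longrightarrow> f \<in> borel_measurable \<mu>"
  using continuous_borel_measurable[of X f] Prob_sets[of \<mu> X]
  by (simp add: Cont_def cong: measurable_cong_sets)

lemma Prob_Cont_integrable:
  assumes "compact_space X" "\<mu> \<in> Prob X" "f \<in> Cont X"
  shows "integrable \<mu> f"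
proof -
  interpret prob_space \<mu> using assms(2) by (rule Prob_prob_space)
  interpret function_space "topspace X" "Cont X" by (rule function_space_Cont[OF assms(1)])
  obtain M where "\<forall>x\<in>topspace X. \<bar>f x\<bar> \<le> M" using bdd_mem[OF assms(3)] by blast
  then show ?thesis
    using Prob_Cont_measurable[OF assms(2,3)] Prob_space[OF assms(2)]
    by (intro integrable_const_bound[of _ M]) auto
qed

text \<open>
  Limits of measures occur only in this form, tested on finitely many continuous functions at a time.
\<close>

lemma strongly_proximal_iff:
  assumes X: "compact_G_space G X \<phi>"
  shows "strongly_proximal G X \<phi> \<longleftrightarrow>
    (\<forall>\<mu>\<in>Prob X. \<exists>x\<in>topspace X. \<forall>F e. finite F \<and> F \<subseteq> Cont X \<and> 0 < e \<longrightarrow>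
      (\<exists>g\<in>carrier G. \<forall>f\<in>F. \<bar>(\<integral>y. f (\<phi> g y) \<partial>\<mu>) - f x\<bar> < e))"
proof -
  interpret compact_action G X \<phi> by unfold_locales (rule X)
  have 1: "(\<integral>y. f y \<partial>distr \<mu> (borel_of X) (\<phi> g)) = (\<integral>y. f (\<phi> g y) \<partial>\<mu>)"
    if "\<mu> \<in> Prob X" "g \<in> carrier G" "f \<in> Cont X" for \<mu> g f
  proof (rule integral_distr)
    show "\<phi> g \<in> \<mu> \<rightarrow>\<^sub>M borel_of X"
      using measurable_borel_of[OF continuous[OF that(2)]] Prob_sets[OF that(1)]
      by (simp cong: measurable_cong_sets)
    show "f \<in> borel_measurable (borel_of X)"
      using that(3) by (simp add: continuous_borel_measurable Cont_def)
  qed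
  have 2: "(\<integral>y. f y \<partial>return (borel_of X) x) = f x" if "x \<in> topspace X" "f \<in> Cont X" for f x
    using that by (intro integral_return) (auto simp: continuous_borel_measurable Cont_def)
  have "return (borel_of X) x \<in> weak_star X closure_of {distr \<mu> (borel_of X) (\<phi> g) | g. g \<in> carrier G}
    \<longleftrightarrow> (\<forall>F e. finite F \<and> F \<subseteq> Cont X \<and> 0 < e \<longrightarrow>
      (\<exists>g\<in>carrier G. \<forall>f\<in>F. \<bar>(\<integral>y. f (\<phi> g y) \<partial>\<mu>) - f x\<bar> < e))"
    if \<mu>: "\<mu> \<in> Prob X" and x: "x \<in> topspace X" for \<mu> x
  proof -
    have "{distr \<mu> (borel_of X) (\<phi> g) | g. g \<in> carrier G} \<subseteq> Prob X"
      using Prob_distr[OF continuous Hausdorff \<mu>] by auto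
    note wc = weak_star_closure[OF return_Prob[OF Hausdorff x] this]
    show ?thesis
      unfolding wc
    proof (intro all_cong1 imp_cong refl)
      fix F and e :: real assume F: "finite F \<and> F \<subseteq> Cont X \<and> 0 < e"
      have "(\<forall>f\<in>F. \<bar>(\<integral>y. f y \<partial>distr \<mu> (borel_of X) (\<phi> g)) - (\<integral>y. f y \<partial>return (borel_of X) x)\<bar> < e)
        \<longleftrightarrow> (\<forall>f\<in>F. \<bar>(\<integral>y. f (\<phi> g y) \<partial>\<mu>) - f x\<bar> < e)" if "g \<in> carrier G" for g
        using F that 1[OF \<mu>] 2[OF x] by (intro ball_cong) auto
      then show "(\<exists>\<nu>\<in>{distr \<mu> (borel_of X) (\<phi> g) |g. g \<in> carrier G}.
            \<forall>f\<in>F. \<bar>(\<integral>y. f y \<partial>\<nu>) - (\<integral>y. f y \<partial>return (borel_of X) x)\<bar> < e) \<longleftrightarrow>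
        (\<exists>g\<in>carrier G. \<forall>f\<in>F. \<bar>(\<integral>y. f (\<phi> g y) \<partial>\<mu>) - f x\<bar> < e)" by blast
    qed
  qed
  then show ?thesis unfolding strongly_proximal_def by (intro ball_cong bex_cong refl) auto
qed

text \<open>
  Being a boundary depends only on the set of homeomorphisms by which the group acts, and survives
  enlarging this set. This covers inflating an action from a quotient, passing to a quotient by a
  subgroup that acts trivially, twisting by an automorphism, and extending from a subgroup.
\<close>

lemma G_boundary_more_maps:
  assumes X: "G_boundary G X \<phi>" and H: "compact_G_space H X \<psi>"
    and sub: "\<phi> ` carrier G \<subseteq> \<psi> ` carrier H"
  shows "G_boundary H X \<psi>"
proof -
  have "invariant_set G \<phi> B" if "invariant_set H \<psi> B" for B
    unfolding invariant_set_def
  proof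
    fix g assume "g \<in> carrier G"
    then obtain h where "h \<in> carrier H" "\<phi> g = \<psi> h" using sub by blast
    then show "\<phi> g ` B \<subseteq> B" using that by (simp add: invariant_set_def)
  qed
  moreover interpret H: compact_action H X \<psi> by unfold_locales (rule H)
  have "invariant_set H \<psi> (topspace X)" using H.act_closed by (auto simp: invariant_set_def)
  ultimately have "minimal_closed_invariant H X \<psi> (topspace X)"
    using X unfolding G_boundary_def minimal_compact_G_space_def minimal_closed_invariant_def by blast
  moreover have "strongly_proximal H X \<psi>"
    unfolding strongly_proximal_def
  proof
    fix \<mu> assume "\<mu> \<in> Prob X"
    then obtain x where "x \<in> topspace X" "return (borel_of X) x \<in>
        weak_star X closure_of {distr \<mu> (borel_of X) (\<phi> g) | g. g \<in> carrier G}"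
      using X by (auto simp: G_boundary_def strongly_proximal_def)
    moreover have "{distr \<mu> (borel_of X) (\<phi> g) | g. g \<in> carrier G} \<subseteq>
        {distr \<mu> (borel_of X) (\<psi> g) | g. g \<in> carrier H}"
    proof
      fix \<nu> assume "\<nu> \<in> {distr \<mu> (borel_of X) (\<phi> g) | g. g \<in> carrier G}"
      then obtain g where g: "g \<in> carrier G" "\<nu> = distr \<mu> (borel_of X) (\<phi> g)" by blast
      then obtain h where "h \<in> carrier H" "\<phi> g = \<psi> h" using sub by blast
      then show "\<nu> \<in> {distr \<mu> (borel_of X) (\<psi> g) | g. g \<in> carrier H}" using g(2) by auto
    qed
    ultimately show "\<exists>x\<in>topspace X. return (borel_of X) x \<in>
        weak_star X closure_of {distr \<mu> (borel_of X) (\<psi> g) | g. g \<in> carrier H}"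
      using closure_of_mono by blast
  qed
  ultimately show ?thesis using H by (simp add: G_boundary_def minimal_compact_G_space_def)
qed

section \<open>Boundaries inside compact convex sets\<close>

definition fun_convex :: "('i \<Rightarrow> real) set \<Rightarrow> bool" where
  "fun_convex Q \<longleftrightarrow> (\<forall>p\<in>Q. \<forall>q\<in>Q. \<forall>t. 0 \<le> t \<and> t \<le> 1 \<longrightarrow> (\<lambda>i. (1 - t) * p i + t * q i) \<in> Q)"

lemma fun_convexD:
  "fun_convex Q \<Longrightarrow> p \<in> Q \<Longrightarrow> q \<in> Q \<Longrightarrow> 0 \<le> t \<Longrightarrow> t \<le> 1 \<Longrightarrow> (\<lambda>i. (1 - t) * p i + t * q i) \<in> Q"
  by (simp add: fun_convex_def)

lemma fun_convex_sum:
  assumes Q: "fun_convex Q" and K: "finite K"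
    and w: "\<And>k. k \<in> K \<Longrightarrow> 0 \<le> w k" and r: "\<And>k. k \<in> K \<Longrightarrow> r k \<in> Q"
    and s: "0 < (\<Sum>k\<in>K. w k)"
  shows "(\<lambda>i. (\<Sum>k\<in>K. w k * r k i) / (\<Sum>k\<in>K. w k)) \<in> Q"
  using K w r s
proof (induction K rule: finite_induct)
  case empty
  then show ?case by simp
next
  case (insert a K)
  define W where "W = (\<Sum>k\<in>K. w k)"
  have W0: "0 \<le> W" using insert by (auto simp: W_def intro: sum_nonneg)
  have sum: "(\<Sum>k\<in>insert a K. w k) = w a + W" using insert by (simp add: W_def)
  show ?case
  proof (cases "W = 0")
    case True
    then have "\<forall>k\<in>K. w k = 0" using insert by (simp add: W_def sum_nonneg_eq_0_iff)
    then have "(\<lambda>i. (\<Sum>k\<in>insert a K. w k * r k i) / (\<Sum>k\<in>insert a K. w k)) = r a"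
      using insert sum True by auto
    then show ?thesis using insert by simp
  next
    case False
    then have W: "0 < W" using W0 by simp
    have IH: "(\<lambda>i. (\<Sum>k\<in>K. w k * r k i) / W) \<in> Q"
      unfolding W_def using insert W by (intro insert.IH) (auto simp: W_def)
    have wa: "0 \<le> w a" using insert by simp
    define t where "t = W / (w a + W)"
    have t: "0 \<le> t" "t \<le> 1" using wa W by (auto simp: t_def)
    have "(\<lambda>i. (1 - t) * r a i + t * ((\<Sum>k\<in>K. w k * r k i) / W)) \<in> Q"
      using fun_convexD[OF Q insert.prems(2) IH t] by simp
    also have "(\<lambda>i. (1 - t) * r a i + t * ((\<Sum>k\<in>K. w k * r k i) / W)) =
        (\<lambda>i. (\<Sum>k\<in>insert a K. w k * r k i) / (\<Sum>k\<in>insert a K. w k))"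
    proof
      fix i
      have "1 - t = w a / (w a + W)" using wa W by (simp add: t_def field_simps)
      then have "(1 - t) * r a i + t * ((\<Sum>k\<in>K. w k * r k i) / W) =
          (w a * r a i) / (w a + W) + (\<Sum>k\<in>K. w k * r k i) / (w a + W)"
        using W by (simp add: t_def)
      also have "\<dots> = (w a * r a i + (\<Sum>k\<in>K. w k * r k i)) / (w a + W)"
        by (simp add: add_divide_distrib)
      also have "\<dots> = (\<Sum>k\<in>insert a K. w k * r k i) / (\<Sum>k\<in>insert a K. w k)"
        using insert sum by simp
      finally show "(1 - t) * r a i + t * ((\<Sum>k\<in>K. w k * r k i) / W) =
        (\<Sum>k\<in>insert a K. w k * r k i) / (\<Sum>k\<in>insert a K. w k)" .
    qed
    finally show ?thesis .
  qed
qed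

text \<open>
  For finitely many coordinates, the space is cut into finitely many Borel pieces on which these
  coordinates vary by less than the error. The corresponding Riemann sum is a convex combination of
  points of the set, so the barycenter is a limit of points of the set.
\<close>

lemma barycenter_mem:
  fixes Q :: "('i \<Rightarrow> real) set"
  assumes \<nu>: "prob_space \<nu>" and sp: "space \<nu> \<subseteq> Q"
    and meas: "\<And>i. (\<lambda>q. q i) \<in> borel_measurable \<nu>"
    and Q: "closedin euclidean Q" "fun_convex Q" "\<And>i. \<exists>M. \<forall>q\<in>Q. \<bar>q i\<bar> \<le> M"
  shows "(\<lambda>i. \<integral>q. q i \<partial>\<nu>) \<in> Q"
proof -
  interpret prob_space \<nu> by fact
  have int: "integrable \<nu> (\<lambda>q. q i)" for i
  proof -
    obtain M where "\<forall>q\<in>Q. \<bar>q i\<bar> \<le> M" using Q(3) by blast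
    then show ?thesis using sp meas by (intro integrable_const_bound[of _ M]) auto
  qed
  have "(\<lambda>i. \<integral>q. q i \<partial>\<nu>) \<in> euclidean closure_of Q"
    unfolding in_closure_fun
  proof (intro allI impI)
    fix J :: "'i set" and e :: real assume "finite J \<and> 0 < e"
    then have J: "finite J" and e: "0 < e" by auto
    define d where "d = e / 2"
    have d: "0 < d" "d < e" using e by (auto simp: d_def)
    define key where "key q = (\<lambda>i\<in>J. \<lfloor>q i / d\<rfloor>)" for q :: "'i \<Rightarrow> real"
    define E where "E k = {q \<in> space \<nu>. key q = k}" for k
    define K where "K = key ` space \<nu>"
    obtain M where M: "\<And>i q. q \<in> Q \<Longrightarrow> \<bar>q i\<bar> \<le> M i" using Q(3) by metis
    have "K \<subseteq> (\<Pi>\<^sub>E i\<in>J. {\<lfloor>- M i / d\<rfloor>..\<lfloor>M i / d\<rfloor>})"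
    proof -
      have "\<lfloor>- M i / d\<rfloor> \<le> \<lfloor>q i / d\<rfloor> \<and> \<lfloor>q i / d\<rfloor> \<le> \<lfloor>M i / d\<rfloor>" if "q \<in> space \<nu>" for q i
        using M[of q i] sp that d(1) by (intro conjI floor_mono divide_right_mono) auto
      then show ?thesis by (auto simp: K_def key_def)
    qed
    then have K: "finite K" using J by (elim finite_subset) (auto intro: finite_PiE)
    have Em: "E k \<in> sets \<nu>" if "k \<in> K" for k
    proof -
      have "k \<in> extensional J" using that by (auto simp: K_def key_def)
      then have "E k = {q \<in> space \<nu>. \<forall>i\<in>J. \<lfloor>q i / d\<rfloor> = k i}"
        by (auto simp: E_def key_def fun_eq_iff extensional_def)
      also have "\<dots> \<in> sets \<nu>"
      proof (rule sets.sets_Collect_finite_All)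
        show "{q \<in> space \<nu>. \<lfloor>q i / d\<rfloor> = k i} \<in> sets \<nu>" for i
        proof -
          have "{q \<in> space \<nu>. \<lfloor>q i / d\<rfloor> = k i} = {q \<in> space \<nu>. of_int (k i) * d \<le> q i} \<inter> {q \<in> space \<nu>. q i < (of_int (k i) + 1) * d}"
            using d(1) by (auto simp: floor_eq_iff field_simps)
          then show ?thesis using meas[of i] by simp
        qed
      qed (use J in auto)
      finally show ?thesis .
    qed
    have "\<exists>q\<in>space \<nu>. key q = k" if "k \<in> K" for k using that by (auto simp: K_def)
    then obtain rep where rep: "\<And>k. k \<in> K \<Longrightarrow> rep k \<in> space \<nu>" "\<And>k. k \<in> K \<Longrightarrow> key (rep k) = k"
      by metis
    have one: "(\<Sum>k\<in>K. indicat_real (E k) q * h k) = h (key q)" if "q \<in> space \<nu>" for q and h :: "_ \<Rightarrow> real"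
    proof -
      have "(\<Sum>k\<in>K. indicat_real (E k) q * h k) = (\<Sum>k\<in>{key q}. indicat_real (E k) q * h k)"
        using K that by (intro sum.mono_neutral_right) (auto simp: K_def E_def)
      then show ?thesis using that by (simp add: E_def)
    qed
    have intE: "integrable \<nu> (\<lambda>q. indicat_real (E k) q * c)" if "k \<in> K" for k c
      using Em[OF that] by (intro integrable_mult_left) (auto simp: integrable_indicator_iff emeasure_eq_measure)
    have wsum: "(\<Sum>k\<in>K. measure \<nu> (E k) * h k) = (\<integral>q. h (key q) \<partial>\<nu>)" for h :: "_ \<Rightarrow> real"
    proof -
      have "(\<integral>q. h (key q) \<partial>\<nu>) = (\<integral>q. (\<Sum>k\<in>K. indicat_real (E k) q * h k) \<partial>\<nu>)"
        by (intro Bochner_Integration.integral_cong refl) (simp add: one)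
      also have "\<dots> = (\<Sum>k\<in>K. \<integral>q. indicat_real (E k) q * h k \<partial>\<nu>)"
        by (rule Bochner_Integration.integral_sum) (rule intE)
      also have "\<dots> = (\<Sum>k\<in>K. measure \<nu> (E k) * h k)"
        using Em by (intro sum.cong refl) (simp add: sets.sets_into_space Int_absorb1)
      finally show ?thesis by simp
    qed
    have w1: "(\<Sum>k\<in>K. measure \<nu> (E k)) = 1" using wsum[of "\<lambda>_. 1"] by (simp add: prob_space)
    define p where "p i = (\<Sum>k\<in>K. measure \<nu> (E k) * rep k i)" for i
    have "(\<lambda>i. (\<Sum>k\<in>K. measure \<nu> (E k) * rep k i) / (\<Sum>k\<in>K. measure \<nu> (E k))) \<in> Q"
      using rep(1) sp w1 by (intro fun_convex_sum[OF Q(2) K]) auto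
    then have "p \<in> Q" unfolding w1 by (simp add: p_def[abs_def])
    moreover have "\<bar>p i - (\<integral>q. q i \<partial>\<nu>)\<bar> < e" if "i \<in> J" for i
    proof -
      have b: "\<bar>rep (key q) i - q i\<bar> \<le> d" if q: "q \<in> space \<nu>" for q
      proof -
        have "key (rep (key q)) i = key q i" using rep(2) q by (simp add: K_def)
        then have "\<lfloor>rep (key q) i / d\<rfloor> = \<lfloor>q i / d\<rfloor>" using \<open>i \<in> J\<close> by (simp add: key_def)
        then have "\<bar>rep (key q) i / d - q i / d\<bar> \<le> 1" by linarith
        then show ?thesis using d(1) by (simp add: diff_divide_distrib[symmetric] abs_divide pos_divide_le_eq)
      qed
      have i1: "integrable \<nu> (\<lambda>q. rep (key q) i)"
      proof -
        have "integrable \<nu> (\<lambda>q. \<Sum>k\<in>K. indicat_real (E k) q * rep k i)"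
          by (rule Bochner_Integration.integrable_sum) (rule intE)
        then show ?thesis
          by (rule Bochner_Integration.integrable_cong[THEN iffD1, rotated 2]) (auto simp: one)
      qed
      have "p i - (\<integral>q. q i \<partial>\<nu>) = (\<integral>q. rep (key q) i - q i \<partial>\<nu>)"
        unfolding p_def wsum using i1 int[of i] by simp
      also have "\<bar>\<dots>\<bar> \<le> (\<integral>q. \<bar>rep (key q) i - q i\<bar> \<partial>\<nu>)" by (rule integral_abs_bound)
      also have "\<dots> \<le> (\<integral>q. d \<partial>\<nu>)"
        using i1 int[of i] b by (intro integral_mono) auto
      also have "\<dots> < e" using d(2) by (simp add: prob_space)
      finally show ?thesis .
    qed
    ultimately show "\<exists>p\<in>Q. \<forall>i\<in>J. \<bar>p i - (\<integral>q. q i \<partial>\<nu>)\<bar> < e"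
      by (intro bexI[of _ p]) auto
  qed
  then show ?thesis by (simp only: closure_of_eq[THEN iffD2, OF Q(1)])
qed

text \<open>
  By the last condition, each coordinate of a translated point is read off from some coordinate of the
  point. So the action is affine and continuous, and the barycenter of a translated measure is the
  translate of the barycenter. Groups act in this way on functionals and on families of functionals.
\<close>

locale convex_action =
  fixes G (structure) and Q :: "('i \<Rightarrow> real) set" and \<alpha>
  assumes cptQ: "compactin euclidean Q" and neQ: "Q \<noteq> {}" and convexQ: "fun_convex Q"
    and act: "group_action G Q \<alpha>"
    and coord: "g \<in> carrier G \<Longrightarrow> \<exists>j. \<forall>q\<in>Q. \<alpha> g q i = q j"
begin

lemma compact_G_space: "compact_G_space G (top_of_set Q) \<alpha>"
proof (rule compact_G_spaceI)
  show "compact_space (top_of_set Q)" using cptQ by (simp add: compact_space_subtopology)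
  show "Hausdorff_space (top_of_set Q)" using Hausdorff_fun Hausdorff_space_subtopology by blast
  show "topspace (top_of_set Q) \<noteq> {}" using neQ by simp
  show "group_action G (topspace (top_of_set Q)) \<alpha>" using act by simp
  interpret group_action G Q \<alpha> by (rule act)
  fix g assume g: "g \<in> carrier G"
  have "continuous_map (top_of_set Q) euclidean (\<alpha> g)"
  proof (rule continuous_map_into_fun)
    fix i
    obtain j where j: "\<forall>q\<in>Q. \<alpha> g q i = q j" using coord[OF g] by blast
    show "continuous_map (top_of_set Q) euclideanreal (\<lambda>q. \<alpha> g q i)"
      using continuous_map_coordinate_sub[of Q j] by (rule continuous_map_eq) (simp add: j)
  qed
  moreover have "\<alpha> g q \<in> Q" if "q \<in> Q" for q using element_image[OF g that] by blast
  ultimately show "continuous_map (top_of_set Q) (top_of_set Q) (\<alpha> g)"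
    by (auto simp: continuous_map_in_subtopology)
qed

sublocale A: compact_action G "top_of_set Q" \<alpha>
  by unfold_locales (rule compact_G_space)

lemma closedQ: "closedin euclidean Q"
  using compactin_imp_closedin[OF Hausdorff_fun cptQ] .

lemma bounded_coord: "\<exists>M. \<forall>q\<in>Q. \<bar>q i\<bar> \<le> M"
proof -
  have "compactin euclideanreal ((\<lambda>q. q i) ` Q)"
    using image_compactin[OF cptQ continuous_map_coordinate] .
  then have "bounded ((\<lambda>q. q i) ` Q)" by (simp add: compact_imp_bounded)
  then show ?thesis by (auto simp: bounded_iff)
qed

lemma minimal_convex_exists:
  obtains Q' where "Q' \<subseteq> Q" "convex_action G Q' (\<lambda>g. restrict (\<alpha> g) Q')"
    "\<And>C. closedin euclidean C \<Longrightarrow> C \<noteq> {} \<Longrightarrow> fun_convex C \<Longrightarrow> invariant_set G \<alpha> C \<Longrightarrow> C \<subseteq> Q' \<Longrightarrow> C = Q'"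
proof -
  let ?P = "\<lambda>C. fun_convex C \<and> invariant_set G \<alpha> C"
  have cl: "closedin (top_of_set Q) C \<longleftrightarrow> closedin euclidean C \<and> C \<subseteq> Q" for C
    using closedin_closed_subtopology[OF closedQ] by blast
  have Qc: "closedin (top_of_set Q) Q" using closedin_topspace[of "top_of_set Q"] by simp
  have PQ: "?P Q" using convexQ A.act_closed by (auto simp: invariant_set_def)
  obtain M where M: "closedin (top_of_set Q) M" "M \<noteq> {}" "?P M" "M \<subseteq> Q"
    "\<And>B. closedin (top_of_set Q) B \<Longrightarrow> B \<noteq> {} \<Longrightarrow> ?P B \<Longrightarrow> B \<subseteq> M \<Longrightarrow> B = M"
  proof (rule minimal_closed_exists[OF A.compact Qc neQ, of ?P])
    show "?P (\<Inter>\<C>)" if "\<C> \<noteq> {}" "\<And>B. B \<in> \<C> \<Longrightarrow> closedin (top_of_set Q) B \<and> ?P B" for \<C>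
      using that(2) unfolding fun_convex_def invariant_set_def by blast
  qed (use PQ in blast)+
  show thesis
  proof (rule that[of M])
    show "M \<subseteq> Q" by (rule M(4))
    have Mc: "closedin euclidean M" using M(1) cl by blast
    have "group_action G M (\<lambda>g. restrict (\<alpha> g) M)"
      using compact_G_space_closed_invariant[OF compact_G_space M(1,2)] M(3,4)
      by (simp add: compact_G_space_def Int_absorb1)
    moreover have "\<exists>j. \<forall>q\<in>M. restrict (\<alpha> g) M q i = q j" if "g \<in> carrier G" for g i
      using coord[OF that, of i] M(4) by (auto simp: subset_eq)
    moreover have "compactin euclidean M"
      using cptQ Mc M(4) closed_compactin by blast
    ultimately show "convex_action G M (\<lambda>g. restrict (\<alpha> g) M)"
      using M(2,3) by (simp add: convex_action_def)
    fix C assume "closedin euclidean C" "C \<noteq> {}" "fun_convex C" "invariant_set G \<alpha> C" "C \<subseteq> M"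
    then show "C = M" using M(4) by (intro M(5)) (auto simp: cl)
  qed
qed

end

lemma square_convex:
  fixes a b t :: real
  assumes "0 \<le> t" "t \<le> 1"
  shows "((1 - t) * a + t * b)\<^sup>2 \<le> (1 - t) * a\<^sup>2 + t * b\<^sup>2"
proof -
  have "(1 - t) * a\<^sup>2 + t * b\<^sup>2 - ((1 - t) * a + t * b)\<^sup>2 = (1 - t) * t * (a - b)\<^sup>2"
    by (simp add: power2_eq_square algebra_simps)
  moreover have "0 \<le> (1 - t) * t * (a - b)\<^sup>2" using assms by simp
  ultimately show ?thesis by linarith
qed

locale minimal_convex_action = convex_action +
  assumes minimal: "closedin euclidean C \<Longrightarrow> C \<noteq> {} \<Longrightarrow> fun_convex C \<Longrightarrow> invariant_set G \<alpha> C \<Longrightarrow>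
    C \<subseteq> Q \<Longrightarrow> C = Q"
begin

text \<open>
  The points whose whole orbit stays at distance at least \<open>e\<close> below the maximum of the sum of
  squares, a convex function, form a closed convex invariant set. It misses the points where the maximum is attained, hence is empty
  by minimality.
\<close>

lemma orbit_approaches_max:
  assumes J: "finite J" and b: "b \<in> Q" and e: "0 < e"
  obtains g where "g \<in> carrier G" "\<And>q. q \<in> Q \<Longrightarrow> (\<Sum>i\<in>J. (q i)\<^sup>2) < (\<Sum>i\<in>J. (\<alpha> g b i)\<^sup>2) + e"
proof -
  let ?F = "\<lambda>q. \<Sum>i\<in>J. (q i)\<^sup>2 :: real"
  have Fc: "continuous_map (top_of_set Q) euclideanreal ?F"
    using J by (intro continuous_intros continuous_map_coordinate_sub) auto
  have Fgc: "continuous_map (top_of_set Q) euclideanreal (\<lambda>q. ?F (\<alpha> g q))" if "g \<in> carrier G" for g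
    using continuous_map_compose[OF A.continuous[OF that] Fc] by (simp add: comp_def)
  have "compact (?F ` Q)"
    using image_compactin[OF _ Fc, of Q] cptQ by (simp add: compactin_subtopology)
  then obtain m where m: "m \<in> ?F ` Q" "\<And>y. y \<in> ?F ` Q \<Longrightarrow> y \<le> m"
    using compact_attains_sup[of "?F ` Q"] neQ by auto
  then obtain q0 where q0: "q0 \<in> Q" "?F q0 = m" by auto
  have "\<exists>g\<in>carrier G. m - e < ?F (\<alpha> g b)"
  proof (rule ccontr)
    assume "\<not> ?thesis"
    then have b': "\<And>g. g \<in> carrier G \<Longrightarrow> ?F (\<alpha> g b) \<le> m - e" by force
    define C where "C = {q \<in> Q. \<forall>g\<in>carrier G. ?F (\<alpha> g q) \<le> m - e}"
    have "closedin (top_of_set Q) C"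
    proof -
      have "C = (\<Inter>g\<in>carrier G. {q \<in> topspace (top_of_set Q). ?F (\<alpha> g q) \<in> {..m - e}})"
        using A.one_closed by (auto simp: C_def)
      moreover have "closedin (top_of_set Q) {q \<in> topspace (top_of_set Q). ?F (\<alpha> g q) \<in> {..m - e}}"
        if "g \<in> carrier G" for g
        by (rule closedin_continuous_map_preimage[OF Fgc[OF that]]) auto
      ultimately show ?thesis using A.one_closed by (auto intro!: closedin_INT)
    qed
    then have "closedin euclidean C"
      using closedin_closed_subtopology[OF closedQ] by blast
    moreover have "C \<noteq> {}" using b b' by (auto simp: C_def)
    moreover have "fun_convex C"
      unfolding fun_convex_def
    proof (intro ballI allI impI)
      fix p q t assume pq: "p \<in> C" "q \<in> C" and t: "0 \<le> t \<and> t \<le> (1::real)"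
      let ?r = "\<lambda>i. (1 - t) * p i + t * q i"
      have r: "?r \<in> Q" using fun_convexD[OF convexQ, of p q t] pq t by (simp add: C_def)
      have "?F (\<alpha> g ?r) \<le> m - e" if g: "g \<in> carrier G" for g
      proof -
        have "\<alpha> g ?r i = (1 - t) * \<alpha> g p i + t * \<alpha> g q i" for i
          using coord[OF g, of i] r pq unfolding C_def by force
        then have "?F (\<alpha> g ?r) \<le> (\<Sum>i\<in>J. (1 - t) * (\<alpha> g p i)\<^sup>2 + t * (\<alpha> g q i)\<^sup>2)"
          using t square_convex by (intro sum_mono) simp
        also have "\<dots> = (1 - t) * ?F (\<alpha> g p) + t * ?F (\<alpha> g q)"
          by (simp add: sum.distrib sum_distrib_left)
        also have "\<dots> \<le> (1 - t) * (m - e) + t * (m - e)"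
          using pq t g by (intro add_mono mult_left_mono) (auto simp: C_def)
        finally show ?thesis by (simp add: algebra_simps)
      qed
      then show "?r \<in> C" using r by (simp add: C_def)
    qed
    moreover have "invariant_set G \<alpha> C"
      unfolding invariant_set_def
    proof (intro ballI subsetI)
      fix g x assume g: "g \<in> carrier G" and "x \<in> \<alpha> g ` C"
      then obtain q where q: "q \<in> C" "x = \<alpha> g q" by blast
      then have qQ: "q \<in> Q" by (simp add: C_def)
      have "?F (\<alpha> h x) \<le> m - e" if h: "h \<in> carrier G" for h
      proof -
        have "\<alpha> h x = \<alpha> (h \<otimes> g) q" using q(2) A.act_mult[OF h g, of q] qQ by simp
        then show ?thesis using q(1) A.m_closed[OF h g] by (simp add: C_def)
      qed
      then show "x \<in> C" using A.act_closed[OF g, of q] q qQ by (simp add: C_def)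
    qed
    ultimately have "C = Q" by (intro minimal) (auto simp: C_def)
    then have "?F (\<alpha> \<one> q0) \<le> m - e" using q0 A.one_closed unfolding C_def by blast
    then show False using q0 e A.act_one[of q0] by simp
  qed
  then obtain g where g: "g \<in> carrier G" "m - e < ?F (\<alpha> g b)" by blast
  show thesis
  proof (rule that[OF g(1)])
    fix q assume "q \<in> Q"
    then have "?F q \<le> m" using m(2) by blast
    then show "?F q < ?F (\<alpha> g b) + e" using g(2) by linarith
  qed
qed

text \<open>
  Let \<open>\<nu>\<close> be a measure with barycenter \<open>b\<close>, and let \<open>F\<close> be the sum of the squares of finitely many
  coordinates. The integral of \<open>F\<close> against \<open>g \<nu>\<close> is at most \<open>max F\<close>, and \<open>F (g b)\<close> comes arbitrarily close
  to \<open>max F\<close>. Their difference is the sum of the variances of the coordinates under \<open>g \<nu>\<close>, which can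
  therefore be made as small as desired. So the translates of \<open>\<nu>\<close> concentrate near the points \<open>g b\<close>, and
  converge to a Dirac measure along a subfamily for which the points \<open>g b\<close> converge.
\<close>

lemma minimal_subset_boundary:
  assumes B: "minimal_closed_invariant G (top_of_set Q) \<alpha> B"
  shows "G_boundary G (top_of_set B) (\<lambda>g. restrict (\<alpha> g) B)"
proof -
  have B': "closedin (top_of_set Q) B" "B \<noteq> {}" "invariant_set G \<alpha> B"
    using B by (auto simp: minimal_closed_invariant_def)
  have BQ: "B \<subseteq> Q" using closedin_subset[OF B'(1)] by simp
  have Bc: "closedin euclidean B" using closedin_closed_subtopology[OF closedQ] B'(1) by blast
  have top: "subtopology (top_of_set Q) B = top_of_set B"
    using BQ by (simp add: subtopology_subtopology Int_absorb1)
  have min: "minimal_compact_G_space G (top_of_set B) (\<lambda>g. restrict (\<alpha> g) B)"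
    using minimal_subset_is_minimal_space[OF compact_G_space B] unfolding top .
  then have cB: "compact_G_space G (top_of_set B) (\<lambda>g. restrict (\<alpha> g) B)"
    by (simp add: minimal_compact_G_space_def)
  interpret B: compact_action G "top_of_set B" "\<lambda>g. restrict (\<alpha> g) B"
    by unfold_locales (rule cB)
  have inv: "\<alpha> g q \<in> B" if "g \<in> carrier G" "q \<in> B" for g q
    using B'(3) that by (auto simp: invariant_set_def)
  have "strongly_proximal G (top_of_set B) (\<lambda>g. restrict (\<alpha> g) B)"
    unfolding strongly_proximal_iff[OF cB]
  proof
    fix \<nu> assume \<nu>: "\<nu> \<in> Prob (top_of_set B)"
    interpret prob_space \<nu> using \<nu> by (rule Prob_prob_space)
    have sp: "space \<nu> = B" using Prob_space[OF \<nu>] by simp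
    have cC: "(\<lambda>q. q i) \<in> Cont (top_of_set B)" for i
      using continuous_map_coordinate_sub by (simp add: Cont_def)
    have meas: "(\<lambda>q. q i) \<in> borel_measurable \<nu>" for i
      by (rule Prob_Cont_measurable[OF \<nu> cC])
    have intC: "integrable \<nu> f" if "f \<in> Cont (top_of_set B)" for f
      by (rule Prob_Cont_integrable[OF B.compact \<nu> that])
    define b where "b = (\<lambda>i. \<integral>q. q i \<partial>\<nu>)"
    have b: "b \<in> Q"
      unfolding b_def
      by (rule barycenter_mem[OF prob_space_axioms _ meas closedQ convexQ bounded_coord]) (simp add: sp BQ)
    have acC: "(\<lambda>q. \<alpha> g q i) \<in> Cont (top_of_set B)" if g: "g \<in> carrier G" for g i
    proof -
      obtain j where j: "\<forall>q\<in>Q. \<alpha> g q i = q j" using coord[OF g] by blast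
      show ?thesis
      proof (rule B.C.cong_mem[OF cC[of j]])
        show "q j = \<alpha> g q i" if "q \<in> topspace (top_of_set B)" for q using j BQ that by auto
      qed
    qed
    have bary: "\<alpha> g b i = (\<integral>q. \<alpha> g q i \<partial>\<nu>)" if g: "g \<in> carrier G" for g i
    proof -
      obtain j where j: "\<forall>q\<in>Q. \<alpha> g q i = q j" using coord[OF g] by blast
      have "(\<integral>q. \<alpha> g q i \<partial>\<nu>) = (\<integral>q. q j \<partial>\<nu>)"
        using j BQ sp by (intro Bochner_Integration.integral_cong) auto
      then show ?thesis using j b by (simp add: b_def)
    qed
    have sqC: "(\<lambda>q. (\<alpha> g q i - c)\<^sup>2) \<in> Cont (top_of_set B)" if g: "g \<in> carrier G" for g i c
      using acC[OF g, of i] by (auto simp: Cont_def intro!: continuous_intros)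
    have sq0: "(\<lambda>q. (\<alpha> g q i)\<^sup>2) \<in> Cont (top_of_set B)" if g: "g \<in> carrier G" for g i
      using sqC[OF g, of i 0] by simp
    define V where "V J g = (\<Sum>i\<in>J. \<integral>q. (\<alpha> g q i - \<alpha> g b i)\<^sup>2 \<partial>\<nu>)" for J g
    have var: "(\<integral>q. (\<alpha> g q i - c)\<^sup>2 \<partial>\<nu>) = (\<integral>q. (\<alpha> g q i)\<^sup>2 \<partial>\<nu>) - 2 * c * \<alpha> g b i + c\<^sup>2"
      if g: "g \<in> carrier G" for g i c
    proof -
      have "(\<integral>q. (\<alpha> g q i - c)\<^sup>2 \<partial>\<nu>) = (\<integral>q. (\<alpha> g q i)\<^sup>2 - (2 * c) * \<alpha> g q i + c\<^sup>2 \<partial>\<nu>)"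
        by (intro Bochner_Integration.integral_cong refl) (simp add: power2_eq_square algebra_simps)
      also have "\<dots> = (\<integral>q. (\<alpha> g q i)\<^sup>2 \<partial>\<nu>) - 2 * c * \<alpha> g b i + c\<^sup>2"
        using intC[OF sq0[OF g, of i]] intC[OF acC[OF g, of i]] by (simp add: prob_space bary[OF g])
      finally show ?thesis .
    qed
    have varb: "(\<integral>q. (\<alpha> g q i - c)\<^sup>2 \<partial>\<nu>) = (\<integral>q. (\<alpha> g q i - \<alpha> g b i)\<^sup>2 \<partial>\<nu>) + (\<alpha> g b i - c)\<^sup>2"
      if g: "g \<in> carrier G" for g i c
      unfolding var[OF g] by (simp add: power2_eq_square algebra_simps)
    have smallV: "\<exists>g\<in>carrier G. V J g < e" if J: "finite J" and e: "0 < e" for J e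
    proof -
      obtain g where g: "g \<in> carrier G"
        "\<And>q. q \<in> Q \<Longrightarrow> (\<Sum>i\<in>J. (q i)\<^sup>2) < (\<Sum>i\<in>J. (\<alpha> g b i)\<^sup>2) + e / 2"
        using orbit_approaches_max[OF J b, of "e / 2"] e by auto
      have "V J g = (\<Sum>i\<in>J. (\<integral>q. (\<alpha> g q i)\<^sup>2 \<partial>\<nu>) - (\<alpha> g b i)\<^sup>2)"
        unfolding V_def var[OF g(1)] by (simp add: power2_eq_square)
      also have "\<dots> = (\<integral>q. (\<Sum>i\<in>J. (\<alpha> g q i)\<^sup>2) \<partial>\<nu>) - (\<Sum>i\<in>J. (\<alpha> g b i)\<^sup>2)"
        using intC[OF sq0[OF g(1)]] by (simp add: sum_subtractf Bochner_Integration.integral_sum)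
      also have "(\<integral>q. (\<Sum>i\<in>J. (\<alpha> g q i)\<^sup>2) \<partial>\<nu>) \<le> (\<integral>q. (\<Sum>i\<in>J. (\<alpha> g b i)\<^sup>2) + e / 2 \<partial>\<nu>)"
      proof (rule integral_mono)
        show "integrable \<nu> (\<lambda>q. \<Sum>i\<in>J. (\<alpha> g q i)\<^sup>2)"
          using intC[OF sq0[OF g(1)]] by (intro Bochner_Integration.integrable_sum)
        show "(\<Sum>i\<in>J. (\<alpha> g q i)\<^sup>2) \<le> (\<Sum>i\<in>J. (\<alpha> g b i)\<^sup>2) + e / 2" if "q \<in> space \<nu>" for q
          using g(2)[of "\<alpha> g q"] inv[OF g(1), of q] that sp BQ by auto
      qed simp
      finally have "V J g \<le> e / 2" by (simp add: prob_space)
      then show ?thesis using g(1) e by (intro bexI[of _ g]) auto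
    qed
    (* A cluster point of the points g b for which the variances are small. *)
    define S where "S = (\<lambda>(J, e). {\<alpha> g b | g. g \<in> carrier G \<and> V J g < e})"
    define D where "D = {(J :: 'c set, e :: real). finite J \<and> 0 < e}"
    have Vmono: "V J g \<le> V J' g" if "J \<subseteq> J'" "finite J'" for J J' g
      unfolding V_def using that by (intro sum_mono2) auto
    have "\<exists>x\<in>Q. \<forall>d\<in>D. x \<in> euclidean closure_of (S d)"
    proof (rule compactin_directed_Inter[OF cptQ])
      have "({}, 1) \<in> D" by (simp add: D_def)
      then show "D \<noteq> {}" by blast
      show "closedin euclidean (euclidean closure_of (S d))" for d by simp
      show "Q \<inter> euclidean closure_of (S d) \<noteq> {}" if dD: "d \<in> D" for d
      proof -
        obtain J e where d: "d = (J, e)" "finite J" "0 < e" using dD by (cases d) (auto simp: D_def)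
        obtain g where "g \<in> carrier G" "V J g < e" using smallV[OF d(2,3)] by blast
        then have "\<alpha> g b \<in> S d" "\<alpha> g b \<in> Q" using A.act_closed[of g b] b by (auto simp: S_def d(1))
        then show ?thesis using closure_of_subset[of "S d" euclidean] by auto
      qed
      show "\<exists>f\<in>D. euclidean closure_of (S f) \<subseteq> euclidean closure_of (S d) \<inter> euclidean closure_of (S e)"
        if de: "d \<in> D" "e \<in> D" for d e
      proof -
        obtain J r J' r' where d: "d = (J, r)" "e = (J', r')" "finite J" "finite J'" "0 < r" "0 < r'"
          using de by (cases d; cases e) (auto simp: D_def)
        let ?f = "(J \<union> J', min r r')"
        have "V J g \<le> V (J \<union> J') g" "V J' g \<le> V (J \<union> J') g" for g
          using Vmono d by auto
        then have V: "V (J \<union> J') g < min r r' \<Longrightarrow> V J g < r \<and> V J' g < r'" for g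
          by (meson le_less_trans min_less_iff_conj)
        have "S ?f \<subseteq> S d" "S ?f \<subseteq> S e"
          unfolding S_def d(1,2) prod.case using V by blast+
        then have "euclidean closure_of (S ?f) \<subseteq> euclidean closure_of (S d) \<inter> euclidean closure_of (S e)"
          by (intro Int_greatest closure_of_mono)
        moreover have "?f \<in> D" using d by (simp add: D_def)
        ultimately show ?thesis by blast
      qed
    qed
    then obtain x where x: "x \<in> Q" "\<And>d. d \<in> D \<Longrightarrow> x \<in> euclidean closure_of (S d)" by blast
    have concentrate: "\<exists>g\<in>carrier G. (\<Sum>i\<in>J. \<integral>q. (\<alpha> g q i - x i)\<^sup>2 \<partial>\<nu>) < e"
      if J: "finite J" and e: "0 < e" for J e
    proof -
      (* With this radius the squared distance from the barycenter to x accounts for at most e / 2. *)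
      define r where "r = sqrt (e / (2 * (real (card J) + 1)))"
      have r: "0 < r" "r\<^sup>2 = e / (2 * (real (card J) + 1))" using e by (auto simp: r_def)
      have "(J, e / 2) \<in> D" using J e by (simp add: D_def)
      then obtain y where "y \<in> S (J, e / 2)" "\<forall>i\<in>J. \<bar>y i - x i\<bar> < r"
        using x(2) J r(1) unfolding in_closure_fun by blast
      then obtain g where g: "g \<in> carrier G" "V J g < e / 2" "\<forall>i\<in>J. \<bar>\<alpha> g b i - x i\<bar> < r"
        by (auto simp: S_def)
      have "(\<Sum>i\<in>J. \<integral>q. (\<alpha> g q i - x i)\<^sup>2 \<partial>\<nu>) = V J g + (\<Sum>i\<in>J. (\<alpha> g b i - x i)\<^sup>2)"
        unfolding varb[OF g(1), of _ "x _"] by (simp add: V_def sum.distrib)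
      also have "(\<Sum>i\<in>J. (\<alpha> g b i - x i)\<^sup>2) \<le> (\<Sum>i\<in>J. r\<^sup>2)"
        using g(3) r(1) by (intro sum_mono) (simp add: abs_le_square_iff[symmetric] less_imp_le)
      also have "\<dots> \<le> e / 2"
        using e by (simp add: r(2) field_simps)
      finally show ?thesis using g(1,2) by (intro bexI[of _ g]) auto
    qed
    have sumI: "(\<Sum>i\<in>J. \<integral>q. (\<alpha> g q i - x i)\<^sup>2 \<partial>\<nu>) = (\<integral>q. (\<Sum>i\<in>J. (\<alpha> g q i - x i)\<^sup>2) \<partial>\<nu>)"
      if "g \<in> carrier G" for J g
      using intC[OF sqC[OF that]] by (simp add: Bochner_Integration.integral_sum)
    have intS: "integrable \<nu> (\<lambda>q. \<Sum>i\<in>J. (\<alpha> g q i - x i)\<^sup>2)" if "g \<in> carrier G" for J g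
      using intC[OF sqC[OF that]] by (intro Bochner_Integration.integrable_sum)
    have far: "r\<^sup>2 \<le> (\<Sum>i\<in>J. (q i - x i)\<^sup>2)" if J: "finite J" "0 < r" "\<not> (\<forall>i\<in>J. \<bar>q i - x i\<bar> < r)" for J r q
    proof -
      obtain i where i: "i \<in> J" "r \<le> \<bar>q i - x i\<bar>" using J(3) by force
      have "r\<^sup>2 \<le> (q i - x i)\<^sup>2" using i(2) that(2) by (simp add: abs_le_square_iff[symmetric])
      also have "\<dots> \<le> (\<Sum>i\<in>J. (q i - x i)\<^sup>2)" using that(1) i(1) by (intro member_le_sum) auto
      finally show ?thesis .
    qed
    have xB: "x \<in> B"
    proof (rule ccontr)
      assume "x \<notin> B"
      then have "x \<notin> euclidean closure_of B" by (simp only: closure_of_eq[THEN iffD2, OF Bc] not_False_eq_True)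
      then obtain J r where J: "finite J" "0 < r" "\<And>q. q \<in> B \<Longrightarrow> \<not> (\<forall>i\<in>J. \<bar>q i - x i\<bar> < r)"
        unfolding in_closure_fun by blast
      obtain g where g: "g \<in> carrier G" "(\<Sum>i\<in>J. \<integral>q. (\<alpha> g q i - x i)\<^sup>2 \<partial>\<nu>) < r\<^sup>2"
        using concentrate[OF J(1), of "r\<^sup>2"] J(2) by auto
      have "(\<integral>q. r\<^sup>2 \<partial>\<nu>) \<le> (\<integral>q. (\<Sum>i\<in>J. (\<alpha> g q i - x i)\<^sup>2) \<partial>\<nu>)"
      proof (rule integral_mono)
        show "r\<^sup>2 \<le> (\<Sum>i\<in>J. (\<alpha> g q i - x i)\<^sup>2)" if "q \<in> space \<nu>" for q
          using far[OF J(1,2) J(3)[OF inv[OF g(1)]]] that sp by simp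
      qed (auto intro: intS[OF g(1)])
      then show False using g(2) sumI[OF g(1)] by (simp add: prob_space)
    qed
    show "\<exists>x\<in>topspace (top_of_set B). \<forall>F e. finite F \<and> F \<subseteq> Cont (top_of_set B) \<and> 0 < e \<longrightarrow>
        (\<exists>g\<in>carrier G. \<forall>f\<in>F. \<bar>(\<integral>y. f (restrict (\<alpha> g) B y) \<partial>\<nu>) - f x\<bar> < e)"
    proof (intro bexI[of _ x] allI impI)
      show "x \<in> topspace (top_of_set B)" using xB by simp
      fix F and e :: real assume "finite F \<and> F \<subseteq> Cont (top_of_set B) \<and> 0 < e"
      then have F: "finite F" "F \<subseteq> Cont (top_of_set B)" and e: "0 < e" by auto
      define P where "P f J c \<longleftrightarrow> finite J \<and> 0 \<le> c \<and>
        (\<forall>q\<in>B. \<bar>f q - f x\<bar> \<le> e / 2 + c * (\<Sum>i\<in>J. (q i - x i)\<^sup>2))" for f J c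
      have "\<exists>J c. P f J c" if f: "f \<in> F" for f
      proof -
        have fC: "f \<in> Cont (top_of_set B)" using F(2) f by blast
        then obtain M where M: "\<And>q. q \<in> B \<Longrightarrow> \<bar>f q\<bar> \<le> M" using B.C.bdd_mem[of f] by auto
        have "continuous_map (top_of_set B) euclideanreal f" using fC by (simp add: Cont_def)
        then have "openin (top_of_set B) {q \<in> topspace (top_of_set B). f q \<in> ball (f x) (e / 2)}"
          by (rule openin_continuous_map_preimage) auto
        then obtain U where U: "openin euclidean U"
          "{q \<in> topspace (top_of_set B). f q \<in> ball (f x) (e / 2)} = U \<inter> B"
          unfolding openin_subtopology by blast
        have "x \<in> {q \<in> topspace (top_of_set B). f q \<in> ball (f x) (e / 2)}" using xB e by simp
        then have "x \<in> U" using U(2) by blast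
        then obtain J r where J: "finite J" "0 < r" "{y. \<forall>i\<in>J. \<bar>y i - x i\<bar> < r} \<subseteq> U"
          using openin_fun_contains_basic[OF U(1)] by blast
        have M0: "0 \<le> M" using M[OF xB] by linarith
        have "\<bar>f q - f x\<bar> \<le> e / 2 + (2 * M / r\<^sup>2) * (\<Sum>i\<in>J. (q i - x i)\<^sup>2)" if q: "q \<in> B" for q
        proof (cases "\<forall>i\<in>J. \<bar>q i - x i\<bar> < r")
          case True
          then have "q \<in> U \<inter> B" using J(3) q by blast
          then have "\<bar>f q - f x\<bar> < e / 2"
            using U(2)[symmetric] by (auto simp: dist_real_def abs_minus_commute)
          moreover have "0 \<le> (2 * M / r\<^sup>2) * (\<Sum>i\<in>J. (q i - x i)\<^sup>2)"
            using M0 by (intro mult_nonneg_nonneg sum_nonneg) auto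
          ultimately show ?thesis by linarith
        next
          case False
          have "\<bar>f q - f x\<bar> \<le> 2 * M" using M[OF q] M[OF xB] by linarith
          also have "\<dots> = (2 * M / r\<^sup>2) * r\<^sup>2" using J(2) by simp
          also have "\<dots> \<le> (2 * M / r\<^sup>2) * (\<Sum>i\<in>J. (q i - x i)\<^sup>2)"
            using M0 by (intro mult_left_mono far[OF J(1,2) False]) auto
          finally show ?thesis using e by linarith
        qed
        then have "P f J (2 * M / r\<^sup>2)" using J(1) M0 by (simp add: P_def)
        then show ?thesis by blast
      qed
      then obtain J c where "\<And>f. f \<in> F \<Longrightarrow> P f (J f) (c f)" by metis
      then have J: "\<And>f. f \<in> F \<Longrightarrow> finite (J f)" and c: "\<And>f. f \<in> F \<Longrightarrow> 0 \<le> c f"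
        and Jc: "\<And>f q. f \<in> F \<Longrightarrow> q \<in> B \<Longrightarrow> \<bar>f q - f x\<bar> \<le> e / 2 + c f * (\<Sum>i\<in>J f. (q i - x i)\<^sup>2)"
        by (auto simp: P_def)
      define J' where "J' = (\<Union>f\<in>F. J f)"
      define c' where "c' = 1 + (\<Sum>f\<in>F. c f)"
      have J': "finite J'" using F(1) J by (simp add: J'_def)
      have c': "0 < c'" "\<And>f. f \<in> F \<Longrightarrow> c f \<le> c'"
      proof -
        have "0 \<le> (\<Sum>f\<in>F. c f)" using c by (intro sum_nonneg)
        then show "0 < c'" by (simp add: c'_def)
        show "c f \<le> c'" if "f \<in> F" for f
          using member_le_sum[of f F c] c F(1) that by (simp add: c'_def)
      qed
      obtain g where g: "g \<in> carrier G" "(\<Sum>i\<in>J'. \<integral>q. (\<alpha> g q i - x i)\<^sup>2 \<partial>\<nu>) < e / (4 * c')"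
        using concentrate[OF J', of "e / (4 * c')"] e c'(1) by auto
      have "\<bar>(\<integral>y. f (restrict (\<alpha> g) B y) \<partial>\<nu>) - f x\<bar> < e" if f: "f \<in> F" for f
      proof -
        have fC: "(\<lambda>y. f (restrict (\<alpha> g) B y)) \<in> Cont (top_of_set B)"
          using B.Cont_act[OF g(1), of f] F(2) f by blast
        have ifg: "integrable \<nu> (\<lambda>y. f (restrict (\<alpha> g) B y))" by (rule intC[OF fC])
        have "\<bar>(\<integral>y. f (restrict (\<alpha> g) B y) \<partial>\<nu>) - f x\<bar> = \<bar>\<integral>y. f (restrict (\<alpha> g) B y) - f x \<partial>\<nu>\<bar>"
          using ifg by (simp add: prob_space)
        also have "\<dots> \<le> (\<integral>y. \<bar>f (restrict (\<alpha> g) B y) - f x\<bar> \<partial>\<nu>)" by (rule integral_abs_bound)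
        also have "\<dots> \<le> (\<integral>y. e / 2 + c' * (\<Sum>i\<in>J'. (\<alpha> g y i - x i)\<^sup>2) \<partial>\<nu>)"
        proof (rule integral_mono)
          show "integrable \<nu> (\<lambda>y. \<bar>f (restrict (\<alpha> g) B y) - f x\<bar>)" using ifg by simp
          show "integrable \<nu> (\<lambda>y. e / 2 + c' * (\<Sum>i\<in>J'. (\<alpha> g y i - x i)\<^sup>2))"
            using intS[OF g(1)] by simp
          fix y assume "y \<in> space \<nu>"
          then have y: "y \<in> B" using sp by simp
          have s0: "0 \<le> (\<Sum>i\<in>J f. (\<alpha> g y i - x i)\<^sup>2)" by (intro sum_nonneg) simp
          have "\<bar>f (\<alpha> g y) - f x\<bar> \<le> e / 2 + c f * (\<Sum>i\<in>J f. (\<alpha> g y i - x i)\<^sup>2)"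
            by (rule Jc[OF f inv[OF g(1) y]])
          also have "\<dots> \<le> e / 2 + c' * (\<Sum>i\<in>J'. (\<alpha> g y i - x i)\<^sup>2)"
            using c'(2)[OF f] f c'(1) J' s0
            by (intro add_left_mono mult_mono sum_mono2) (auto simp: J'_def)
          finally show "\<bar>f (restrict (\<alpha> g) B y) - f x\<bar> \<le> e / 2 + c' * (\<Sum>i\<in>J'. (\<alpha> g y i - x i)\<^sup>2)"
            using y by simp
        qed
        also have "\<dots> = e / 2 + c' * (\<Sum>i\<in>J'. \<integral>q. (\<alpha> g q i - x i)\<^sup>2 \<partial>\<nu>)"
          using intS[OF g(1)] sumI[OF g(1)] by (simp add: prob_space)
        also have "\<dots> \<le> e / 2 + c' * (e / (4 * c'))"
          using g(2) c'(1) by (intro add_left_mono mult_left_mono) auto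
        also have "\<dots> < e" using c'(1) e by simp
        finally show ?thesis .
      qed
      then show "\<exists>g\<in>carrier G. \<forall>f\<in>F. \<bar>(\<integral>y. f (restrict (\<alpha> g) B y) \<partial>\<nu>) - f x\<bar> < e"
        using g(1) by blast
    qed
  qed
  then show ?thesis using min by (simp add: G_boundary_def)
qed

end

theorem convex_contains_boundary:
  assumes "convex_action G Q \<alpha>"
  obtains B where "B \<subseteq> Q" "closedin euclidean B" "invariant_set G \<alpha> B"
    "G_boundary G (top_of_set B) (\<lambda>g. restrict (\<alpha> g) B)"
proof -
  interpret convex_action G Q \<alpha> by fact
  obtain Q' where Q': "Q' \<subseteq> Q" "convex_action G Q' (\<lambda>g. restrict (\<alpha> g) Q')"
    "\<And>C. closedin euclidean C \<Longrightarrow> C \<noteq> {} \<Longrightarrow> fun_convex C \<Longrightarrow> invariant_set G \<alpha> C \<Longrightarrow> C \<subseteq> Q' \<Longrightarrow> C = Q'"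
    by (rule minimal_convex_exists) blast
  have inv: "invariant_set G (\<lambda>g. restrict (\<alpha> g) Q') C \<longleftrightarrow> invariant_set G \<alpha> C" if "C \<subseteq> Q'" for C
    using that by (force simp: invariant_set_def)
  interpret M: minimal_convex_action G Q' "\<lambda>g. restrict (\<alpha> g) Q'"
    unfolding minimal_convex_action_def minimal_convex_action_axioms_def
    using Q'(2,3) inv by blast
  obtain B where B: "minimal_closed_invariant G (top_of_set Q') (\<lambda>g. restrict (\<alpha> g) Q') B"
    using minimal_subset_exists[OF M.compact_G_space] .
  have BQ: "B \<subseteq> Q'" using B closedin_subset[of "top_of_set Q'" B] by (simp add: minimal_closed_invariant_def)
  have "(\<lambda>g. restrict (restrict (\<alpha> g) Q') B) = (\<lambda>g. restrict (\<alpha> g) B)"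
    using BQ by (auto simp: fun_eq_iff restrict_def)
  then have "G_boundary G (top_of_set B) (\<lambda>g. restrict (\<alpha> g) B)"
    using M.minimal_subset_boundary[OF B] by simp
  moreover have "closedin euclidean B"
    using B closedin_closed_subtopology[OF M.closedQ] by (simp add: minimal_closed_invariant_def)
  moreover have "invariant_set G \<alpha> B"
    using B inv[OF BQ] by (simp add: minimal_closed_invariant_def)
  ultimately show thesis using that BQ Q'(1) by blast
qed

section \<open>The compact convex set of states\<close>

definition dirac :: "('s \<Rightarrow> real) set \<Rightarrow> 's \<Rightarrow> ('s \<Rightarrow> real) \<Rightarrow> real" where
  "dirac A s = (\<lambda>f. if f \<in> A then f s else 0)"

context function_space
begin

lemma dirac_state: "s \<in> S \<Longrightarrow> dirac A s \<in> states S A"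
  using const_mem add_mem scale_mem by (auto simp: states_def dirac_def)

lemma closedin_states: "closedin euclidean (states S A)"
proof -
  have c: "continuous_on UNIV (\<lambda>q::('s \<Rightarrow> real) \<Rightarrow> real. q f)" for f
    by (rule continuous_on_product_coordinates)
  have imp: "closed {q. b \<longrightarrow> R q}" if "closed {q. R q}" for b and R :: "(('s \<Rightarrow> real) \<Rightarrow> real) \<Rightarrow> bool"
    using that by (cases b) auto
  have c1: "closed {q :: ('s \<Rightarrow> real) \<Rightarrow> real. f \<in> A \<longrightarrow> h \<in> A \<longrightarrow> q (\<lambda>x. f x + h x) = q f + q h}" for f h
    by (intro imp closed_Collect_eq continuous_on_add c)
  have c2: "closed {q :: ('s \<Rightarrow> real) \<Rightarrow> real. f \<in> A \<longrightarrow> q (\<lambda>x. r * f x) = r * q f}" for f r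
    by (intro imp closed_Collect_eq continuous_on_mult_left c)
  have c3: "closed {q :: ('s \<Rightarrow> real) \<Rightarrow> real. f \<in> A \<longrightarrow> (\<forall>x\<in>S. 0 \<le> f x) \<longrightarrow> 0 \<le> q f}" for f
    by (intro imp closed_Collect_le continuous_on_const c)
  have c4: "closed {q :: ('s \<Rightarrow> real) \<Rightarrow> real. q (\<lambda>_. 1) = 1}"
    by (intro closed_Collect_eq continuous_on_const c)
  have c5: "closed {q :: ('s \<Rightarrow> real) \<Rightarrow> real. f \<notin> A \<longrightarrow> q f = 0}" for f
    by (intro imp closed_Collect_eq continuous_on_const c)
  have eq: "states S A = {q.
     (\<forall>f h. f \<in> A \<longrightarrow> h \<in> A \<longrightarrow> q (\<lambda>x. f x + h x) = q f + q h) \<and>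
     (\<forall>f r. f \<in> A \<longrightarrow> q (\<lambda>x. r * f x) = r * q f) \<and>
     (\<forall>f. f \<in> A \<longrightarrow> (\<forall>x\<in>S. 0 \<le> f x) \<longrightarrow> 0 \<le> q f) \<and>
     q (\<lambda>_. 1) = 1 \<and> (\<forall>f. f \<notin> A \<longrightarrow> q f = 0)}"
    unfolding states_def Ball_def all_simps ..
  have "closed (states S A)"
    unfolding eq
  proof (rule closed_Collect_conj[OF _ closed_Collect_conj[OF _ closed_Collect_conj[OF _ closed_Collect_conj]]])
    show "closed {q :: ('s \<Rightarrow> real) \<Rightarrow> real. \<forall>f h. f \<in> A \<longrightarrow> h \<in> A \<longrightarrow> q (\<lambda>x. f x + h x) = q f + q h}"
      by (rule closed_Collect_all)+ (rule c1)
    show "closed {q :: ('s \<Rightarrow> real) \<Rightarrow> real. \<forall>f r. f \<in> A \<longrightarrow> q (\<lambda>x. r * f x) = r * q f}"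
      by (rule closed_Collect_all)+ (rule c2)
    show "closed {q :: ('s \<Rightarrow> real) \<Rightarrow> real. \<forall>f. f \<in> A \<longrightarrow> (\<forall>x\<in>S. 0 \<le> f x) \<longrightarrow> 0 \<le> q f}"
      by (rule closed_Collect_all) (rule c3)
    show "closed {q :: ('s \<Rightarrow> real) \<Rightarrow> real. q (\<lambda>_. 1) = 1}" by (rule c4)
    show "closed {q :: ('s \<Rightarrow> real) \<Rightarrow> real. \<forall>f. f \<notin> A \<longrightarrow> q f = 0}"
      by (rule closed_Collect_all) (rule c5)
  qed
  then show ?thesis by simp
qed

lemma states_bounded: "\<exists>M. \<forall>q\<in>states S A. \<bar>q f\<bar> \<le> M"
proof (cases "f \<in> A")
  case True
  then obtain M where M: "\<forall>x\<in>S. \<bar>f x\<bar> \<le> M" using bdd_mem by blast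
  have "\<bar>q f\<bar> \<le> M" if "q \<in> states S A" for q
  proof -
    have "q f \<le> M" by (rule state_le[OF that True]) (use M in force)
    moreover have "- M \<le> q f" by (rule state_ge[OF that True]) (use M in force)
    ultimately show ?thesis by linarith
  qed
  then show ?thesis by blast
next
  case False
  then show ?thesis using state_off by (intro exI[of _ 0]) auto
qed

lemma compactin_states: "compactin euclidean (states S A)"
  by (rule compactin_fun[OF closedin_states states_bounded])

lemma states_mix:
  assumes p: "p \<in> states S A" and q: "q \<in> states S A" and t: "0 \<le> t" "t \<le> 1"
  shows "(\<lambda>f. (1 - t) * p f + t * q f) \<in> states S A"
proof -
  have "0 \<le> (1 - t) * p f + t * q f" if "f \<in> A" "\<forall>x\<in>S. 0 \<le> f x" for f
    using state_nonneg[OF p that(1)] state_nonneg[OF q that(1)] that(2) t by simp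
  then show ?thesis
    using assms unfolding states_def by (auto simp: algebra_simps)
qed

lemma fun_convex_states: "fun_convex (states S A)"
  unfolding fun_convex_def by (simp add: states_mix)

end

text \<open>
  Precomposition is applied to the test function, so that an action on points from the left becomes an
  action on states from the left.
\<close>

definition state_act ::
    "'s set \<Rightarrow> ('s \<Rightarrow> real) set \<Rightarrow> ('a \<Rightarrow> 's \<Rightarrow> 's) \<Rightarrow> 'a \<Rightarrow> (('s \<Rightarrow> real) \<Rightarrow> real) \<Rightarrow> ('s \<Rightarrow> real) \<Rightarrow> real" where
  "state_act S A \<phi> g = (\<lambda>q\<in>states S A. (\<lambda>f. q (\<lambda>x. f (\<phi> g x))))"

locale function_action = function_space S A + group_action G S \<phi>
  for S :: "'s set" and A and G (structure) and \<phi> +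
  assumes nonempty: "S \<noteq> {}"
    and act_mem: "g \<in> carrier G \<Longrightarrow> f \<in> A \<Longrightarrow> (\<lambda>x. f (\<phi> g x)) \<in> A"
begin

lemma group: "group G" using group_hom by (simp add: group_hom_def)

lemma state_act_closed:
  assumes g: "g \<in> carrier G" and q: "q \<in> states S A"
  shows "(\<lambda>f. q (\<lambda>x. f (\<phi> g x))) \<in> states S A"
proof -
  have 1: "(\<lambda>x. f (\<phi> g x)) \<notin> A" if "f \<notin> A" for f
  proof
    interpret group G by (rule group)
    assume "(\<lambda>x. f (\<phi> g x)) \<in> A"
    then have "(\<lambda>x. f (\<phi> g (\<phi> (inv g) x))) \<in> A" using act_mem[of "inv g"] g by blast
    moreover have "f (\<phi> g (\<phi> (inv g) x)) = f x" if "x \<in> S" for x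
      using composition_rule[OF that g, of "inv g"] g id_eq_one that by (metis inv_closed r_inv restrict_apply')
    ultimately show False using cong_mem \<open>f \<notin> A\<close> by metis
  qed
  have 2: "\<phi> g x \<in> S" if "x \<in> S" for x using element_image[OF g that] by blast
  show ?thesis
    unfolding states_def
  proof (intro CollectI conjI ballI allI impI)
    fix f h assume "f \<in> A" "h \<in> A"
    then show "q (\<lambda>x. f (\<phi> g x) + h (\<phi> g x)) = q (\<lambda>x. f (\<phi> g x)) + q (\<lambda>x. h (\<phi> g x))"
      using g by (intro state_add[OF q] act_mem)
  next
    fix f c assume "f \<in> A"
    then show "q (\<lambda>x. c * f (\<phi> g x)) = c * q (\<lambda>x. f (\<phi> g x))"
      using g by (intro state_scale[OF q] act_mem)
  next
    fix f assume "f \<in> A" "\<forall>x\<in>S. 0 \<le> f x"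
    then show "0 \<le> q (\<lambda>x. f (\<phi> g x))"
      using g 2 by (intro state_nonneg[OF q] act_mem) auto
  next
    show "q (\<lambda>x. 1) = 1" by (rule state_const[OF q])
  next
    fix f assume "f \<notin> A"
    then show "q (\<lambda>x. f (\<phi> g x)) = 0" using 1 state_off[OF q] by blast
  qed
qed

lemma convex_action_states: "convex_action G (states S A) (state_act S A \<phi>)"
  unfolding convex_action_def
proof (intro conjI allI impI)
  show "compactin euclidean (states S A)" by (rule compactin_states)
  show "states S A \<noteq> {}" using nonempty dirac_state by blast
  show "fun_convex (states S A)" by (rule fun_convex_states)
  show "group_action G (states S A) (state_act S A \<phi>)"
  proof (rule group_actionI[OF group])
    fix g q assume g: "g \<in> carrier G" and q: "q \<in> states S A"
    show "state_act S A \<phi> g q \<in> states S A"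
      using state_act_closed[OF g q] q by (simp add: state_act_def)
  next
    show "state_act S A \<phi> g \<in> extensional (states S A)" for g by (simp add: state_act_def)
  next
    fix q assume q: "q \<in> states S A"
    have "q (\<lambda>x. f (\<phi> \<one> x)) = q f" for f
      by (rule state_cong[OF q]) (metis id_eq_one restrict_apply')
    then show "state_act S A \<phi> \<one> q = q" using q by (simp add: state_act_def)
  next
    fix g h q assume gh: "g \<in> carrier G" "h \<in> carrier G" and q: "q \<in> states S A"
    have "q (\<lambda>x. f (\<phi> (g \<otimes> h) x)) = q (\<lambda>x. f (\<phi> g (\<phi> h x)))" for f
      by (rule state_cong[OF q]) (simp add: composition_rule[OF _ gh])
    then show "state_act S A \<phi> (g \<otimes> h) q = state_act S A \<phi> g (state_act S A \<phi> h q)"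
      using q state_act_closed[OF gh(2) q] by (simp add: state_act_def)
  qed
  show "\<exists>j. \<forall>q\<in>states S A. state_act S A \<phi> g q i = q j" if "g \<in> carrier G" for g i
    by (rule exI[of _ "\<lambda>x. i (\<phi> g x)"]) (simp add: state_act_def)
qed

end

context compact_action
begin

lemma function_action: "function_action (topspace X) (Cont X) G \<phi>"
  by unfold_locales (use nonempty Cont_act in auto)

abbreviation "P \<equiv> states (topspace X) (Cont X)"
abbreviation "pact \<equiv> state_act (topspace X) (Cont X) \<phi>"

lemma separate_points:
  assumes "x \<in> topspace X" "y \<in> topspace X" "x \<noteq> y"
  obtains f where "f \<in> Cont X" "f x = 0" "f y = 1" "\<And>z. z \<in> topspace X \<Longrightarrow> 0 \<le> f z"
proof -
  have n: "normal_space X"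
    using compact Hausdorff compact_Hausdorff_or_regular_imp_normal_space by blast
  have c: "closedin X {x}" "closedin X {y}"
    using assms Hausdorff Hausdorff_imp_t1_space closedin_t1_singleton by metis+
  have d: "disjnt {x} {y}" using assms(3) by simp
  obtain f where f: "continuous_map X (top_of_set {0..1::real}) f" "f ` {x} \<subseteq> {0}" "f ` {y} \<subseteq> {1}"
    using Urysohn_lemma[OF n c d, of 0 1] by auto
  show thesis
    by (rule that[of f]) (use f in \<open>auto simp: Cont_def continuous_map_in_subtopology image_subset_iff\<close>)
qed

lemma dirac_inj:
  assumes "x \<in> topspace X" "y \<in> topspace X" "dirac (Cont X) x = dirac (Cont X) y"
  shows "x = y"
proof (rule ccontr)
  assume "x \<noteq> y"
  then obtain f where f: "f \<in> Cont X" "f x = 0" "f y = 1" using separate_points[OF assms(1,2)] by blast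
  then show False using fun_cong[OF assms(3), of f] by (simp add: dirac_def)
qed

lemma continuous_dirac: "continuous_map X euclidean (dirac (Cont X))"
proof (rule continuous_map_into_fun)
  fix f
  show "continuous_map X euclideanreal (\<lambda>x. dirac (Cont X) x f)"
    by (cases "f \<in> Cont X") (auto simp: dirac_def Cont_def)
qed

text \<open>
  Representing the state by a Radon measure makes the definition of strong proximality applicable.
\<close>

lemma strongly_proximal_state:
  assumes sp: "strongly_proximal G X \<phi>" and p: "p \<in> P"
  shows "\<exists>x\<in>topspace X. dirac (Cont X) x \<in> euclidean closure_of {(\<lambda>f. p (\<lambda>y. f (\<phi> g y))) | g. g \<in> carrier G}"
proof -
  obtain \<mu> where \<mu>: "\<mu> \<in> Prob X" "\<And>f. f \<in> Cont X \<Longrightarrow> p f = (\<integral>x. f x \<partial>\<mu>)"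
    using Riesz_state[OF compact Hausdorff p] by blast
  obtain x where x: "x \<in> topspace X" and lim: "\<And>F e. finite F \<and> F \<subseteq> Cont X \<and> 0 < e \<Longrightarrow>
      (\<exists>g\<in>carrier G. \<forall>f\<in>F. \<bar>(\<integral>y. f (\<phi> g y) \<partial>\<mu>) - f x\<bar> < e)"
    using sp \<mu>(1) unfolding strongly_proximal_iff[OF compact_G] by metis
  have "dirac (Cont X) x \<in> euclidean closure_of {(\<lambda>f. p (\<lambda>y. f (\<phi> g y))) | g. g \<in> carrier G}"
    unfolding in_closure_fun
  proof (intro allI impI)
    fix J :: "('x \<Rightarrow> real) set" and e :: real assume J: "finite J \<and> 0 < e"
    then obtain g where g: "g \<in> carrier G" "\<forall>f\<in>J \<inter> Cont X. \<bar>(\<integral>y. f (\<phi> g y) \<partial>\<mu>) - f x\<bar> < e"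
      using lim[of "J \<inter> Cont X" e] by auto
    interpret F: function_action "topspace X" "Cont X" G \<phi> by (rule function_action)
    have "\<bar>p (\<lambda>y. f (\<phi> g y)) - dirac (Cont X) x f\<bar> < e" if f: "f \<in> J" for f
    proof (cases "f \<in> Cont X")
      case True
      then have "p (\<lambda>y. f (\<phi> g y)) = (\<integral>y. f (\<phi> g y) \<partial>\<mu>)"
        using \<mu>(2)[OF Cont_act[OF g(1)]] by blast
      then show ?thesis using g(2) f True by (simp add: dirac_def)
    next
      case False
      then show ?thesis
        using F.state_act_closed[OF g(1) p, THEN C.state_off, OF False] J by (simp add: dirac_def)
    qed
    then show "\<exists>y\<in>{(\<lambda>f. p (\<lambda>y. f (\<phi> g y))) | g. g \<in> carrier G}. \<forall>i\<in>J. \<bar>y i - dirac (Cont X) x i\<bar> < e"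
      using g(1) by (intro bexI[of _ "\<lambda>f. p (\<lambda>y. f (\<phi> g y))"]) auto
  qed
  then show ?thesis using x by blast
qed

end

section \<open>Maps from minimal spaces to boundaries\<close>

lemma G_boundaryD:
  assumes "G_boundary G X \<phi>"
  shows "compact_action G X \<phi>" "strongly_proximal G X \<phi>"
    "minimal_closed_invariant G X \<phi> (topspace X)" "minimal_compact_G_space G X \<phi>"
  using assms by (auto simp: G_boundary_def minimal_compact_G_space_def compact_action_def)

text \<open>
  The image of \<open>e\<close> is compact and invariant, so by strong proximality it contains a Dirac state. The points
  of \<open>B\<close> that are sent to Dirac states form a closed invariant set, which is everything by minimality.
  Both the existence and the uniqueness of maps to boundaries follow from this.
\<close>

lemma minimal_to_boundary:
  fixes G (structure) and X :: "'x topology" and B :: "'b topology"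
  assumes B: "minimal_compact_G_space G B \<beta>" and X: "G_boundary G X \<phi>"
    and ec: "continuous_map B euclidean e"
    and est: "\<And>b. b \<in> topspace B \<Longrightarrow> e b \<in> states (topspace X) (Cont X)"
    and eeq: "\<And>g b f. g \<in> carrier G \<Longrightarrow> b \<in> topspace B \<Longrightarrow> f \<in> Cont X \<Longrightarrow> e (\<beta> g b) f = e b (\<lambda>x. f (\<phi> g x))"
  obtains \<pi> where "equivariant_quotient G B \<beta> X \<phi> \<pi>"
    "\<And>b. b \<in> topspace B \<Longrightarrow> e b = dirac (Cont X) (\<pi> b)"
proof -
  interpret X: compact_action G X \<phi> using G_boundaryD[OF X] by simp
  interpret F: function_action "topspace X" "Cont X" G \<phi> by (rule X.function_action)
  interpret B: compact_action G B \<beta>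
    using B by unfold_locales (simp add: minimal_compact_G_space_def)
  have minX: "\<And>C. closedin X C \<Longrightarrow> C \<noteq> {} \<Longrightarrow> invariant_set G \<phi> C \<Longrightarrow> C = topspace X"
    using G_boundaryD(3)[OF X] closedin_subset unfolding minimal_closed_invariant_def by metis
  have minB: "\<And>C. closedin B C \<Longrightarrow> C \<noteq> {} \<Longrightarrow> invariant_set G \<beta> C \<Longrightarrow> C = topspace B"
    using B closedin_subset unfolding minimal_compact_G_space_def minimal_closed_invariant_def by metis
  have eeq': "e (\<beta> g b) = (\<lambda>f. e b (\<lambda>x. f (\<phi> g x)))" if "g \<in> carrier G" "b \<in> topspace B" for g b
  proof
    fix f
    show "e (\<beta> g b) f = e b (\<lambda>x. f (\<phi> g x))"
    proof (cases "f \<in> Cont X")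
      case True
      then show ?thesis using eeq that by blast
    next
      case False
      then show ?thesis
        using X.C.state_off[OF est[OF B.act_closed[OF that]] False]
          X.C.state_off[OF F.state_act_closed[OF that(1) est[OF that(2)]] False] by simp
    qed
  qed
  have cp: "compactin euclidean (e ` topspace B)"
    using image_compactin[OF _ ec] B.compact by (simp add: compact_space_def)
  have cl: "closedin euclidean (e ` topspace B)" by (rule compactin_imp_closedin[OF Hausdorff_fun cp])
  have cpD: "compactin euclidean (dirac (Cont X) ` C)" if "closedin X C" for C
    using image_compactin[OF closedin_compact_space[OF X.compact that] X.continuous_dirac] .
  have clD: "closedin euclidean (dirac (Cont X) ` C)" if "closedin X C" for C
    by (rule compactin_imp_closedin[OF Hausdorff_fun cpD[OF that]])
  define B0 where "B0 = {b \<in> topspace B. e b \<in> dirac (Cont X) ` topspace X}"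
  have "B0 = topspace B"
  proof (rule minB)
    show "closedin B B0"
      unfolding B0_def by (rule closedin_continuous_map_preimage[OF ec clD]) simp
    show "invariant_set G \<beta> B0"
      unfolding invariant_set_def
    proof (intro ballI subsetI)
      fix g y assume g: "g \<in> carrier G" and "y \<in> \<beta> g ` B0"
      then obtain b x where b: "b \<in> topspace B" "y = \<beta> g b" "x \<in> topspace X" "e b = dirac (Cont X) x"
        by (auto simp: B0_def)
      have "e y f = dirac (Cont X) (\<phi> g x) f" for f
      proof (cases "f \<in> Cont X")
        case True
        then show ?thesis
          using eeq[OF g b(1) True] X.Cont_act[OF g True] b by (simp add: dirac_def)
      next
        case False
        then show ?thesis
          using X.C.state_off[OF est[OF B.act_closed[OF g b(1)]] False] b(2) by (simp add: dirac_def)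
      qed
      then have "e y = dirac (Cont X) (\<phi> g x)" by blast
      then show "y \<in> B0" using B.act_closed[OF g b(1)] X.act_closed[OF g b(3)] b(2) by (auto simp: B0_def)
    qed
    obtain b0 where b0: "b0 \<in> topspace B" using B.nonempty by blast
    obtain x where x: "x \<in> topspace X"
      "dirac (Cont X) x \<in> euclidean closure_of {(\<lambda>f. e b0 (\<lambda>y. f (\<phi> g y))) | g. g \<in> carrier G}"
      using X.strongly_proximal_state[OF G_boundaryD(2)[OF X] est[OF b0]] by blast
    have "{(\<lambda>f. e b0 (\<lambda>y. f (\<phi> g y))) | g. g \<in> carrier G} \<subseteq> e ` topspace B"
    proof (intro subsetI)
      fix y assume "y \<in> {(\<lambda>f. e b0 (\<lambda>y. f (\<phi> g y))) | g. g \<in> carrier G}"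
      then obtain g where g: "g \<in> carrier G" "y = (\<lambda>f. e b0 (\<lambda>y. f (\<phi> g y)))" by blast
      then have "y = e (\<beta> g b0)" using eeq'[OF g(1) b0] by simp
      then show "y \<in> e ` topspace B" using B.act_closed[OF g(1) b0] by blast
    qed
    then have "dirac (Cont X) x \<in> e ` topspace B"
      using x(2) closure_of_minimal[OF _ cl] by blast
    then obtain b where "b \<in> topspace B" "e b = dirac (Cont X) x" by auto
    then have "b \<in> B0" using x(1) by (simp add: B0_def)
    then show "B0 \<noteq> {}" by blast
  qed
  then have "\<exists>x\<in>topspace X. e b = dirac (Cont X) x" if "b \<in> topspace B" for b
    using that by (auto simp: B0_def)
  then obtain \<pi> where \<pi>: "\<And>b. b \<in> topspace B \<Longrightarrow> \<pi> b \<in> topspace X"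
    "\<And>b. b \<in> topspace B \<Longrightarrow> e b = dirac (Cont X) (\<pi> b)" by metis
  have \<pi>c: "continuous_map B X \<pi>"
    unfolding continuous_map_closedin
  proof (intro conjI allI impI ballI)
    show "\<pi> \<in> topspace B \<rightarrow> topspace X" using \<pi>(1) by auto
    fix C assume C: "closedin X C"
    have "{b \<in> topspace B. \<pi> b \<in> C} = {b \<in> topspace B. e b \<in> dirac (Cont X) ` C}"
    proof (intro Collect_cong conj_cong refl iffI)
      fix b assume b: "b \<in> topspace B"
      show "\<pi> b \<in> C \<Longrightarrow> e b \<in> dirac (Cont X) ` C" using \<pi>(2)[OF b] by simp
      assume "e b \<in> dirac (Cont X) ` C"
      then obtain c where c: "c \<in> C" "dirac (Cont X) (\<pi> b) = dirac (Cont X) c" using \<pi>(2)[OF b] by auto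
      then have "\<pi> b = c" using X.dirac_inj[OF \<pi>(1)[OF b]] closedin_subset[OF C] by blast
      then show "\<pi> b \<in> C" using c by simp
    qed
    also have "closedin B \<dots>" by (rule closedin_continuous_map_preimage[OF ec clD[OF C]])
    finally show "closedin B {b \<in> topspace B. \<pi> b \<in> C}" .
  qed
  have \<pi>e: "\<pi> (\<beta> g b) = \<phi> g (\<pi> b)" if g: "g \<in> carrier G" and b: "b \<in> topspace B" for g b
  proof (rule X.dirac_inj[OF \<pi>(1)[OF B.act_closed[OF g b]] X.act_closed[OF g \<pi>(1)[OF b]]], rule ext)
    fix f
    show "dirac (Cont X) (\<pi> (\<beta> g b)) f = dirac (Cont X) (\<phi> g (\<pi> b)) f"
    proof (cases "f \<in> Cont X")
      case True
      then show ?thesis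
        using \<pi>(2)[OF B.act_closed[OF g b], symmetric] eeq[OF g b True] \<pi>(2)[OF b] X.Cont_act[OF g True]
        by (simp add: dirac_def)
    qed (simp add: dirac_def)
  qed
  have "\<pi> ` topspace B = topspace X"
  proof (rule minX)
    show "closedin X (\<pi> ` topspace B)"
      using image_compactin[OF _ \<pi>c] B.compact compactin_imp_closedin[OF X.Hausdorff]
      by (simp add: compact_space_def)
    show "\<pi> ` topspace B \<noteq> {}" using B.nonempty by blast
    show "invariant_set G \<phi> (\<pi> ` topspace B)"
      unfolding invariant_set_def using \<pi>e B.act_closed by (auto simp: image_iff) metis
  qed
  then have "equivariant_quotient G B \<beta> X \<phi> \<pi>"
    using \<pi>c \<pi>e by (simp add: equivariant_quotient_def)
  then show thesis using \<pi>(2) by (rule that)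
qed

text \<open>
  The average of the Dirac states at \<open>f b\<close> and \<open>h b\<close> is an equivariant family of states, hence consists of
  Dirac states; but an average of two Dirac states is a Dirac state only if the two agree.
\<close>

lemma boundary_map_unique:
  fixes G (structure)
  assumes B: "minimal_compact_G_space G B \<beta>" and X: "G_boundary G X \<phi>"
    and f: "equivariant_quotient G B \<beta> X \<phi> f" and h: "equivariant_quotient G B \<beta> X \<phi> h"
    and b: "b \<in> topspace B"
  shows "f b = h b"
proof -
  interpret X: compact_action G X \<phi> using G_boundaryD[OF X] by simp
  have fh: "f c \<in> topspace X" "h c \<in> topspace X" if "c \<in> topspace B" for c
    using f h that by (auto simp: equivariant_quotient_def)
  have fc: "continuous_map B X f" and hc: "continuous_map B X h"
    using f h by (auto simp: equivariant_quotient_def)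
  define e where "e c = (\<lambda>k. (1 - 1/2) * dirac (Cont X) (f c) k + (1/2) * dirac (Cont X) (h c) k)" for c
  obtain \<pi> where \<pi>: "equivariant_quotient G B \<beta> X \<phi> \<pi>"
    "\<And>b. b \<in> topspace B \<Longrightarrow> e b = dirac (Cont X) (\<pi> b)"
  proof (rule minimal_to_boundary[OF B X, of e])
    show "continuous_map B euclidean e"
    proof (rule continuous_map_into_fun)
      fix k
      have d: "continuous_map X euclideanreal (\<lambda>x. dirac (Cont X) x k)"
        using continuous_map_compose[OF X.continuous_dirac continuous_map_coordinate]
        by (simp add: comp_def)
      have "continuous_map B euclideanreal (\<lambda>c. dirac (Cont X) (f c) k)"
        "continuous_map B euclideanreal (\<lambda>c. dirac (Cont X) (h c) k)"
        using continuous_map_compose[OF fc d] continuous_map_compose[OF hc d] by (simp_all add: comp_def)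
      then show "continuous_map B euclideanreal (\<lambda>c. e c k)"
        unfolding e_def by (intro continuous_intros)
    qed
    show "e c \<in> X.P" if "c \<in> topspace B" for c
      unfolding e_def by (rule X.C.states_mix) (use fh[OF that] X.C.dirac_state in auto)
    show "e (\<beta> g c) k = e c (\<lambda>x. k (\<phi> g x))"
      if "g \<in> carrier G" "c \<in> topspace B" "k \<in> Cont X" for g c k
      using that f h X.Cont_act[OF that(1,3)] by (simp add: e_def dirac_def equivariant_quotient_def)
  qed blast
  have \<pi>b: "\<pi> b \<in> topspace X" using \<pi>(1) b by (auto simp: equivariant_quotient_def)
  have eq: "c = \<pi> b" if c: "c \<in> topspace X" "c = f b \<or> c = h b" for c
  proof (rule ccontr)
    assume "c \<noteq> \<pi> b"
    then obtain k where k: "k \<in> Cont X" "k (\<pi> b) = 0" "k c = 1" "\<And>z. z \<in> topspace X \<Longrightarrow> 0 \<le> k z"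
      using X.separate_points[OF \<pi>b c(1)] by metis
    have "(1/2) * k (f b) + (1/2) * k (h b) = k (\<pi> b)"
      using fun_cong[OF \<pi>(2)[OF b], of k] k(1) by (simp add: e_def dirac_def)
    moreover have "0 \<le> k (f b)" "0 \<le> k (h b)" using k(4) fh[OF b] by auto
    ultimately show False using k(2,3) c(2) by auto
  qed
  show ?thesis using eq[of "f b"] eq[of "h b"] fh[OF b] by simp
qed

section \<open>Existence of the Furstenberg boundary\<close>

text \<open>
  No bound is required outside the carrier, in line with the congruence condition of
  \<^locale>\<open>function_space\<close>.
\<close>

definition bounded_functions :: "('a, 'c) monoid_scheme \<Rightarrow> ('a \<Rightarrow> real) set" where
  "bounded_functions G = {f. \<exists>M. \<forall>x\<in>carrier G. \<bar>f x\<bar> \<le> M}"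

definition left_mult :: "('a, 'c) monoid_scheme \<Rightarrow> 'a \<Rightarrow> 'a \<Rightarrow> 'a" where
  "left_mult G g = (\<lambda>x\<in>carrier G. g \<otimes>\<^bsub>G\<^esub> x)"

lemma function_action_bounded_functions:
  assumes G: "group G"
  shows "function_action (carrier G) (bounded_functions G) G (left_mult G)"
proof -
  interpret group G by fact
  interpret group_action G "carrier G" "left_mult G"
    by (rule group_actionI[OF G]) (auto simp: left_mult_def m_assoc)
  show ?thesis
  proof
    show "carrier G \<noteq> {}" by auto
    show "(\<lambda>_. c) \<in> bounded_functions G" for c by (auto simp: bounded_functions_def)
    show "(\<lambda>x. f x + h x) \<in> bounded_functions G"
      if f: "f \<in> bounded_functions G" and h: "h \<in> bounded_functions G" for f h
    proof -
      obtain M M' where "\<forall>x\<in>carrier G. \<bar>f x\<bar> \<le> M" "\<forall>x\<in>carrier G. \<bar>h x\<bar> \<le> M'"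
        using f h by (auto simp: bounded_functions_def)
      then have "\<forall>x\<in>carrier G. \<bar>f x + h x\<bar> \<le> M + M'" by (meson abs_triangle_ineq add_mono order_trans)
      then show ?thesis unfolding bounded_functions_def by blast
    qed
    show "(\<lambda>x. c * f x) \<in> bounded_functions G" if f: "f \<in> bounded_functions G" for f c
    proof -
      obtain M where "\<forall>x\<in>carrier G. \<bar>f x\<bar> \<le> M" using f by (auto simp: bounded_functions_def)
      then have "\<forall>x\<in>carrier G. \<bar>c * f x\<bar> \<le> \<bar>c\<bar> * M" by (simp add: abs_mult mult_left_mono)
      then show ?thesis unfolding bounded_functions_def by blast
    qed
    show "\<exists>M. \<forall>x\<in>carrier G. \<bar>f x\<bar> \<le> M" if "f \<in> bounded_functions G" for f
      using that by (simp add: bounded_functions_def)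
    show "h \<in> bounded_functions G"
      if "f \<in> bounded_functions G" "\<And>x. x \<in> carrier G \<Longrightarrow> f x = h x" for f h
      using that by (simp add: bounded_functions_def)
    show "(\<lambda>x. f (left_mult G g x)) \<in> bounded_functions G"
      if g: "g \<in> carrier G" and f: "f \<in> bounded_functions G" for f g
    proof -
      obtain M where "\<forall>x\<in>carrier G. \<bar>f x\<bar> \<le> M" using f by (auto simp: bounded_functions_def)
      then have "\<forall>x\<in>carrier G. \<bar>f (left_mult G g x)\<bar> \<le> M" using g by (simp add: left_mult_def)
      then show ?thesis unfolding bounded_functions_def by blast
    qed
  qed
qed

text \<open>
  The boundary is found inside the convex set of means on the group. Given another boundary and a point
  of it, composing functions with the orbit map of this point turns means on the group into states on
  that boundary, and \<open>minimal_to_boundary\<close> applies.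
\<close>

theorem furstenberg_boundary_exists:
  assumes G: "group G"
  shows "case furstenberg_boundary G of (Z, \<theta>) \<Rightarrow> is_furstenberg_boundary G Z \<theta>"
proof -
  interpret G: group G by fact
  interpret F: function_action "carrier G" "bounded_functions G" G "left_mult G"
    by (rule function_action_bounded_functions[OF G])
  let ?Q = "states (carrier G) (bounded_functions G)"
  let ?\<alpha> = "state_act (carrier G) (bounded_functions G) (left_mult G)"
  obtain B where B: "B \<subseteq> ?Q" "closedin euclidean B" "invariant_set G ?\<alpha> B"
    "G_boundary G (top_of_set B) (\<lambda>g. restrict (?\<alpha> g) B)"
    by (rule convex_contains_boundary[OF F.convex_action_states])
  have "is_furstenberg_boundary G (top_of_set B) (\<lambda>g. restrict (?\<alpha> g) B)"
    unfolding is_furstenberg_boundary_def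
  proof (intro conjI allI impI)
    show "G_boundary G (top_of_set B) (\<lambda>g. restrict (?\<alpha> g) B)" by (rule B(4))
    fix Y :: "'a set set topology" and \<psi> assume Y: "G_boundary G Y \<psi>"
    interpret Y: compact_action G Y \<psi> using G_boundaryD[OF Y] by simp
    obtain y0 where y0: "y0 \<in> topspace Y" using Y.nonempty by blast
    have orb: "(\<lambda>x. f (\<psi> x y0)) \<in> bounded_functions G" if "f \<in> Cont Y" for f
    proof -
      obtain M where "\<forall>y\<in>topspace Y. \<bar>f y\<bar> \<le> M" using Y.C.bdd_mem[OF \<open>f \<in> Cont Y\<close>] by blast
      then have "\<forall>x\<in>carrier G. \<bar>f (\<psi> x y0)\<bar> \<le> M" using Y.act_closed y0 by blast
      then show ?thesis unfolding bounded_functions_def by blast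
    qed
    define e where "e q = (\<lambda>f. if f \<in> Cont Y then q (\<lambda>x. f (\<psi> x y0)) else (0::real))" for q
    obtain \<pi> where "equivariant_quotient G (top_of_set B) (\<lambda>g. restrict (?\<alpha> g) B) Y \<psi> \<pi>"
    proof (rule minimal_to_boundary[OF G_boundaryD(4)[OF B(4)] Y, of e])
      show "continuous_map (top_of_set B) euclidean e"
      proof (rule continuous_map_into_fun)
        fix f
        show "continuous_map (top_of_set B) euclideanreal (\<lambda>q. e q f)"
          using continuous_map_coordinate_sub[of B "\<lambda>x. f (\<psi> x y0)"]
          by (cases "f \<in> Cont Y") (simp_all add: e_def)
      qed
      show "e q \<in> Y.P" if "q \<in> topspace (top_of_set B)" for q
      proof -
        have q: "q \<in> ?Q" using that B(1) by auto
        show ?thesis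
          unfolding states_def
        proof (intro CollectI conjI ballI allI impI)
          fix f h assume fh: "f \<in> Cont Y" "h \<in> Cont Y"
          then show "e q (\<lambda>x. f x + h x) = e q f + e q h"
            using F.state_add[OF q orb[OF fh(1)] orb[OF fh(2)]] Y.C.add_mem[OF fh] by (simp add: e_def)
        next
          fix f c assume f: "f \<in> Cont Y"
          then show "e q (\<lambda>x. c * f x) = c * e q f"
            using F.state_scale[OF q orb[OF f]] Y.C.scale_mem[OF f] by (simp add: e_def)
        next
          fix f assume f: "f \<in> Cont Y" "\<forall>x\<in>topspace Y. 0 \<le> f x"
          then show "0 \<le> e q f"
            using F.state_nonneg[OF q orb[OF f(1)]] Y.act_closed[OF _ y0] by (simp add: e_def)
        next
          show "e q (\<lambda>_. 1) = 1" using F.state_const[OF q, of 1] Y.C.const_mem by (simp add: e_def)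
        qed (simp add: e_def)
      qed
      show "e (restrict (?\<alpha> g) B q) f = e q (\<lambda>x. f (\<psi> g x))"
        if g: "g \<in> carrier G" and qB: "q \<in> topspace (top_of_set B)" and f: "f \<in> Cont Y" for g q f
      proof -
        have q: "q \<in> ?Q" using qB B(1) by auto
        have "q (\<lambda>x. f (\<psi> (left_mult G g x) y0)) = q (\<lambda>x. f (\<psi> g (\<psi> x y0)))"
          using Y.act_mult[OF g _ y0] by (intro F.state_cong[OF q]) (simp add: left_mult_def)
        then show ?thesis using f Y.Cont_act[OF g f] qB q by (simp add: e_def state_act_def)
      qed
    qed blast
    then show "\<exists>f. equivariant_quotient G (top_of_set B) (\<lambda>g. restrict (?\<alpha> g) B) Y \<psi> f" by blast
  qed
  then show ?thesis by (rule furstenberg_boundary_small_model)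
qed

section \<open>The boundary of a normal subgroup\<close>

text \<open>
  Twisting the action of \<open>N\<close> by conjugation with \<open>g\<close> gives another boundary of \<open>N\<close> on the same space, so
  universality provides a map from the boundary to its twist. Uniqueness of such maps implies that they
  compose as the elements \<open>g\<close> do, and that for \<open>g \<in> N\<close> one gets back the given action.
\<close>

theorem normal_boundary_extends:
  fixes G (structure) and Z :: "'a set set topology"
  assumes N: "N \<lhd> G" and Z: "is_furstenberg_boundary (G\<lparr>carrier := N\<rparr>) Z \<zeta>"
  obtains \<tau> where "compact_G_space G Z \<tau>" "\<And>n. n \<in> N \<Longrightarrow> \<tau> n = \<zeta> n"
proof -
  interpret N: normal N G by fact
  let ?N = "G\<lparr>carrier := N\<rparr>"
  have sub: "subgroup N G" by (rule N.subgroup_axioms)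
  have NG: "n \<in> carrier G" if "n \<in> N" for n using that N.subset by blast
  have conjN: "g \<otimes> n \<otimes> inv g \<in> N" if "g \<in> carrier G" "n \<in> N" for g n
    using N.inv_op_closed2 that by blast
  have bZ: "G_boundary ?N Z \<zeta>" using Z by (simp add: is_furstenberg_boundary_def)
  interpret Z: compact_action ?N Z \<zeta> using G_boundaryD[OF bZ] by simp
  have mult: "\<zeta> (n \<otimes> m) z = \<zeta> n (\<zeta> m z)" if "n \<in> N" "m \<in> N" "z \<in> topspace Z" for n m z
    using Z.act_mult[of n m z] that by simp
  have one: "\<zeta> \<one> z = z" if "z \<in> topspace Z" for z using Z.act_one[OF that] by simp
  have clo: "\<zeta> n z \<in> topspace Z" if "n \<in> N" "z \<in> topspace Z" for n z
    using Z.act_closed[of n z] that by simp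
  define tw where "tw g = (\<lambda>n. \<zeta> (g \<otimes> n \<otimes> inv g))" for g
  have tw: "G_boundary ?N Z (tw g)" if g: "g \<in> carrier G" for g
  proof (rule G_boundary_more_maps[OF bZ])
    show "compact_G_space ?N Z (tw g)"
    proof (rule compact_G_spaceI[OF Z.compact Z.Hausdorff Z.nonempty])
      show "continuous_map Z Z (tw g n)" if "n \<in> carrier ?N" for n
        using Z.continuous[of "g \<otimes> n \<otimes> inv g"] conjN[OF g] that by (simp add: tw_def)
      show "group_action ?N (topspace Z) (tw g)"
      proof (rule group_actionI[OF Z.is_group])
        fix n x assume n: "n \<in> carrier ?N" and x: "x \<in> topspace Z"
        show "tw g n x \<in> topspace Z" using clo[OF conjN[OF g] x] n by (simp add: tw_def)
      next
        show "tw g n \<in> extensional (topspace Z)" if "n \<in> carrier ?N" for n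
          using Z.act_ext[of "g \<otimes> n \<otimes> inv g"] conjN[OF g] that by (simp add: tw_def)
      next
        show "tw g \<one>\<^bsub>?N\<^esub> x = x" if "x \<in> topspace Z" for x
          using g one[OF that] by (simp add: tw_def)
      next
        fix n m x assume nm: "n \<in> carrier ?N" "m \<in> carrier ?N" and x: "x \<in> topspace Z"
        have "g \<otimes> (n \<otimes> m) \<otimes> inv g = (g \<otimes> n \<otimes> inv g) \<otimes> (g \<otimes> m \<otimes> inv g)"
          using nm g NG by (simp add: N.m_assoc N.inv_solve_left)
        then show "tw g (n \<otimes>\<^bsub>?N\<^esub> m) x = tw g n (tw g m x)"
          using mult[OF conjN[OF g] conjN[OF g] x] nm by (simp add: tw_def)
      qed
    qed
    show "\<zeta> ` carrier ?N \<subseteq> tw g ` carrier ?N"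
    proof
      fix k assume "k \<in> \<zeta> ` carrier ?N"
      then obtain n where n: "n \<in> N" "k = \<zeta> n" by auto
      have "inv g \<otimes> n \<otimes> g \<in> N" using N.inv_op_closed1[OF g n(1)] .
      moreover have "g \<otimes> (inv g \<otimes> n \<otimes> g) \<otimes> inv g = n"
        using g NG[OF n(1)] by (simp add: N.m_assoc[symmetric]) (simp add: N.m_assoc)
      ultimately show "k \<in> tw g ` carrier ?N" using n(2) by (intro image_eqI[of _ _ "inv g \<otimes> n \<otimes> g"]) (simp_all add: tw_def)
    qed
  qed
  have "\<exists>f. equivariant_quotient ?N Z \<zeta> Z (tw g) f" if "g \<in> carrier G" for g
    by (rule furstenberg_boundary_universal[OF Z tw[OF that]])
  then obtain f where f: "\<And>g. g \<in> carrier G \<Longrightarrow> equivariant_quotient ?N Z \<zeta> Z (tw g) (f g)" by metis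
  have fcl: "f g z \<in> topspace Z" if "g \<in> carrier G" "z \<in> topspace Z" for g z
    using f[OF that(1)] that(2) by (auto simp: equivariant_quotient_def)
  have fc: "continuous_map Z Z (f g)" if "g \<in> carrier G" for g
    using f[OF that(1)] by (auto simp: equivariant_quotient_def)
  have fe: "f g (\<zeta> n z) = \<zeta> (g \<otimes> n \<otimes> inv g) (f g z)" if "g \<in> carrier G" "n \<in> N" "z \<in> topspace Z" for g n z
    using f[OF that(1)] that(2,3) by (auto simp: equivariant_quotient_def tw_def)
  have uniq: "f g z = h z"
    if g: "g \<in> carrier G" and h: "equivariant_quotient ?N Z \<zeta> Z (tw g) h" and z: "z \<in> topspace Z" for g h z
    using boundary_map_unique[OF G_boundaryD(4)[OF bZ] tw[OF g] f[OF g] h z] .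
  have fN: "f n z = \<zeta> n z" if n: "n \<in> N" and z: "z \<in> topspace Z" for n z
  proof (rule uniq[OF NG[OF n] _ z])
    show "equivariant_quotient ?N Z \<zeta> Z (tw n) (\<zeta> n)"
      unfolding equivariant_quotient_def
    proof (intro conjI ballI)
      show "continuous_map Z Z (\<zeta> n)" using Z.continuous[of n] n by simp
      show "\<zeta> n ` topspace Z = topspace Z" using Z.surj_prop[of n] n by simp
      fix m x assume m: "m \<in> carrier ?N" and x: "x \<in> topspace Z"
      have m': "m \<in> N" using m by simp
      have "\<zeta> (n \<otimes> m \<otimes> inv n) (\<zeta> n x) = \<zeta> (n \<otimes> m \<otimes> inv n \<otimes> n) x"
        using mult[OF conjN[OF NG[OF n] m'] n x] by simp
      also have "n \<otimes> m \<otimes> inv n \<otimes> n = n \<otimes> m"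
        using NG[OF n] NG[OF m'] by (simp add: N.m_assoc)
      finally show "\<zeta> n (\<zeta> m x) = tw n m (\<zeta> n x)"
        using mult[OF n m' x] by (simp add: tw_def)
    qed
  qed
  have fmult: "f (g \<otimes> h) z = f g (f h z)" if g: "g \<in> carrier G" and h: "h \<in> carrier G" and z: "z \<in> topspace Z" for g h z
  proof -
    have gh: "g \<otimes> h \<in> carrier G" using g h by simp
    have "f (g \<otimes> h) z = (f g \<circ> f h) z"
    proof (rule uniq[OF gh _ z])
      show "equivariant_quotient ?N Z \<zeta> Z (tw (g \<otimes> h)) (f g \<circ> f h)"
        unfolding equivariant_quotient_def
      proof (intro conjI ballI)
        show "continuous_map Z Z (f g \<circ> f h)" by (rule continuous_map_compose[OF fc[OF h] fc[OF g]])
        show "(f g \<circ> f h) ` topspace Z = topspace Z"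
          using f[OF g] f[OF h] unfolding equivariant_quotient_def image_comp[symmetric] by simp
        fix m x assume m: "m \<in> carrier ?N" and x: "x \<in> topspace Z"
        have m': "m \<in> N" using m by simp
        have "(f g \<circ> f h) (\<zeta> m x) = \<zeta> (g \<otimes> (h \<otimes> m \<otimes> inv h) \<otimes> inv g) ((f g \<circ> f h) x)"
          using fe[OF h m' x] fe[OF g conjN[OF h m'] fcl[OF h x]] by simp
        also have "g \<otimes> (h \<otimes> m \<otimes> inv h) \<otimes> inv g = (g \<otimes> h) \<otimes> m \<otimes> inv (g \<otimes> h)"
          using g h NG[OF m'] by (simp add: N.m_assoc N.inv_mult_group)
        finally show "(f g \<circ> f h) (\<zeta> m x) = tw (g \<otimes> h) m ((f g \<circ> f h) x)" by (simp add: tw_def)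
      qed
    qed
    then show ?thesis by simp
  qed
  define \<tau> where "\<tau> g = restrict (f g) (topspace Z)" for g
  show thesis
  proof (rule that[of \<tau>])
    show "compact_G_space G Z \<tau>"
    proof (rule compact_G_spaceI[OF Z.compact Z.Hausdorff Z.nonempty])
      show "continuous_map Z Z (\<tau> g)" if "g \<in> carrier G" for g
        using fc[OF that] by (rule continuous_map_eq) (simp add: \<tau>_def)
      show "group_action G (topspace Z) \<tau>"
      proof (rule group_actionI[OF N.is_group])
        show "\<tau> \<one> x = x" if "x \<in> topspace Z" for x
          using fN[of \<one> x] one[OF that] that N.one_closed by (simp add: \<tau>_def)
      qed (auto simp: \<tau>_def fcl fmult)
    qed
    show "\<tau> n = \<zeta> n" if "n \<in> N" for n
    proof
      fix z
      show "\<tau> n z = \<zeta> n z"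
        using fN[OF that, of z] Z.act_ext[of n] that by (cases "z \<in> topspace Z") (auto simp: \<tau>_def extensional_def)
    qed
  qed
qed

section \<open>Actions of subgroups and quotients\<close>

lemma compact_G_space_subgroup:
  assumes X: "compact_G_space G X \<phi>" and N: "subgroup N G"
  shows "compact_G_space (G\<lparr>carrier := N\<rparr>) X \<phi>"
proof -
  interpret compact_action G X \<phi> by unfold_locales (rule X)
  interpret N: subgroup N G by (rule N)
  show ?thesis
  proof (rule compact_G_spaceI[OF compact Hausdorff nonempty])
    show "group_action (G\<lparr>carrier := N\<rparr>) (topspace X) \<phi>"
      using N.mem_carrier act_closed act_ext act_one act_mult
      by (intro group_actionI subgroup_imp_group[OF N]) auto
    show "continuous_map X X (\<phi> g)" if "g \<in> carrier (G\<lparr>carrier := N\<rparr>)" for g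
      using continuous that N.mem_carrier by simp
  qed
qed

lemma compact_G_space_quotient:
  fixes G (structure)
  assumes X: "compact_G_space G X \<phi>" and N: "N \<lhd> G"
    and triv: "\<And>n x. n \<in> N \<Longrightarrow> x \<in> topspace X \<Longrightarrow> \<phi> n x = x"
  obtains \<beta> where "compact_G_space (G Mod N) X \<beta>" "\<And>g. g \<in> carrier G \<Longrightarrow> \<beta> (N #> g) = \<phi> g"
proof -
  interpret compact_action G X \<phi> by unfold_locales (rule X)
  interpret N: normal N G by (rule N)
  define \<beta> where "\<beta> C = \<phi> (SOME g. g \<in> C)" for C
  have \<beta>: "\<beta> (N #> g) = \<phi> g" if g: "g \<in> carrier G" for g
  proof -
    have "g \<in> N #> g" using rcos_self[OF g N.subgroup_axioms] .
    then have "(SOME h. h \<in> N #> g) \<in> N #> g" by (rule someI)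
    then obtain n where n: "n \<in> N" "(SOME h. h \<in> N #> g) = n \<otimes> g" by (auto simp: r_coset_def)
    have "\<phi> (n \<otimes> g) x = \<phi> g x" for x
    proof (cases "x \<in> topspace X")
      case True
      then show ?thesis
        using act_mult[OF N.mem_carrier[OF n(1)] g True] triv[OF n(1) act_closed[OF g True]] by simp
    next
      case False
      then show ?thesis
        using act_ext[of "n \<otimes> g"] act_ext[OF g] g N.mem_carrier[OF n(1)] by (auto simp: extensional_def)
    qed
    then show ?thesis unfolding \<beta>_def n(2) by blast
  qed
  have car: "\<exists>g\<in>carrier G. C = N #> g" if "C \<in> carrier (G Mod N)" for C
    using that by (auto simp: FactGroup_def RCOSETS_def)
  show thesis
  proof (rule that[OF _ \<beta>])
    show "compact_G_space (G Mod N) X \<beta>"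
    proof (rule compact_G_spaceI[OF compact Hausdorff nonempty])
      show "continuous_map X X (\<beta> C)" if "C \<in> carrier (G Mod N)" for C
        using car[OF that] \<beta> continuous by auto
      show "group_action (G Mod N) (topspace X) \<beta>"
      proof (rule group_actionI[OF N.factorgroup_is_group])
        show "\<beta> C x \<in> topspace X" if "C \<in> carrier (G Mod N)" "x \<in> topspace X" for C x
          using car[OF that(1)] \<beta> act_closed that(2) by auto
        show "\<beta> C \<in> extensional (topspace X)" if "C \<in> carrier (G Mod N)" for C
          using car[OF that] \<beta> act_ext by auto
        show "\<beta> \<one>\<^bsub>G Mod N\<^esub> x = x" if "x \<in> topspace X" for x
        proof -
          have "\<one>\<^bsub>G Mod N\<^esub> = N #> \<one>" using N.subset by (simp add: FactGroup_def coset_mult_one)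
          then show ?thesis using \<beta>[of \<one>] act_one[OF that] by simp
        qed
        show "\<beta> (C \<otimes>\<^bsub>G Mod N\<^esub> D) x = \<beta> C (\<beta> D x)"
          if CD: "C \<in> carrier (G Mod N)" "D \<in> carrier (G Mod N)" and x: "x \<in> topspace X" for C D x
        proof -
          obtain g h where gh: "g \<in> carrier G" "C = N #> g" "h \<in> carrier G" "D = N #> h"
            using car[OF CD(1)] car[OF CD(2)] by blast
          have "C \<otimes>\<^bsub>G Mod N\<^esub> D = N #> (g \<otimes> h)"
            using N.rcos_sum[OF gh(1,3)] gh by (simp add: FactGroup_def)
          then show ?thesis using \<beta> gh act_mult[OF gh(1,3) x] by simp
        qed
      qed
    qed
  qed
qed

section \<open>Equivariant families of states\<close>

text \<open>
  The family is equivariant under all \<open>g\<close> that act trivially on the boundary of \<open>G/N\<close>. In particular its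
  value at \<open>z\<close> is fixed by those \<open>g\<close> that moreover fix \<open>z\<close>. This plays the role of the amenability of
  their group. The family is found inside the set of all \<open>N\<close>-equivariant families, continuous in \<open>z\<close>
  or not, because this set is compact for pointwise convergence.
\<close>

theorem equivariant_states_exist:
  fixes G (structure) and Y :: "'a set set set topology" and Z :: "'a set set topology"
    and X :: "'x topology"
  assumes N: "N \<lhd> G" and X: "compact_G_space G X \<phi>"
    and Z: "is_furstenberg_boundary (G\<lparr>carrier := N\<rparr>) Z \<tau>" and \<tau>: "compact_G_space G Z \<tau>"
    and Y: "is_furstenberg_boundary (G Mod N) Y \<psi>"
  obtains F where "\<And>z. z \<in> topspace Z \<Longrightarrow> F z \<in> states (topspace X) (Cont X)"
    "\<And>g z k. g \<in> carrier G \<Longrightarrow> (\<And>y. y \<in> topspace Y \<Longrightarrow> \<psi> (N #> g) y = y) \<Longrightarrow> z \<in> topspace Z \<Longrightarrow>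
      F (\<tau> g z) k = F z (\<lambda>x. k (\<phi> g x))"
proof -
  interpret X: compact_action G X \<phi> by unfold_locales (rule X)
  interpret XF: function_action "topspace X" "Cont X" G \<phi> by (rule X.function_action)
  interpret Z: compact_action G Z \<tau> by unfold_locales (rule \<tau>)
  interpret N: normal N G by (rule N)
  have NG: "n \<in> carrier G" if "n \<in> N" for n using N.mem_carrier[OF that] .
  let ?N = "G\<lparr>carrier := N\<rparr>"
  interpret XN: compact_action ?N X \<phi>
    by unfold_locales (rule compact_G_space_subgroup[OF X N.subgroup_axioms])
  interpret XNF: function_action "topspace X" "Cont X" ?N \<phi> by (rule XN.function_action)
  obtain B0 where B0: "B0 \<subseteq> X.P" "invariant_set ?N X.pact B0"
    "G_boundary ?N (top_of_set B0) (\<lambda>g. restrict (X.pact g) B0)"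
    by (rule convex_contains_boundary[OF XNF.convex_action_states])
  obtain f0 where f0: "equivariant_quotient ?N Z \<tau> (top_of_set B0) (\<lambda>g. restrict (X.pact g) B0) f0"
    using furstenberg_boundary_universal[OF Z B0(3)] by blast
  have f0B: "f0 z \<in> B0" if "z \<in> topspace Z" for z
    using f0 that by (auto simp: equivariant_quotient_def)
  have f0e: "f0 (\<tau> n z) k = f0 z (\<lambda>x. k (\<phi> n x))" if "n \<in> N" "z \<in> topspace Z" for n z k
  proof -
    have "f0 (\<tau> n z) = X.pact n (f0 z)"
      using f0 that f0B[OF that(2)] by (simp add: equivariant_quotient_def)
    then show ?thesis using f0B[OF that(2)] B0(1) by (auto simp: state_act_def)
  qed
  (* The N-equivariant families of states, as functions of a point and a test function. *)
  define M where "M = {F :: 'a set set \<times> ('x \<Rightarrow> real) \<Rightarrow> real.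
      (\<forall>z\<in>topspace Z. (\<lambda>k. F (z, k)) \<in> X.P) \<and>
      (\<forall>n\<in>N. \<forall>z\<in>topspace Z. \<forall>k. F (\<tau> n z, k) = F (z, \<lambda>x. k (\<phi> n x))) \<and>
      (\<forall>z k. z \<notin> topspace Z \<longrightarrow> F (z, k) = 0)}"
  have MP: "(\<lambda>k. F (z, k)) \<in> X.P" if "F \<in> M" "z \<in> topspace Z" for F z
    using that by (simp add: M_def)
  have MN: "F (\<tau> n z, k) = F (z, \<lambda>x. k (\<phi> n x))" if "F \<in> M" "n \<in> N" "z \<in> topspace Z" for F n z k
    using that by (simp add: M_def)
  have M0: "F (z, k) = 0" if "F \<in> M" "z \<notin> topspace Z" for F z k
    using that by (simp add: M_def)
  have Mcong: "F (z, k) = F (z, k')" if "F \<in> M" "z \<in> topspace Z" "\<And>x. x \<in> topspace X \<Longrightarrow> k x = k' x"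
    for F z and k k' :: "'x \<Rightarrow> real"
    using X.C.state_cong[OF MP[OF that(1,2)], of k k'] that(3) by simp
  define \<alpha> where "\<alpha> g = (\<lambda>F\<in>M. (\<lambda>(z, k). if z \<in> topspace Z then F (\<tau> (inv g) z, \<lambda>x. k (\<phi> g x)) else 0))" for g
  have \<alpha>: "\<alpha> g F (z, k) = (if z \<in> topspace Z then F (\<tau> (inv g) z, \<lambda>x. k (\<phi> g x)) else 0)"
    if "F \<in> M" for g F z k using that by (simp add: \<alpha>_def)
  have \<alpha>M: "\<alpha> g F \<in> M" if g: "g \<in> carrier G" and F: "F \<in> M" for g F
    unfolding M_def
  proof (intro CollectI conjI ballI allI impI)
    fix z assume z: "z \<in> topspace Z"
    have z': "\<tau> (inv g) z \<in> topspace Z" using Z.act_closed[OF _ z] g by simp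
    show "(\<lambda>k. \<alpha> g F (z, k)) \<in> X.P"
      using XF.state_act_closed[OF g MP[OF F z']] z by (simp add: \<alpha>[OF F])
  next
    fix n z k assume n: "n \<in> N" and z: "z \<in> topspace Z"
    have z': "\<tau> (inv g) z \<in> topspace Z" "\<tau> n z \<in> topspace Z"
      using Z.act_closed[OF _ z] g NG[OF n] by auto
    let ?m = "inv g \<otimes> n \<otimes> g"
    have m: "?m \<in> N" using N.inv_op_closed1[OF g n] .
    have "\<tau> (inv g) (\<tau> n z) = \<tau> (?m \<otimes> inv g) z"
      using Z.act_mult[of "inv g" n z] g NG[OF n] z by (simp add: X.m_assoc)
    also have "\<dots> = \<tau> ?m (\<tau> (inv g) z)" using Z.act_mult[OF NG[OF m], of "inv g" z] g z by simp
    finally have "\<alpha> g F (\<tau> n z, k) = F (\<tau> (inv g) z, \<lambda>x. k (\<phi> g (\<phi> ?m x)))"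
      using z' MN[OF F m z'(1)] by (simp add: \<alpha>[OF F])
    also have "\<dots> = F (\<tau> (inv g) z, \<lambda>x. k (\<phi> n (\<phi> g x)))"
    proof (rule Mcong[OF F z'(1)])
      fix x assume x: "x \<in> topspace X"
      have "g \<otimes> ?m = n \<otimes> g" using g NG[OF n] by (simp add: X.m_assoc[symmetric])
      then show "k (\<phi> g (\<phi> ?m x)) = k (\<phi> n (\<phi> g x))"
        using X.act_mult[OF g NG[OF m] x] X.act_mult[OF NG[OF n] g x] by simp
    qed
    finally show "\<alpha> g F (\<tau> n z, k) = \<alpha> g F (z, \<lambda>x. k (\<phi> n x))"
      using z by (simp add: \<alpha>[OF F])
  next
    show "\<alpha> g F (z, k) = 0" if "z \<notin> topspace Z" for z k using that by (simp add: \<alpha>[OF F])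
  qed
  have conv: "convex_action G M \<alpha>"
    unfolding convex_action_def
  proof (intro conjI allI impI)
    show "compactin euclidean M"
    proof (rule compactin_fun)
      show "\<exists>m. \<forall>F\<in>M. \<bar>F i\<bar> \<le> m" for i
      proof (cases i)
        case (Pair z k)
        show ?thesis
        proof (cases "z \<in> topspace Z")
          case True
          obtain m where m: "\<forall>q\<in>X.P. \<bar>q k\<bar> \<le> m" using X.C.states_bounded by blast
          show ?thesis
            using m MP[OF _ True] by (intro exI[of _ m]) (auto simp: Pair)
        next
          case False
          then show ?thesis using M0 by (intro exI[of _ 0]) (auto simp: Pair)
        qed
      qed
      have c: "continuous_on UNIV (\<lambda>F::'a set set \<times> ('x \<Rightarrow> real) \<Rightarrow> real. F i)" for i
        by (rule continuous_on_product_coordinates)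
      have imp: "closed {F. b \<longrightarrow> R F}" if "closed {F. R F}"
        for b and R :: "('a set set \<times> ('x \<Rightarrow> real) \<Rightarrow> real) \<Rightarrow> bool"
        using that by (cases b) auto
      have c1: "closed {F :: 'a set set \<times> ('x \<Rightarrow> real) \<Rightarrow> real. z \<in> topspace Z \<longrightarrow> (\<lambda>k. F (z, k)) \<in> X.P}" for z
      proof (rule imp)
        have "continuous_map euclidean euclidean (\<lambda>F :: 'a set set \<times> ('x \<Rightarrow> real) \<Rightarrow> real. \<lambda>k. F (z, k))"
          by (rule continuous_map_into_fun[OF continuous_map_coordinate])
        from closedin_continuous_map_preimage[OF this X.C.closedin_states]
        show "closed {F :: 'a set set \<times> ('x \<Rightarrow> real) \<Rightarrow> real. (\<lambda>k. F (z, k)) \<in> X.P}" by simp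
      qed
      have c2: "closed {F :: 'a set set \<times> ('x \<Rightarrow> real) \<Rightarrow> real. n \<in> N \<longrightarrow> z \<in> topspace Z \<longrightarrow>
          F (\<tau> n z, k) = F (z, \<lambda>x. k (\<phi> n x))}" for n z k
        by (intro imp closed_Collect_eq c)
      have c3: "closed {F :: 'a set set \<times> ('x \<Rightarrow> real) \<Rightarrow> real. z \<notin> topspace Z \<longrightarrow> F (z, k) = 0}" for z k
        by (intro imp closed_Collect_eq c continuous_on_const)
      have eq: "M = {F. (\<forall>z. z \<in> topspace Z \<longrightarrow> (\<lambda>k. F (z, k)) \<in> X.P) \<and>
          (\<forall>n z k. n \<in> N \<longrightarrow> z \<in> topspace Z \<longrightarrow> F (\<tau> n z, k) = F (z, \<lambda>x. k (\<phi> n x))) \<and>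
          (\<forall>z k. z \<notin> topspace Z \<longrightarrow> F (z, k) = 0)}"
        unfolding M_def Ball_def all_simps ..
      have "closed M"
        unfolding eq by (intro closed_Collect_conj closed_Collect_all c1 c2 c3)
      then show "closedin euclidean M" by simp
    qed
    show "M \<noteq> {}"
    proof -
      have "(\<lambda>(z, k). if z \<in> topspace Z then f0 z k else 0) \<in> M"
        unfolding M_def
      proof (intro CollectI conjI ballI allI impI)
        show "(\<lambda>k. case (z, k) of (z, k) \<Rightarrow> if z \<in> topspace Z then f0 z k else 0) \<in> X.P"
          if "z \<in> topspace Z" for z using f0B[OF that] B0(1) that by auto
      qed (use f0e Z.act_closed NG in auto)
      then show ?thesis by blast
    qed
    show "fun_convex M"
      unfolding fun_convex_def
    proof (intro ballI allI impI)
      fix p q and t :: real assume p: "p \<in> M" and q: "q \<in> M" and t: "0 \<le> t \<and> t \<le> 1"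
      show "(\<lambda>i. (1 - t) * p i + t * q i) \<in> M"
        unfolding M_def using X.C.states_mix[OF MP[OF p] MP[OF q]] MN[OF p] MN[OF q] M0[OF p] M0[OF q] t
        by simp
    qed
    show "group_action G M \<alpha>"
    proof (rule group_actionI[OF X.is_group])
      show "\<alpha> g F \<in> M" if "g \<in> carrier G" "F \<in> M" for g F by (rule \<alpha>M[OF that])
      show "\<alpha> g \<in> extensional M" for g by (simp add: \<alpha>_def)
      show "\<alpha> \<one> F = F" if F: "F \<in> M" for F
      proof
        fix i :: "'a set set \<times> ('x \<Rightarrow> real)"
        obtain z k where i: "i = (z, k)" by (cases i)
        show "\<alpha> \<one> F i = F i"
          using Mcong[OF F, of z "\<lambda>x. k (\<phi> \<one> x)" k] M0[OF F, of z k] Z.act_one[of z] X.act_one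
          by (cases "z \<in> topspace Z") (simp_all add: \<alpha>[OF F] i)
      qed
      fix g h F assume g: "g \<in> carrier G" and h: "h \<in> carrier G" and F: "F \<in> M"
      show "\<alpha> (g \<otimes> h) F = \<alpha> g (\<alpha> h F)"
      proof
        fix i :: "'a set set \<times> ('x \<Rightarrow> real)"
        obtain z k where i: "i = (z, k)" by (cases i)
        show "\<alpha> (g \<otimes> h) F i = \<alpha> g (\<alpha> h F) i"
        proof (cases "z \<in> topspace Z")
          case True
          have z1: "\<tau> (inv g) z \<in> topspace Z" using Z.act_closed[OF _ True] g by simp
          then have z2: "\<tau> (inv h) (\<tau> (inv g) z) \<in> topspace Z" using Z.act_closed[OF _ z1] h by simp
          have "\<tau> (inv (g \<otimes> h)) z = \<tau> (inv h) (\<tau> (inv g) z)"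
            using Z.act_mult[of "inv h" "inv g" z] g h True by (simp add: X.inv_mult_group)
          then show ?thesis
            using True z1 Mcong[OF F z2, of "\<lambda>x. k (\<phi> (g \<otimes> h) x)" "\<lambda>x. k (\<phi> g (\<phi> h x))"]
              X.act_mult[OF g h] by (simp add: \<alpha>[OF F] \<alpha>[OF \<alpha>M[OF h F]] i)
        qed (simp add: \<alpha>[OF F] \<alpha>[OF \<alpha>M[OF h F]] i)
      qed
    qed
    show "\<exists>j. \<forall>F\<in>M. \<alpha> g F i = F j" if g: "g \<in> carrier G" for g i
    proof (cases i)
      case (Pair z k)
      show ?thesis
        by (rule exI[of _ "if z \<in> topspace Z then (\<tau> (inv g) z, \<lambda>x. k (\<phi> g x)) else (z, k)"])
          (simp add: Pair \<alpha> M0)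
    qed
  qed
  obtain B where B: "B \<subseteq> M" "invariant_set G \<alpha> B" "G_boundary G (top_of_set B) (\<lambda>g. restrict (\<alpha> g) B)"
    by (rule convex_contains_boundary[OF conv])
  (* Equivariance under N means being fixed by N, so G acts on M through G/N. *)
  have triv: "\<alpha> n F = F" if n: "n \<in> N" and F: "F \<in> M" for n F
  proof
    fix i :: "'a set set \<times> ('x \<Rightarrow> real)"
    obtain z k where i: "i = (z, k)" by (cases i)
    show "\<alpha> n F i = F i"
    proof (cases "z \<in> topspace Z")
      case True
      have "F (\<tau> (inv n) z, \<lambda>x. k (\<phi> n x)) = F (z, \<lambda>x. k (\<phi> n (\<phi> (inv n) x)))"
        using MN[OF F _ True, of "inv n"] n by simp
      also have "\<dots> = F (z, k)"
        using X.act_inv(2)[OF NG[OF n]] by (intro Mcong[OF F True]) simp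
      finally show ?thesis using True by (simp add: \<alpha>[OF F] i)
    qed (simp add: \<alpha>[OF F] i M0[OF F])
  qed
  have cB: "compact_G_space G (top_of_set B) (\<lambda>g. restrict (\<alpha> g) B)"
    using B(3) by (simp add: G_boundary_def minimal_compact_G_space_def)
  obtain \<beta> where \<beta>: "compact_G_space (G Mod N) (top_of_set B) \<beta>"
    "\<And>g. g \<in> carrier G \<Longrightarrow> \<beta> (N #> g) = restrict (\<alpha> g) B"
  proof (rule compact_G_space_quotient[OF cB N])
    show "restrict (\<alpha> n) B x = x" if "n \<in> N" "x \<in> topspace (top_of_set B)" for n x
      using triv[OF that(1)] that(2) B(1) by auto
  qed blast
  have "G_boundary (G Mod N) (top_of_set B) \<beta>"
  proof (rule G_boundary_more_maps[OF B(3) \<beta>(1)])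
    show "(\<lambda>g. restrict (\<alpha> g) B) ` carrier G \<subseteq> \<beta> ` carrier (G Mod N)"
      using \<beta>(2) by (force simp: FactGroup_def RCOSETS_def image_iff)
  qed
  then obtain \<pi> where \<pi>: "equivariant_quotient (G Mod N) Y \<psi> (top_of_set B) \<beta> \<pi>"
    using furstenberg_boundary_universal[OF Y] by blast
  interpret Bc: compact_action G "top_of_set B" "\<lambda>g. restrict (\<alpha> g) B" by unfold_locales (rule cB)
  obtain F where FB: "F \<in> B" using Bc.nonempty by auto
  then have F: "F \<in> M" using B(1) by blast
  show thesis
  proof (rule that[of "\<lambda>z k. F (z, k)"])
    show "(\<lambda>k. F (z, k)) \<in> X.P" if "z \<in> topspace Z" for z by (rule MP[OF F that])
    fix g z k assume g: "g \<in> carrier G" and fixY: "\<And>y. y \<in> topspace Y \<Longrightarrow> \<psi> (N #> g) y = y"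
      and z: "z \<in> topspace Z"
    have Ng: "N #> g \<in> carrier (G Mod N)" using g by (auto simp: FactGroup_def RCOSETS_def)
    have "F \<in> \<pi> ` topspace Y" using \<pi> FB by (simp add: equivariant_quotient_def)
    then obtain y where y: "y \<in> topspace Y" "\<pi> y = F" by blast
    have "\<pi> (\<psi> (N #> g) y) = \<beta> (N #> g) (\<pi> y)"
      using \<pi> y(1) Ng by (simp add: equivariant_quotient_def)
    then have "\<alpha> g F = F"
      using y fixY[OF y(1)] \<beta>(2)[OF g] FB by simp
    then have "\<alpha> g F (\<tau> g z, k) = F (\<tau> g z, k)" by simp
    then show "F (\<tau> g z, k) = F (z, \<lambda>x. k (\<phi> g x))"
      using Z.act_inv(1)[OF g z] Z.act_closed[OF g z] by (simp add: \<alpha>[OF F])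
  qed
qed

section \<open>The space of subgroups\<close>

lemma topspace_Sub [simp]: "topspace (Sub G) = {H. subgroup H G}"
  unfolding Sub_def topspace_pullback_topology by auto

lemma openin_Sub_basic:
  assumes F: "finite F" "F \<subseteq> carrier G"
  shows "openin (Sub G) {H. subgroup H G \<and> H \<inter> F = K \<inter> F}"
proof -
  define Y where "Y i = (if i \<in> F then {i \<in> K} else UNIV)" for i
  have "openin (product_topology (\<lambda>_. discrete_topology UNIV) (carrier G)) (\<Pi>\<^sub>E i\<in>carrier G. Y i)"
    using F(1) by (intro product_topology_basis) (auto simp: Y_def intro: finite_subset[of _ F])
  moreover have "{H. subgroup H G \<and> H \<inter> F = K \<inter> F} =
      (\<lambda>H. \<lambda>g\<in>carrier G. g \<in> H) -` (\<Pi>\<^sub>E i\<in>carrier G. Y i) \<inter> {H. subgroup H G}"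
    using F(2) by (auto simp: Y_def PiE_iff split: if_splits)
  ultimately show ?thesis unfolding Sub_def openin_pullback_topology by blast
qed

lemma openin_Sub_contains_basic:
  assumes U: "openin (Sub G) U" and K: "K \<in> U"
  obtains F where "finite F" "F \<subseteq> carrier G" "{H. subgroup H G \<and> H \<inter> F = K \<inter> F} \<subseteq> U"
proof -
  let ?I = "\<lambda>H. \<lambda>g\<in>carrier G. g \<in> H"
  obtain W where W: "openin (product_topology (\<lambda>_. discrete_topology (UNIV :: bool set)) (carrier G)) W"
    "U = ?I -` W \<inter> {H. subgroup H G}"
    using U unfolding Sub_def openin_pullback_topology by blast
  have KW: "?I K \<in> W" using K W(2) by blast
  obtain Y where Y: "?I K \<in> (\<Pi>\<^sub>E i\<in>carrier G. Y i)" "finite {i. Y i \<noteq> UNIV}"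
    "(\<Pi>\<^sub>E i\<in>carrier G. Y i) \<subseteq> W"
    using product_topology_open_contains_basis[OF W(1) KW] by auto
  define F where "F = {i \<in> carrier G. Y i \<noteq> UNIV}"
  show thesis
  proof (rule that[of F])
    show "finite F" using Y(2) by (rule rev_finite_subset) (auto simp: F_def)
    show "F \<subseteq> carrier G" by (auto simp: F_def)
    show "{H. subgroup H G \<and> H \<inter> F = K \<inter> F} \<subseteq> U"
    proof
      fix H assume H: "H \<in> {H. subgroup H G \<and> H \<inter> F = K \<inter> F}"
      have "(i \<in> H) \<in> Y i" if i: "i \<in> carrier G" for i
      proof (cases "i \<in> F")
        case True
        then have "(i \<in> H) = (i \<in> K)" using H by blast
        then show ?thesis using Y(1) i by (auto simp: PiE_iff)
      qed (use i in \<open>simp add: F_def\<close>)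
      then have "?I H \<in> (\<Pi>\<^sub>E i\<in>carrier G. Y i)" by (auto simp: PiE_iff)
      then show "H \<in> U" using Y(3) W(2) H by blast
    qed
  qed
qed

text \<open>
  The topology on subgroups is handled through finite subsets of the group.
\<close>

lemma in_closure_Sub:
  assumes "S \<subseteq> {H. subgroup H G}"
  shows "K \<in> Sub G closure_of S \<longleftrightarrow>
    subgroup K G \<and> (\<forall>F. finite F \<and> F \<subseteq> carrier G \<longrightarrow> (\<exists>H\<in>S. H \<inter> F = K \<inter> F))"
proof (intro iffI conjI allI impI)
  assume K: "K \<in> Sub G closure_of S"
  then show sK: "subgroup K G" using closure_of_subset_topspace[of "Sub G" S] by auto
  fix F assume F: "finite F \<and> F \<subseteq> carrier G"
  define U where "U = {H. subgroup H G \<and> H \<inter> F = K \<inter> F}"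
  have "openin (Sub G) U" unfolding U_def using F by (intro openin_Sub_basic) auto
  moreover have "K \<in> U" using sK by (simp add: U_def)
  ultimately obtain H where "H \<in> S" "H \<in> U"
    using K unfolding in_closure_of by blast
  then show "\<exists>H\<in>S. H \<inter> F = K \<inter> F" by (auto simp: U_def)
next
  assume R: "subgroup K G \<and> (\<forall>F. finite F \<and> F \<subseteq> carrier G \<longrightarrow> (\<exists>H\<in>S. H \<inter> F = K \<inter> F))"
  show "K \<in> Sub G closure_of S"
    unfolding in_closure_of
  proof (intro conjI allI impI)
    show "K \<in> topspace (Sub G)" using R by simp
    fix T assume "K \<in> T \<and> openin (Sub G) T"
    then obtain F where F: "finite F" "F \<subseteq> carrier G" "{H. subgroup H G \<and> H \<inter> F = K \<inter> F} \<subseteq> T"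
      using openin_Sub_contains_basic[of G T K] by blast
    then obtain H where "H \<in> S" "H \<inter> F = K \<inter> F" using R by blast
    then show "\<exists>y. y \<in> S \<and> y \<in> T" using F(3) assms by blast
  qed
qed

lemma closure_SubE:
  assumes "K \<in> Sub G closure_of S" "S \<subseteq> {H. subgroup H G}" "finite F" "F \<subseteq> carrier G"
  obtains H where "H \<in> S" "H \<inter> F = K \<inter> F"
  using assms by (auto simp: in_closure_Sub)

lemma compact_space_Sub:
  fixes G (structure)
  assumes G: "group G"
  shows "compact_space (Sub G)"
proof -
  interpret group G by fact
  let ?P = "product_topology (\<lambda>_. discrete_topology (UNIV :: bool set)) (carrier G)"
  define C where "C a v = {p \<in> topspace ?P. p a \<in> {v}}" for a v
  have C: "closedin ?P (C a v)" if "a \<in> carrier G" for a v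
    unfolding C_def using that
    by (intro closedin_continuous_map_preimage[OF continuous_map_product_projection]) auto
  define D where "D = C \<one> True \<inter>
    (\<Inter>a\<in>carrier G. \<Inter>b\<in>carrier G. C a False \<union> C b False \<union> C (a \<otimes> b) True) \<inter>
    (\<Inter>a\<in>carrier G. C a False \<union> C (inv a) True)"
  have "closedin ?P D"
    unfolding D_def using one_closed by (intro closedin_Int closedin_INT closedin_Un C) auto
  moreover have "compact_space ?P"
    by (simp add: compact_space_product_topology compact_space_discrete_topology)
  ultimately have cD: "compactin ?P D" by (intro closedin_compact_space)
  define s where "s p = {g \<in> carrier G. p g}" for p :: "'a \<Rightarrow> bool"
  have Dtop: "D \<subseteq> topspace ?P" by (auto simp: D_def C_def)
  have sub: "subgroup (s p) G" if p: "p \<in> D" for p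
  proof (rule subgroupI)
    show "s p \<subseteq> carrier G" by (auto simp: s_def)
    show "s p \<noteq> {}" using p one_closed by (auto simp: s_def D_def C_def)
    show "inv a \<in> s p" if "a \<in> s p" for a using p that by (auto simp: s_def D_def C_def)
    show "a \<otimes> b \<in> s p" if "a \<in> s p" "b \<in> s p" for a b using p that by (force simp: s_def D_def C_def)
  qed
  have "continuous_map (subtopology ?P D) (Sub G) s"
    unfolding Sub_def
  proof (rule continuous_map_pullback')
    have "continuous_map (subtopology ?P D) ?P id" by (simp add: continuous_map_from_subtopology)
    then show "continuous_map (subtopology ?P D) ?P ((\<lambda>H. \<lambda>g\<in>carrier G. g \<in> H) \<circ> s)"
    proof (rule continuous_map_eq)
      fix p assume "p \<in> topspace (subtopology ?P D)"
      then have "p \<in> extensional (carrier G)" by (auto simp: PiE_def)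
      then show "id p = ((\<lambda>H. \<lambda>g\<in>carrier G. g \<in> H) \<circ> s) p"
        by (auto simp: s_def fun_eq_iff extensional_def restrict_def)
    qed
    show "topspace (subtopology ?P D) \<subseteq> s -` {H. subgroup H G}" using sub by auto
  qed
  moreover have "compactin (subtopology ?P D) D" using cD by (simp add: compactin_subtopology)
  ultimately have "compactin (Sub G) (s ` D)" by (rule image_compactin[rotated])
  moreover have "{H. subgroup H G} \<subseteq> s ` D"
  proof
    fix H assume "H \<in> {H. subgroup H G}"
    then have H: "subgroup H G" by simp
    interpret H: subgroup H G by fact
    let ?p = "\<lambda>g\<in>carrier G. g \<in> H"
    have "s ?p = H" using H.subset by (auto simp: s_def)
    moreover have "?p \<in> D" unfolding D_def C_def by (auto intro: H.one_closed)
    ultimately show "H \<in> s ` D" by blast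
  qed
  ultimately show ?thesis
    using compactin_subset_topspace unfolding compact_space_def
    by (metis subset_antisym topspace_Sub)
qed

context group
begin

text \<open>
  Unlike for the product of cosets, membership unfolds here without an existential quantifier.
\<close>

definition conjugate :: "'a \<Rightarrow> 'a set \<Rightarrow> 'a set" where
  "conjugate g H = {x \<in> carrier G. inv g \<otimes> x \<otimes> g \<in> H}"

lemma conj_action_eq:
  assumes g: "g \<in> carrier G" and H: "subgroup H G"
  shows "conj_action G g H = conjugate g H"
proof -
  interpret H: subgroup H G by fact
  have "x \<in> g <# H #> inv g \<longleftrightarrow> x \<in> conjugate g H" for x
  proof
    assume "x \<in> g <# H #> inv g"
    then obtain h where h: "h \<in> H" "x = g \<otimes> h \<otimes> inv g" by (auto simp: l_coset_def r_coset_def)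
    then have "h \<in> carrier G" using H.mem_carrier by blast
    moreover from this have "inv g \<otimes> (g \<otimes> h \<otimes> inv g) \<otimes> g = h"
      using g by (simp add: m_assoc[symmetric]) (simp add: m_assoc)
    ultimately show "x \<in> conjugate g H" using h g by (simp add: conjugate_def)
  next
    assume x: "x \<in> conjugate g H"
    then have "x = g \<otimes> (inv g \<otimes> x \<otimes> g) \<otimes> inv g"
      using g by (simp add: conjugate_def m_assoc[symmetric]) (simp add: m_assoc conjugate_def)
    then show "x \<in> g <# H #> inv g" using x by (auto simp: l_coset_def r_coset_def conjugate_def)
  qed
  then show ?thesis using H by (auto simp: conj_action_def)
qed

lemma conjugate_subset: "conjugate g H \<subseteq> carrier G"
  by (auto simp: conjugate_def)

lemma conjugate_mono: "H \<subseteq> K \<Longrightarrow> conjugate g H \<subseteq> conjugate g K"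
  by (auto simp: conjugate_def)

lemma conjugate_one: "H \<subseteq> carrier G \<Longrightarrow> conjugate \<one> H = H"
  by (auto simp: conjugate_def)

lemma conjugate_mult:
  assumes "g \<in> carrier G" "h \<in> carrier G"
  shows "conjugate (g \<otimes> h) H = conjugate g (conjugate h H)"
proof -
  have "inv (g \<otimes> h) \<otimes> x \<otimes> (g \<otimes> h) = inv h \<otimes> (inv g \<otimes> x \<otimes> g) \<otimes> h" if "x \<in> carrier G" for x
    using assms that by (simp add: inv_mult_group m_assoc)
  then show ?thesis using assms by (auto simp: conjugate_def)
qed

lemma subgroup_conjugate:
  assumes g: "g \<in> carrier G" and H: "subgroup H G"
  shows "subgroup (conjugate g H) G"
proof (rule subgroupI)
  interpret H: subgroup H G by fact
  show "conjugate g H \<subseteq> carrier G" by (rule conjugate_subset)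
  have "\<one> \<in> conjugate g H" using g by (simp add: conjugate_def)
  then show "conjugate g H \<noteq> {}" by blast
  fix a assume a: "a \<in> conjugate g H"
  have ac: "a \<in> carrier G" "inv g \<otimes> a \<otimes> g \<in> H" using a by (auto simp: conjugate_def)
  have "inv g \<otimes> inv a \<otimes> g = inv (inv g \<otimes> a \<otimes> g)" using g ac(1) by (simp add: inv_mult_group m_assoc)
  then show "inv a \<in> conjugate g H" using ac by (simp add: conjugate_def)
  fix b assume b: "b \<in> conjugate g H"
  have bc: "b \<in> carrier G" "inv g \<otimes> b \<otimes> g \<in> H" using b by (auto simp: conjugate_def)
  have "inv g \<otimes> (a \<otimes> b) \<otimes> g = (inv g \<otimes> a \<otimes> g) \<otimes> (inv g \<otimes> b \<otimes> g)"
    using g ac(1) bc(1) by (simp add: m_assoc) (simp add: m_assoc[symmetric])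
  then show "a \<otimes> b \<in> conjugate g H" using ac bc by (simp add: conjugate_def)
qed

lemma conjugate_normal:
  assumes R: "R \<lhd> G" and g: "g \<in> carrier G"
  shows "conjugate g R = R"
proof -
  interpret R: normal R G by fact
  have "x \<in> R" if "x \<in> conjugate g R" for x
  proof -
    have x: "x \<in> carrier G" "inv g \<otimes> x \<otimes> g \<in> R" using that by (auto simp: conjugate_def)
    have "g \<otimes> (inv g \<otimes> x \<otimes> g) \<otimes> inv g \<in> R" using R.inv_op_closed2[OF g x(2)] .
    also have "g \<otimes> (inv g \<otimes> x \<otimes> g) \<otimes> inv g = x"
      using g x(1) by (simp add: m_assoc[symmetric]) (simp add: m_assoc)
    finally show ?thesis .
  qed
  moreover have "x \<in> conjugate g R" if "x \<in> R" for x
    using R.inv_op_closed1[OF g that] that R.mem_carrier by (simp add: conjugate_def)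
  ultimately show ?thesis by blast
qed

lemma carrier_normal: "carrier G \<lhd> G"
  unfolding normal_inv_iff using subgroup_self by auto

lemma conjugate_Int_finite:
  assumes g: "g \<in> carrier G" and F: "F \<subseteq> carrier G"
    and eq: "H \<inter> (\<lambda>x. inv g \<otimes> x \<otimes> g) ` F = K \<inter> (\<lambda>x. inv g \<otimes> x \<otimes> g) ` F"
  shows "conjugate g H \<inter> F = conjugate g K \<inter> F"
  using eq F unfolding conjugate_def by blast

definition conjugate_invariant :: "'a set set \<Rightarrow> bool" where
  "conjugate_invariant S \<longleftrightarrow> (\<forall>g\<in>carrier G. \<forall>H\<in>S. conjugate g H \<in> S)"

lemma invariant_conj_action:
  assumes "S \<subseteq> {H. subgroup H G}"
  shows "invariant_set G (conj_action G) S \<longleftrightarrow> conjugate_invariant S"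
  using assms conj_action_eq by (fastforce simp: invariant_set_def conjugate_invariant_def)

lemma closedin_Sub_subgroup: "closedin (Sub G) S \<Longrightarrow> H \<in> S \<Longrightarrow> subgroup H G"
  using closedin_subset[of "Sub G" S] by auto

lemma URS_iff:
  "URS G U \<longleftrightarrow> closedin (Sub G) U \<and> U \<noteq> {} \<and> conjugate_invariant U \<and>
    (\<forall>B. closedin (Sub G) B \<and> B \<noteq> {} \<and> conjugate_invariant B \<and> B \<subseteq> U \<longrightarrow> B = U)"
proof -
  have "invariant_set G (conj_action G) S \<longleftrightarrow> conjugate_invariant S" if "closedin (Sub G) S" for S
    using closedin_subset[OF that] by (intro invariant_conj_action) simp
  then show ?thesis unfolding URS_def minimal_closed_invariant_def by blast
qed

lemma URS_D:
  assumes "URS G U"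
  shows "closedin (Sub G) U" "U \<noteq> {}" "\<And>g H. g \<in> carrier G \<Longrightarrow> H \<in> U \<Longrightarrow> conjugate g H \<in> U"
    "\<And>B. closedin (Sub G) B \<Longrightarrow> B \<noteq> {} \<Longrightarrow> conjugate_invariant B \<Longrightarrow> B \<subseteq> U \<Longrightarrow> B = U"
    "\<And>H. H \<in> U \<Longrightarrow> subgroup H G"
  using assms closedin_Sub_subgroup[of U] unfolding URS_iff by (auto simp: conjugate_invariant_def)

lemma conjugate_closure:
  assumes S: "S \<subseteq> {H. subgroup H G}" and K: "K \<in> Sub G closure_of S" and g: "g \<in> carrier G"
  shows "conjugate g K \<in> Sub G closure_of (conjugate g ` S)"
proof -
  have "conjugate g ` S \<subseteq> {H. subgroup H G}" using S subgroup_conjugate[OF g] by auto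
  moreover have "subgroup (conjugate g K) G" using K subgroup_conjugate[OF g] by (simp add: in_closure_Sub[OF S])
  moreover have "\<exists>H\<in>conjugate g ` S. H \<inter> F = conjugate g K \<inter> F" if F: "finite F" "F \<subseteq> carrier G" for F
  proof -
    define F' where "F' = (\<lambda>x. inv g \<otimes> x \<otimes> g) ` F"
    have F': "finite F'" "F' \<subseteq> carrier G" using F g by (auto simp: F'_def)
    obtain H where H: "H \<in> S" "H \<inter> F' = K \<inter> F'" by (rule closure_SubE[OF K S F'])
    then have "conjugate g H \<inter> F = conjugate g K \<inter> F" unfolding F'_def by (intro conjugate_Int_finite[OF g F(2)])
    then show ?thesis using H(1) by blast
  qed
  ultimately show ?thesis by (simp add: in_closure_Sub)
qed

lemma conjugate_invariant_closure:
  assumes S: "S \<subseteq> {H. subgroup H G}" and inv: "conjugate_invariant S"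
  shows "conjugate_invariant (Sub G closure_of S)"
  unfolding conjugate_invariant_def
proof (intro ballI)
  fix g K assume g: "g \<in> carrier G" and K: "K \<in> Sub G closure_of S"
  have "conjugate g ` S \<subseteq> S" using inv g by (auto simp: conjugate_invariant_def)
  then show "conjugate g K \<in> Sub G closure_of S"
    using conjugate_closure[OF S K g] closure_of_mono[of "conjugate g ` S" S "Sub G"] by blast
qed

text \<open>
  A compactness argument: the subgroups in \<open>S\<close> that avoid a given finite set form a closed set.
\<close>

lemma subgroup_below_set:
  assumes S: "closedin (Sub G) S" and T: "\<And>F. finite F \<Longrightarrow> F \<subseteq> carrier G - T \<Longrightarrow> \<exists>K\<in>S. K \<inter> F = {}"
  shows "\<exists>K\<in>S. K \<subseteq> T"
proof -
  have sS: "S \<subseteq> {H. subgroup H G}" using closedin_subset[OF S] by simp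
  define C where "C F = {K \<in> S. K \<inter> F = {}}" for F
  define D where "D = {F. finite F \<and> F \<subseteq> carrier G - T}"
  have "\<exists>K\<in>topspace (Sub G). \<forall>F\<in>D. K \<in> C F"
  proof (rule compactin_directed_Inter)
    show "compactin (Sub G) (topspace (Sub G))"
      using compact_space_Sub[OF is_group] by (simp only: compact_space_def)
    show "D \<noteq> {}" by (auto simp: D_def)
    show "closedin (Sub G) (C F)" if F: "F \<in> D" for F
    proof -
      have "Sub G closure_of (C F) \<subseteq> C F"
      proof
        fix K assume K: "K \<in> Sub G closure_of (C F)"
        have CS: "C F \<subseteq> S" by (auto simp: C_def)
        then have "K \<in> S" using K closure_of_minimal[OF CS S] by blast
        moreover have "K \<inter> F = {}"
        proof -
          have CF: "C F \<subseteq> {H. subgroup H G}" "finite F" "F \<subseteq> carrier G"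
            using CS sS F by (auto simp: D_def)
          obtain H where "H \<in> C F" "H \<inter> F = K \<inter> F" by (rule closure_SubE[OF K CF])
          then show ?thesis by (auto simp: C_def)
        qed
        ultimately show "K \<in> C F" by (simp add: C_def)
      qed
      moreover have "C F \<subseteq> topspace (Sub G)" using sS by (auto simp: C_def)
      ultimately show ?thesis by (intro closure_of_subset_eq[THEN iffD1] conjI)
    qed
    show "topspace (Sub G) \<inter> C F \<noteq> {}" if "F \<in> D" for F
      using T[of F] that sS by (auto simp: C_def D_def)
    show "\<exists>f\<in>D. C f \<subseteq> C d \<inter> C e" if "d \<in> D" "e \<in> D" for d e
      using that by (intro bexI[of _ "d \<union> e"]) (auto simp: C_def D_def)
  qed
  then obtain K where K: "subgroup K G" "\<And>F. F \<in> D \<Longrightarrow> K \<in> C F" by auto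
  have "K \<in> S" using K(2)[of "{}"] by (simp add: C_def D_def)
  moreover have "x \<in> T" if "x \<in> K" for x
  proof (rule ccontr)
    assume "x \<notin> T"
    then have "{x} \<in> D" using that subgroup.mem_carrier[OF K(1)] by (auto simp: D_def)
    then show False using K(2)[of "{x}"] that by (auto simp: C_def)
  qed
  ultimately show ?thesis by blast
qed

text \<open>
  By \<open>subgroup_below_set\<close>, the members of \<open>U\<close> that contain a member of \<open>V\<close> form a closed set.
\<close>

lemma URS_below_all:
  assumes U: "URS G U" and V: "closedin (Sub G) V" "conjugate_invariant V"
    and H0: "H0 \<in> U" "K0 \<in> V" "K0 \<subseteq> H0" and H: "H \<in> U"
  shows "\<exists>K\<in>V. K \<subseteq> H"
proof -
  define W where "W = {H \<in> U. \<exists>K\<in>V. K \<subseteq> H}"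
  have sU: "U \<subseteq> {H. subgroup H G}" using URS_D(5)[OF U] by blast
  have sW: "W \<subseteq> {H. subgroup H G}" using sU by (auto simp: W_def)
  have "W = U"
  proof (rule URS_D(4)[OF U])
    show "W \<noteq> {}" using H0 by (auto simp: W_def)
    show "conjugate_invariant W"
      unfolding conjugate_invariant_def
    proof (intro ballI)
      fix g H assume g: "g \<in> carrier G" and "H \<in> W"
      then obtain K where K: "H \<in> U" "K \<in> V" "K \<subseteq> H" by (auto simp: W_def)
      then have "conjugate g K \<subseteq> conjugate g H" "conjugate g K \<in> V" using conjugate_mono V(2) g by (auto simp: conjugate_invariant_def)
      then show "conjugate g H \<in> W" using URS_D(3)[OF U g K(1)] by (auto simp: W_def)
    qed
    have "Sub G closure_of W \<subseteq> W"
    proof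
      fix H assume HW: "H \<in> Sub G closure_of W"
      have "W \<subseteq> U" by (auto simp: W_def)
      then have HU: "H \<in> U" using HW closure_of_minimal[OF _ URS_D(1)[OF U]] by blast
      have "\<exists>K\<in>V. K \<subseteq> H"
      proof (rule subgroup_below_set[OF V(1)])
        fix F assume F: "finite F" "F \<subseteq> carrier G - H"
        then obtain H' where H': "H' \<in> W" "H' \<inter> F = H \<inter> F"
          using closure_SubE[OF HW sW, of F] by blast
        then obtain K where "K \<in> V" "K \<subseteq> H'" by (auto simp: W_def)
        then show "\<exists>K\<in>V. K \<inter> F = {}" using F(2) H'(2) by blast
      qed
      then show "H \<in> W" using HU by (simp add: W_def)
    qed
    then show "closedin (Sub G) W" using sW closure_of_subset_eq[of W "Sub G"] by simp
  qed (auto simp: W_def)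
  then show ?thesis using H by (auto simp: W_def)
qed

lemma closed_Sub_minimal_element:
  assumes S: "closedin (Sub G) S" "S \<noteq> {}"
  obtains H where "H \<in> S" "\<And>K. K \<in> S \<Longrightarrow> K \<subseteq> H \<Longrightarrow> K = H"
proof -
  define R where "R = (\<lambda>B C :: 'a set. C \<subseteq> B)"
  have "\<exists>m\<in>S. \<forall>a\<in>S. R m a \<longrightarrow> a = m"
  proof (rule predicate_Zorn)
    show "partial_order_on S (relation_of R S)"
      by (rule partial_order_on_relation_ofI) (auto simp: R_def)
    fix \<C> assume ch: "\<C> \<in> Chains (relation_of R S)"
    then have CS: "\<C> \<subseteq> S" and lin: "\<And>B C. B \<in> \<C> \<Longrightarrow> C \<in> \<C> \<Longrightarrow> B \<subseteq> C \<or> C \<subseteq> B"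
      by (auto simp: Chains_def relation_of_def R_def)
    show "\<exists>u\<in>S. \<forall>a\<in>\<C>. R a u"
    proof (cases "\<C> = {}")
      case True
      then show ?thesis using S(2) by auto
    next
      case False
      have "\<exists>K\<in>S. K \<subseteq> \<Inter>\<C>"
      proof (rule subgroup_below_set[OF S(1)])
        fix F assume "finite F" "F \<subseteq> carrier G - \<Inter>\<C>"
        then have "\<exists>K\<in>\<C>. K \<inter> F = {}"
        proof (induction F rule: finite_induct)
          case empty
          then show ?case using False by auto
        next
          case (insert x F)
          then obtain K L where "K \<in> \<C>" "K \<inter> F = {}" "L \<in> \<C>" "x \<notin> L" by auto
          then show ?case using lin[of K L] by auto
        qed
        then show "\<exists>K\<in>S. K \<inter> F = {}" using CS by blast
      qed
      then show ?thesis by (auto simp: R_def)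
    qed
  qed
  then show thesis using that by (auto simp: R_def)
qed

text \<open>
  A URS may contain pairs of members that are properly nested, so one starts from a minimal member \<open>H\<close>
  of \<open>U\<close>. Below it lies a member of \<open>V\<close>, and below that a member of \<open>U\<close>; by minimality all three are
  equal, so \<open>U\<close> and \<open>V\<close> meet.
\<close>

lemma URS_antisym:
  assumes U: "URS G U" and V: "URS G V"
    and 1: "H1 \<in> U" "K1 \<in> V" "K1 \<subseteq> H1" and 2: "H2 \<in> U" "K2 \<in> V" "H2 \<subseteq> K2"
  shows "U = V"
proof -
  have inv: "conjugate_invariant U" "conjugate_invariant V" using U V by (auto simp: URS_iff)
  obtain H where H: "H \<in> U" "\<And>K. K \<in> U \<Longrightarrow> K \<subseteq> H \<Longrightarrow> K = H"
    by (rule closed_Sub_minimal_element[OF URS_D(1,2)[OF U]]) blast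
  obtain K where K: "K \<in> V" "K \<subseteq> H"
    using URS_below_all[OF U URS_D(1)[OF V] inv(2) 1 H(1)] by blast
  obtain H' where H': "H' \<in> U" "H' \<subseteq> K"
    using URS_below_all[OF V URS_D(1)[OF U] inv(1) 2(2,1,3) K(1)] by blast
  have "K = H" using H(2)[OF H'(1)] H' K by blast
  then have ne: "U \<inter> V \<noteq> {}" using H(1) K(1) by blast
  have cl: "closedin (Sub G) (U \<inter> V)" using URS_D(1)[OF U] URS_D(1)[OF V] by (rule closedin_Int)
  have iv: "conjugate_invariant (U \<inter> V)" using inv by (auto simp: conjugate_invariant_def)
  have "U \<inter> V = U" by (rule URS_D(4)[OF U cl ne iv]) auto
  moreover have "U \<inter> V = V" by (rule URS_D(4)[OF V cl ne iv]) auto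
  ultimately show ?thesis by simp
qed

end

section \<open>Stabilizers at regular points\<close>

context compact_action
begin

definition stab_in :: "'a set \<Rightarrow> 'x \<Rightarrow> 'a set" where
  "stab_in R x = {g \<in> R. \<phi> g x = x}"

text \<open>
  At a regular point the set of elements of \<open>R\<close> that fix it is locally constant on each finite part
  of \<open>R\<close>; in other words, the stabilizer map is continuous there.
\<close>

definition regular_point :: "'a set \<Rightarrow> 'x \<Rightarrow> bool" where
  "regular_point R x \<longleftrightarrow> x \<in> topspace X \<and>
     (\<forall>g\<in>R. \<phi> g x = x \<longrightarrow> (\<exists>U. openin X U \<and> x \<in> U \<and> (\<forall>y\<in>U. \<phi> g y = y)))"

lemma open_moved:
  assumes g: "g \<in> carrier G"
  shows "openin X {x \<in> topspace X. \<phi> g x \<noteq> x}"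
proof -
  have "closedin X {x \<in> topspace X. \<phi> g x = id x}"
    using Hausdorff continuous[OF g] continuous_map_id by (rule closedin_continuous_maps_eq)
  then have "openin X (topspace X - {x \<in> topspace X. \<phi> g x = x})" by auto
  then show ?thesis by (rule back_subst[of "openin X"]) auto
qed

text \<open>
  For each \<open>g\<close> the frontier of the fixed point set of \<open>g\<close> is closed and nowhere dense; by Baire's theorem
  countably many such sets do not cover the space.
\<close>

lemma regular_point_exists:
  assumes R: "countable R" "R \<subseteq> carrier G"
  shows "\<exists>x. regular_point R x"
proof -
  define Fx where "Fx g = {x \<in> topspace X. \<phi> g x = x}" for g
  have cl: "closedin X (Fx g)" if "g \<in> R" for g
  proof -
    have "closedin X (topspace X - {x \<in> topspace X. \<phi> g x \<noteq> x})"
      using open_moved[of g] R(2) that by blast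
    then show ?thesis by (rule back_subst[of "closedin X"]) (auto simp: Fx_def)
  qed
  have "X interior_of (\<Union>g\<in>R. Fx g - X interior_of (Fx g)) = {}"
  proof (rule Baire_category_alt)
    show "completely_metrizable_space X \<or> locally_compact_space X \<and> regular_space X"
      using compact Hausdorff compact_Hausdorff_imp_regular_space compact_imp_locally_compact_space by blast
    show "countable ((\<lambda>g. Fx g - X interior_of (Fx g)) ` R)" using R(1) by simp
    fix T assume "T \<in> (\<lambda>g. Fx g - X interior_of (Fx g)) ` R"
    then obtain g where g: "g \<in> R" "T = Fx g - X interior_of (Fx g)" by blast
    have "X interior_of T \<subseteq> X interior_of (Fx g)" unfolding g(2) by (rule interior_of_mono) auto
    moreover have "X interior_of T \<subseteq> T" by (rule interior_of_subset)
    ultimately have "X interior_of T = {}" using g(2) by blast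
    then show "closedin X T \<and> X interior_of T = {}"
      using closedin_diff[OF cl[OF g(1)] openin_interior_of] g(2) by blast
  qed
  then have "topspace X - (\<Union>g\<in>R. Fx g - X interior_of (Fx g)) \<noteq> {}"
    using nonempty interior_of_topspace
    by (metis (no_types, lifting) Diff_eq_empty_iff bot.extremum_uniqueI interior_of_mono)
  then obtain x where x: "x \<in> topspace X" "\<And>g. g \<in> R \<Longrightarrow> x \<in> Fx g \<Longrightarrow> x \<in> X interior_of (Fx g)" by blast
  have "regular_point R x"
    unfolding regular_point_def
  proof (intro conjI ballI impI)
    fix g assume g: "g \<in> R" "\<phi> g x = x"
    then have "x \<in> X interior_of (Fx g)" using x by (simp add: Fx_def)
    moreover have "\<forall>y\<in>X interior_of (Fx g). \<phi> g y = y"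
      using interior_of_subset[of X "Fx g"] by (auto simp: Fx_def)
    ultimately show "\<exists>U. openin X U \<and> x \<in> U \<and> (\<forall>y\<in>U. \<phi> g y = y)"
      by (intro exI[of _ "X interior_of (Fx g)"]) simp
  qed (rule x(1))
  then show ?thesis by blast
qed

lemma subgroup_stab_in:
  assumes R: "subgroup R G" and x: "x \<in> topspace X"
  shows "subgroup (stab_in R x) G"
proof (rule subgroupI)
  interpret R: subgroup R G by fact
  show "stab_in R x \<subseteq> carrier G" using R.subset by (auto simp: stab_in_def)
  have "\<one> \<in> stab_in R x" using act_one[OF x] by (simp add: stab_in_def)
  then show "stab_in R x \<noteq> {}" by blast
  show "inv a \<in> stab_in R x" if "a \<in> stab_in R x" for a
    using that act_inv(1)[of a x] x R.mem_carrier by (auto simp: stab_in_def) 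
  show "a \<otimes> b \<in> stab_in R x" if "a \<in> stab_in R x" "b \<in> stab_in R x" for a b
    using that act_mult[of a b x] x R.mem_carrier by (auto simp: stab_in_def)
qed

lemma stab_in_act:
  assumes R: "R \<lhd> G" and g: "g \<in> carrier G" and x: "x \<in> topspace X"
  shows "stab_in R (\<phi> g x) = conjugate g (stab_in R x)"
proof -
  interpret R: normal R G by fact
  have "h \<in> stab_in R (\<phi> g x) \<longleftrightarrow> h \<in> conjugate g (stab_in R x)" if h: "h \<in> carrier G" for h
  proof -
    have "h \<in> R \<longleftrightarrow> inv g \<otimes> h \<otimes> g \<in> R" using conjugate_normal[OF R g] h by (auto simp: conjugate_def)
    moreover have "\<phi> (inv g \<otimes> h \<otimes> g) x = \<phi> (inv g) (\<phi> h (\<phi> g x))"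
      using act_mult[of "inv g \<otimes> h" g x] act_mult[of "inv g" h "\<phi> g x"] act_closed[OF g x] g h x by simp
    moreover have "\<phi> (inv g) (\<phi> h (\<phi> g x)) = x \<longleftrightarrow> \<phi> h (\<phi> g x) = \<phi> g x"
      using act_inv[OF g] act_closed[OF g x] act_closed[OF h] x by metis
    ultimately show ?thesis using h by (auto simp: conjugate_def stab_in_def)
  qed
  moreover have "stab_in R (\<phi> g x) \<subseteq> carrier G" using R.subset by (auto simp: stab_in_def)
  ultimately show ?thesis using conjugate_subset[of g "stab_in R x"] by blast
qed

lemma regular_point_act:
  assumes R: "R \<lhd> G" and g: "g \<in> carrier G" and x: "regular_point R x"
  shows "regular_point R (\<phi> g x)"
  unfolding regular_point_def
proof (intro conjI ballI impI)
  interpret R: normal R G by fact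
  have xX: "x \<in> topspace X" using x by (simp add: regular_point_def)
  show "\<phi> g x \<in> topspace X" by (rule act_closed[OF g xX])
  fix h assume h: "h \<in> R" "\<phi> h (\<phi> g x) = \<phi> g x"
  have hG: "h \<in> carrier G" using R.mem_carrier h by blast
  let ?k = "inv g \<otimes> h \<otimes> g"
  have "h \<in> conjugate g (stab_in R x)" using h stab_in_act[OF R g xX] by (auto simp: stab_in_def)
  then have "?k \<in> R" "\<phi> ?k x = x" by (auto simp: conjugate_def stab_in_def)
  then obtain U where U: "openin X U" "x \<in> U" "\<And>y. y \<in> U \<Longrightarrow> \<phi> ?k y = y"
    using x unfolding regular_point_def by blast
  let ?V = "{y \<in> topspace X. \<phi> (inv g) y \<in> U}"
  have "openin X ?V" using openin_continuous_map_preimage[OF continuous U(1)] g by blast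
  moreover have "\<phi> g x \<in> ?V" using act_closed[OF g xX] act_inv(1)[OF g xX] U(2) by simp
  moreover have "\<phi> h y = y" if y: "y \<in> ?V" for y
  proof -
    have yX: "y \<in> topspace X" using y by simp
    have y': "\<phi> (inv g) y \<in> topspace X" using act_closed[OF _ yX] g by simp
    have "\<phi> ?k (\<phi> (inv g) y) = \<phi> (inv g) y" using U(3) y by simp
    then have "\<phi> (inv g) (\<phi> h (\<phi> g (\<phi> (inv g) y))) = \<phi> (inv g) y"
      using act_mult[of "inv g \<otimes> h" g "\<phi> (inv g) y"] act_mult[of "inv g" h "\<phi> g (\<phi> (inv g) y)"]
        act_closed[OF g y'] y' g hG by simp
    then have "\<phi> (inv g) (\<phi> h y) = \<phi> (inv g) y" using act_inv(2)[OF g yX] by simp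
    then show ?thesis using act_inv(2)[OF g] act_closed[OF hG yX] yX by metis
  qed
  ultimately show "\<exists>U. openin X U \<and> \<phi> g x \<in> U \<and> (\<forall>y\<in>U. \<phi> h y = y)" by blast
qed

lemma stab_in_locally_constant:
  assumes R: "R \<subseteq> carrier G" and x: "regular_point R x" and F: "finite F"
  obtains U where "openin X U" "x \<in> U" "\<And>y. y \<in> U \<Longrightarrow> stab_in R y \<inter> F = stab_in R x \<inter> F"
proof -
  have xX: "x \<in> topspace X" using x by (simp add: regular_point_def)
  have "\<exists>U. openin X U \<and> x \<in> U \<and> (\<forall>y\<in>U. \<phi> f y = y \<longleftrightarrow> \<phi> f x = x)" if f: "f \<in> R" for f
  proof (cases "\<phi> f x = x")
    case True
    then show ?thesis using x f unfolding regular_point_def by metis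
  next
    case False
    then show ?thesis using open_moved[of f] R f xX
      by (intro exI[of _ "{x \<in> topspace X. \<phi> f x \<noteq> x}"]) auto
  qed
  then obtain U where U: "\<And>f. f \<in> R \<Longrightarrow> openin X (U f)" "\<And>f. f \<in> R \<Longrightarrow> x \<in> U f"
    "\<And>f y. f \<in> R \<Longrightarrow> y \<in> U f \<Longrightarrow> \<phi> f y = y \<longleftrightarrow> \<phi> f x = x" by metis
  define W where "W = topspace X \<inter> (\<Inter>f\<in>F \<inter> R. U f)"
  show thesis
  proof (rule that[of W])
    show "openin X W"
      using U(1) F unfolding W_def by (cases "F \<inter> R = {}") (auto intro!: openin_Int openin_INT2)
    show "x \<in> W" using U(2) xX by (simp add: W_def)
    show "stab_in R y \<inter> F = stab_in R x \<inter> F" if "y \<in> W" for y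
      using U(3) that by (auto simp: W_def stab_in_def)
  qed
qed

text \<open>
  Given a finite set, take a neighbourhood of the regular point on which the stabilizers agree on this
  set. By minimality and compactness finitely many translates by elements of \<open>N\<close> cover the space, so one
  of finitely many elements of \<open>N\<close> moves a point whose stabilizer approximates \<open>K\<close> into the
  neighbourhood.
\<close>

lemma regular_recurrent:
  assumes R: "R \<lhd> G" and N: "subgroup N G"
    and min: "minimal_closed_invariant (G\<lparr>carrier := N\<rparr>) X \<phi> (topspace X)"
    and x: "regular_point R x" and K: "K \<in> Sub G closure_of (stab_in R ` topspace X)"
  shows "stab_in R x \<in> Sub G closure_of {conjugate n K | n. n \<in> N}"
proof -
  interpret R: normal R G by fact
  interpret N: subgroup N G by fact
  have xX: "x \<in> topspace X" using x by (simp add: regular_point_def)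
  have S: "stab_in R ` topspace X \<subseteq> {H. subgroup H G}"
    using subgroup_stab_in[OF R.subgroup_axioms] by auto
  have sK: "subgroup K G" using K by (simp add: in_closure_Sub[OF S])
  have S': "{conjugate n K | n. n \<in> N} \<subseteq> {H. subgroup H G}" using subgroup_conjugate[OF _ sK] N.mem_carrier by auto
  show ?thesis
    unfolding in_closure_Sub[OF S']
  proof (intro conjI allI impI)
    show "subgroup (stab_in R x) G" using subgroup_stab_in[OF R.subgroup_axioms xX] .
    fix F assume F: "finite F \<and> F \<subseteq> carrier G"
    obtain U where U: "openin X U" "x \<in> U" "\<And>y. y \<in> U \<Longrightarrow> stab_in R y \<inter> F = stab_in R x \<inter> F"
      using stab_in_locally_constant[OF R.subset x, of F] F by blast
    define W where "W n = {y \<in> topspace X. \<phi> n y \<in> U}" for n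
    have W: "openin X (W n)" if "n \<in> N" for n
      unfolding W_def using openin_continuous_map_preimage[OF continuous U(1)] N.mem_carrier[OF that] by blast
    have "topspace X - (\<Union>n\<in>N. W n) = {}"
    proof (rule ccontr)
      assume ne: "topspace X - (\<Union>n\<in>N. W n) \<noteq> {}"
      have "closedin X (topspace X - (\<Union>n\<in>N. W n))" using W by (intro closedin_diff openin_Union) auto
      moreover have "invariant_set (G\<lparr>carrier := N\<rparr>) \<phi> (topspace X - (\<Union>n\<in>N. W n))"
        unfolding invariant_set_def
      proof (intro ballI subsetI)
        fix m z assume m: "m \<in> carrier (G\<lparr>carrier := N\<rparr>)" and "z \<in> \<phi> m ` (topspace X - (\<Union>n\<in>N. W n))"
        then obtain y where y: "y \<in> topspace X" "z = \<phi> m y" "\<And>n. n \<in> N \<Longrightarrow> \<phi> n y \<notin> U"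
          by (auto simp: W_def)
        have m': "m \<in> N" "m \<in> carrier G" using m N.mem_carrier by auto
        have "\<phi> n z \<notin> U" if "n \<in> N" for n
          using y(3)[OF N.m_closed[OF that m'(1)]] act_mult[OF N.mem_carrier[OF that] m'(2) y(1)] y(2) by simp
        then show "z \<in> topspace X - (\<Union>n\<in>N. W n)" using act_closed[OF m'(2) y(1)] y(2) by (auto simp: W_def)
      qed
      ultimately have "topspace X - (\<Union>n\<in>N. W n) = topspace X"
        using min ne unfolding minimal_closed_invariant_def by blast
      moreover have "x \<in> W \<one>" using U(2) xX act_one[OF xX] by (simp add: W_def)
      ultimately show False using xX N.one_closed by blast
    qed
    then have cover: "topspace X \<subseteq> \<Union>(W ` N)" by blast
    obtain E where E: "finite E" "E \<subseteq> W ` N" "topspace X \<subseteq> \<Union>E"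
      using compact W cover unfolding compact_space_def compactin_def by (metis (no_types, lifting) imageE)
    obtain I where I: "finite I" "I \<subseteq> N" "E = W ` I" using E(1,2) by (meson finite_subset_image)
    define F' where "F' = (\<Union>n\<in>I. (\<lambda>f. inv n \<otimes> f \<otimes> n) ` F)"
    have "inv n \<otimes> f \<otimes> n \<in> carrier G" if "n \<in> I" "f \<in> F" for n f
    proof -
      have "n \<in> carrier G" "f \<in> carrier G" using N.subset I(2) F that by blast+
      then show ?thesis by simp
    qed
    then have F': "finite F'" "F' \<subseteq> carrier G"
      using I(1) F by (auto simp: F'_def)
    obtain y where y: "y \<in> topspace X" "stab_in R y \<inter> F' = K \<inter> F'"
      using closure_SubE[OF K S F'] by auto
    obtain n where n: "n \<in> I" "\<phi> n y \<in> U" using E(3) I(3) y(1) by (auto simp: W_def)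
    have nN: "n \<in> N" "n \<in> carrier G" using n(1) I(2) N.mem_carrier by auto
    have "conjugate n K \<inter> F = conjugate n (stab_in R y) \<inter> F"
    proof (rule conjugate_Int_finite[OF nN(2)])
      have "(\<lambda>f. inv n \<otimes> f \<otimes> n) ` F \<subseteq> F'" using n(1) by (auto simp: F'_def)
      then show "K \<inter> (\<lambda>f. inv n \<otimes> f \<otimes> n) ` F = stab_in R y \<inter> (\<lambda>f. inv n \<otimes> f \<otimes> n) ` F"
        using y(2) by blast
    qed (use F in auto)
    also have "\<dots> = stab_in R x \<inter> F" using stab_in_act[OF R nN(2) y(1)] U(3)[OF n(2)] by simp
    finally show "\<exists>H\<in>{conjugate n K | n. n \<in> N}. H \<inter> F = stab_in R x \<inter> F" using nN(1) by blast
  qed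
qed

definition stab_URS :: "'a set \<Rightarrow> 'x \<Rightarrow> 'a set set" where
  "stab_URS R x = Sub G closure_of {conjugate g (stab_in R x) | g. g \<in> carrier G}"

lemma stab_URS_closure:
  assumes R: "R \<lhd> G" and x: "x \<in> topspace X"
  shows "stab_URS R x \<subseteq> Sub G closure_of (stab_in R ` topspace X)"
  unfolding stab_URS_def
proof (rule closure_of_mono)
  show "{conjugate g (stab_in R x) | g. g \<in> carrier G} \<subseteq> stab_in R ` topspace X"
    using stab_in_act[OF R _ x] act_closed[OF _ x] by auto
qed

text \<open>
  Conjugates of the stabilizer of a regular point are again stabilizers of regular points, so
  recurrence applies to each of them.
\<close>

lemma stab_URS_minimal:
  assumes R: "R \<lhd> G" and N: "subgroup N G"
    and min: "minimal_closed_invariant (G\<lparr>carrier := N\<rparr>) X \<phi> (topspace X)"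
    and x: "regular_point R x" and K: "K \<in> Sub G closure_of (stab_in R ` topspace X)"
  shows "stab_URS R x \<subseteq> Sub G closure_of {conjugate n K | n. n \<in> N}"
  unfolding stab_URS_def
proof (rule closure_of_minimal)
  have xX: "x \<in> topspace X" using x by (simp add: regular_point_def)
  show "{conjugate g (stab_in R x) | g. g \<in> carrier G} \<subseteq> Sub G closure_of {conjugate n K | n. n \<in> N}"
  proof
    fix L assume "L \<in> {conjugate g (stab_in R x) | g. g \<in> carrier G}"
    then obtain g where g: "g \<in> carrier G" "L = stab_in R (\<phi> g x)"
      using stab_in_act[OF R _ xX] by auto
    then show "L \<in> Sub G closure_of {conjugate n K | n. n \<in> N}"
      using regular_recurrent[OF R N min regular_point_act[OF R g(1) x] K] by simp
  qed
qed simp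

lemma stab_URS_mem:
  assumes R: "R \<lhd> G" and x: "x \<in> topspace X"
  shows "stab_in R x \<in> stab_URS R x"
proof -
  interpret R: normal R G by fact
  have s: "subgroup (stab_in R x) G" using subgroup_stab_in[OF R.subgroup_axioms x] .
  then have "{conjugate g (stab_in R x) | g. g \<in> carrier G} \<subseteq> topspace (Sub G)"
    using subgroup_conjugate by auto
  then have "{conjugate g (stab_in R x) | g. g \<in> carrier G} \<subseteq> stab_URS R x"
    unfolding stab_URS_def by (rule closure_of_subset)
  moreover have "conjugate \<one> (stab_in R x) = stab_in R x" using conjugate_one subgroup.subset[OF s] by blast
  ultimately show ?thesis using one_closed by blast
qed

lemma conjugate_orbit_closure_subset:
  assumes B: "closedin (Sub G) B" "conjugate_invariant B" and K: "K \<in> B"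
  shows "Sub G closure_of {conjugate g K | g. g \<in> carrier G} \<subseteq> B"
  by (rule closure_of_minimal) (use B K in \<open>auto simp: conjugate_invariant_def\<close>)

lemma stab_URS_is_URS:
  assumes R: "R \<lhd> G" and min: "minimal_closed_invariant G X \<phi> (topspace X)" and x: "regular_point R x"
  shows "URS G (stab_URS R x)"
  unfolding URS_iff
proof (intro conjI allI impI)
  interpret R: normal R G by fact
  have xX: "x \<in> topspace X" using x by (simp add: regular_point_def)
  have s: "subgroup (stab_in R x) G" using subgroup_stab_in[OF R.subgroup_axioms xX] .
  show "closedin (Sub G) (stab_URS R x)" by (simp add: stab_URS_def)
  show "stab_URS R x \<noteq> {}" using stab_URS_mem[OF R xX] by blast
  show "conjugate_invariant (stab_URS R x)"
    unfolding stab_URS_def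
  proof (rule conjugate_invariant_closure)
    show "{conjugate g (stab_in R x) | g. g \<in> carrier G} \<subseteq> {H. subgroup H G}" using subgroup_conjugate s by auto
    show "conjugate_invariant {conjugate g (stab_in R x) | g. g \<in> carrier G}"
      unfolding conjugate_invariant_def using conjugate_mult m_closed by (auto, metis)
  qed
  fix B assume B: "closedin (Sub G) B \<and> B \<noteq> {} \<and> conjugate_invariant B \<and> B \<subseteq> stab_URS R x"
  then obtain K where K: "K \<in> B" by blast
  then have "K \<in> Sub G closure_of (stab_in R ` topspace X)" using B stab_URS_closure[OF R xX] by blast
  then have "stab_URS R x \<subseteq> Sub G closure_of {conjugate n K | n. n \<in> carrier G}"
    using stab_URS_minimal[OF R subgroup_self _ x] min by simp
  also have "\<dots> \<subseteq> B" using B K by (intro conjugate_orbit_closure_subset) auto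
  finally show "B = stab_URS R x" using B by blast
qed

text \<open>
  By recurrence every URS in the closure of the set of stabilizers contains the stabilizer of each
  regular point. So there is exactly one such URS as soon as there is a regular point.
\<close>

lemma stabilizer_URS_eq:
  assumes min: "minimal_closed_invariant G X \<phi> (topspace X)" and x: "regular_point (carrier G) x"
  shows "stabilizer_URS G X \<phi> = stab_URS (carrier G) x"
proof -
  have st: "stabilizer G \<phi> = stab_in (carrier G)"
    by (auto simp: stabilizer_def stab_in_def fun_eq_iff)
  have R: "carrier G \<lhd> G" by (rule carrier_normal)
  have xX: "x \<in> topspace X" using x by (simp add: regular_point_def)
  show ?thesis
    unfolding stabilizer_URS_def st
  proof (rule the_equality)
    show "URS G (stab_URS (carrier G) x) \<and> stab_URS (carrier G) x \<subseteq> Sub G closure_of stab_in (carrier G) ` topspace X"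
      using stab_URS_is_URS[OF R min x] stab_URS_closure[OF R xX] by blast
    fix U assume U: "URS G U \<and> U \<subseteq> Sub G closure_of stab_in (carrier G) ` topspace X"
    then obtain K where K: "K \<in> U" using URS_D(2) by blast
    then have "stab_URS (carrier G) x \<subseteq> Sub G closure_of {conjugate n K | n. n \<in> carrier G}"
      using stab_URS_minimal[OF R subgroup_self _ x] min U by auto
    also have "\<dots> \<subseteq> U" using U K by (intro conjugate_orbit_closure_subset) (auto simp: URS_iff)
    finally have sub: "stab_URS (carrier G) x \<subseteq> U" .
    have "URS G (stab_URS (carrier G) x)" using stab_URS_is_URS[OF R min x] .
    then have "stab_URS (carrier G) x = U"
      using sub U unfolding URS_iff by blast
    then show "U = stab_URS (carrier G) x" by simp
  qed
qed

text \<open>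
  The points whose stabilizer contains a member of \<open>S\<close> form a closed invariant set, because a finite set
  of group elements that move a given point also moves all nearby points.
\<close>

lemma subgroup_below_stabilizers:
  assumes min: "minimal_closed_invariant G X \<phi> (topspace X)"
    and S: "closedin (Sub G) S" "conjugate_invariant S"
    and K0: "K0 \<in> S" "K0 \<subseteq> stab_in (carrier G) x0" and x0: "x0 \<in> topspace X" and x: "x \<in> topspace X"
  shows "\<exists>K\<in>S. K \<subseteq> stab_in (carrier G) x"
proof -
  have R: "carrier G \<lhd> G" by (rule carrier_normal)
  define W where "W = {x \<in> topspace X. \<exists>K\<in>S. K \<subseteq> stab_in (carrier G) x}"
  have WX: "W \<subseteq> topspace X" by (auto simp: W_def)
  have "X closure_of W \<subseteq> W"
  proof
    fix y assume y: "y \<in> X closure_of W"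
    then have yX: "y \<in> topspace X" by (simp add: in_closure_of)
    have "\<exists>K\<in>S. K \<subseteq> stab_in (carrier G) y"
    proof (rule subgroup_below_set[OF S(1)])
      fix F assume F: "finite F" "F \<subseteq> carrier G - stab_in (carrier G) y"
      define U where "U = topspace X \<inter> (\<Inter>f\<in>F. {z \<in> topspace X. \<phi> f z \<noteq> z})"
      have "openin X U"
        using F open_moved unfolding U_def by (cases "F = {}") (auto intro!: openin_Int openin_INT2)
      moreover have "y \<in> U" using F(2) yX by (auto simp: U_def stab_in_def)
      ultimately obtain z where "z \<in> W" "z \<in> U" using y unfolding in_closure_of by blast
      then obtain K where K: "K \<in> S" "K \<subseteq> stab_in (carrier G) z" by (auto simp: W_def)
      have "K \<inter> F = {}" using K(2) \<open>z \<in> U\<close> by (auto simp: U_def stab_in_def)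
      then show "\<exists>K\<in>S. K \<inter> F = {}" using K(1) by blast
    qed
    then show "y \<in> W" using yX by (simp add: W_def)
  qed
  with WX have "closedin X W" by (intro closure_of_subset_eq[THEN iffD1] conjI)
  moreover have "W \<noteq> {}" using K0 x0 by (auto simp: W_def)
  moreover have "invariant_set G \<phi> W"
    unfolding invariant_set_def
  proof (intro ballI subsetI)
    fix g z assume g: "g \<in> carrier G" and "z \<in> \<phi> g ` W"
    then obtain y K where y: "y \<in> topspace X" "z = \<phi> g y" "K \<in> S" "K \<subseteq> stab_in (carrier G) y"
      by (auto simp: W_def)
    have "conjugate g K \<subseteq> stab_in (carrier G) z" using conjugate_mono[OF y(4)] stab_in_act[OF R g y(1)] y(2) by simp
    moreover have "conjugate g K \<in> S" using S(2) g y(3) by (simp add: conjugate_invariant_def)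
    ultimately show "z \<in> W" using act_closed[OF g y(1)] y(2) by (auto simp: W_def)
  qed
  ultimately have "W = topspace X" using min WX unfolding minimal_closed_invariant_def by blast
  then show ?thesis using x by (auto simp: W_def)
qed

end

section \<open>The Furstenberg URS modulo a normal subgroup\<close>

lemma (in compact_action) kernel_normal: "{g \<in> carrier G. \<forall>x\<in>topspace X. \<phi> g x = x} \<lhd> G"
  unfolding normal_inv_iff
proof (intro conjI ballI)
  show "subgroup {g \<in> carrier G. \<forall>x\<in>topspace X. \<phi> g x = x} G"
  proof (rule subgroupI)
    have "\<one> \<in> {g \<in> carrier G. \<forall>x\<in>topspace X. \<phi> g x = x}" using act_one by simp
    then show "{g \<in> carrier G. \<forall>x\<in>topspace X. \<phi> g x = x} \<noteq> {}" by blast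
    show "inv a \<in> {g \<in> carrier G. \<forall>x\<in>topspace X. \<phi> g x = x}"
      if "a \<in> {g \<in> carrier G. \<forall>x\<in>topspace X. \<phi> g x = x}" for a
      using that act_inv(1)[of a] by auto
  qed (use act_mult in auto)
  fix g h assume g: "g \<in> carrier G" and h: "h \<in> {g \<in> carrier G. \<forall>x\<in>topspace X. \<phi> g x = x}"
  have "\<phi> (g \<otimes> h \<otimes> inv g) x = x" if x: "x \<in> topspace X" for x
  proof -
    have x': "\<phi> (inv g) x \<in> topspace X" using act_closed[OF _ x] g by simp
    have "\<phi> (g \<otimes> h \<otimes> inv g) x = \<phi> g (\<phi> h (\<phi> (inv g) x))"
      using act_mult[of "g \<otimes> h" "inv g" x] act_mult[of g h "\<phi> (inv g) x"] x x' g h by simp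
    also have "\<dots> = x" using h x' act_inv(2)[OF g x] by simp
    finally show ?thesis .
  qed
  then show "g \<otimes> h \<otimes> inv g \<in> {g \<in> carrier G. \<forall>x\<in>topspace X. \<phi> g x = x}" using g h by simp
qed

lemma compact_G_space_pullback:
  fixes G (structure)
  assumes N: "N \<lhd> G" and Y: "compact_G_space (G Mod N) Y \<psi>"
  shows "compact_G_space G Y (\<lambda>g. \<psi> (N #> g))"
proof -
  interpret N: normal N G by (rule N)
  interpret Y: compact_action "G Mod N" Y \<psi> by unfold_locales (rule Y)
  have car: "N #> g \<in> carrier (G Mod N)" if "g \<in> carrier G" for g
    using that by (auto simp: FactGroup_def RCOSETS_def)
  show ?thesis
  proof (rule compact_G_spaceI[OF Y.compact Y.Hausdorff Y.nonempty])
    show "continuous_map Y Y (\<psi> (N #> g))" if "g \<in> carrier G" for g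
      by (rule Y.continuous[OF car[OF that]])
    show "group_action G (topspace Y) (\<lambda>g. \<psi> (N #> g))"
    proof (rule group_actionI[OF N.is_group])
      show "\<psi> (N #> g) y \<in> topspace Y" if "g \<in> carrier G" "y \<in> topspace Y" for g y
        by (rule Y.act_closed[OF car[OF that(1)] that(2)])
      show "\<psi> (N #> g) \<in> extensional (topspace Y)" if "g \<in> carrier G" for g
        by (rule Y.act_ext[OF car[OF that]])
      show "\<psi> (N #> \<one>) y = y" if "y \<in> topspace Y" for y
      proof -
        have "\<one>\<^bsub>G Mod N\<^esub> = N #> \<one>" using N.subset by (simp add: FactGroup_def N.coset_mult_one)
        then show ?thesis using Y.act_one[OF that] by simp
      qed
      show "\<psi> (N #> (g \<otimes> h)) y = \<psi> (N #> g) (\<psi> (N #> h) y)"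
        if "g \<in> carrier G" "h \<in> carrier G" "y \<in> topspace Y" for g h y
      proof -
        have "(N #> g) \<otimes>\<^bsub>G Mod N\<^esub> (N #> h) = N #> (g \<otimes> h)"
          using N.rcos_sum[OF that(1,2)] by (simp add: FactGroup_def)
        then show ?thesis using Y.act_mult[OF car[OF that(1)] car[OF that(2)] that(3)] by simp
      qed
    qed
  qed
qed

lemma is_furstenberg_boundary_cong:
  assumes Z: "is_furstenberg_boundary H Z \<zeta>" and \<tau>: "compact_G_space H Z \<tau>"
    and eq: "\<And>n. n \<in> carrier H \<Longrightarrow> \<tau> n = \<zeta> n"
  shows "is_furstenberg_boundary H Z \<tau>"
proof -
  have "G_boundary H Z \<tau>"
    using Z by (intro G_boundary_more_maps[OF _ \<tau>]) (auto simp: is_furstenberg_boundary_def eq image_iff)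
  moreover have "equivariant_quotient H Z \<tau> Y \<psi> f" if "equivariant_quotient H Z \<zeta> Y \<psi> f"
    for Y :: "'a set set topology" and \<psi> f
    using that eq by (simp add: equivariant_quotient_def)
  ultimately show ?thesis using Z unfolding is_furstenberg_boundary_def by blast
qed

text \<open>
  Let \<open>x\<close> be such that translates of \<open>\<nu>\<close> tend to the Dirac state at \<open>x\<close>. The translate of \<open>\<nu>\<close> by \<open>g\<close> is
  invariant under \<open>g L g\<^bsup>-1\<^esup>\<close>. If \<open>f\<close> moves \<open>x\<close>, then a test function that separates \<open>x\<close> from its image
  shows that translates of \<open>\<nu>\<close> close to \<open>x\<close> are not invariant under \<open>f\<close>, so \<open>f\<close> is not in
  \<open>g L g\<^bsup>-1\<^esup>\<close>.
\<close>

lemma (in compact_action) stabilizers_limit_in_stabilizer: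
  assumes sp: "strongly_proximal G X \<phi>" and \<nu>: "\<nu> \<in> states (topspace X) (Cont X)"
    and L: "subgroup L G" "\<And>l k. l \<in> L \<Longrightarrow> \<nu> (\<lambda>x. k (\<phi> l x)) = \<nu> k"
    and V: "closedin (Sub G) V" "\<And>g. g \<in> carrier G \<Longrightarrow> conjugate g L \<in> V"
  shows "\<exists>x\<in>topspace X. \<exists>K\<in>V. K \<subseteq> stab_in (carrier G) x"
proof -
  interpret L: subgroup L G by (rule L(1))
  obtain x where x: "x \<in> topspace X"
    "dirac (Cont X) x \<in> euclidean closure_of {(\<lambda>f. \<nu> (\<lambda>y. f (\<phi> g y))) | g. g \<in> carrier G}"
    using strongly_proximal_state[OF sp \<nu>] by blast
  have "\<exists>K\<in>V. K \<subseteq> stab_in (carrier G) x"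
  proof (rule subgroup_below_set[OF V(1)])
    fix E assume E: "finite E" "E \<subseteq> carrier G - stab_in (carrier G) x"
    have "\<exists>k. k \<in> Cont X \<and> k x = 0 \<and> k (\<phi> f x) = 1" if f: "f \<in> E" for f
    proof -
      have "f \<in> carrier G" "x \<noteq> \<phi> f x" using E f by (auto simp: stab_in_def)
      then show ?thesis using separate_points[OF x(1) act_closed[OF _ x(1)], of f] by metis
    qed
    then obtain k where k: "\<And>f. f \<in> E \<Longrightarrow> k f \<in> Cont X" "\<And>f. f \<in> E \<Longrightarrow> k f x = 0"
      "\<And>f. f \<in> E \<Longrightarrow> k f (\<phi> f x) = 1" by metis
    define J where "J = k ` E \<union> (\<lambda>f. \<lambda>y. k f (\<phi> f y)) ` E"
    have "finite J \<and> (0::real) < 1/2" using E(1) by (simp add: J_def)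
    then have "\<exists>y\<in>{(\<lambda>f. \<nu> (\<lambda>y. f (\<phi> g y))) | g. g \<in> carrier G}. \<forall>i\<in>J. \<bar>y i - dirac (Cont X) x i\<bar> < 1/2"
      using x(2)[unfolded in_closure_fun, rule_format, of J "1/2"] by simp
    then obtain g where g: "g \<in> carrier G" "\<And>i. i \<in> J \<Longrightarrow> \<bar>\<nu> (\<lambda>y. i (\<phi> g y)) - dirac (Cont X) x i\<bar> < 1/2"
      by auto
    have "f \<notin> conjugate g L" if f: "f \<in> E" for f
    proof
      assume fL: "f \<in> conjugate g L"
      have fG: "f \<in> carrier G" using E f by auto
      let ?l = "inv g \<otimes> f \<otimes> g"
      have l: "?l \<in> L" using fL by (simp add: conjugate_def)
      have "\<nu> (\<lambda>y. k f (\<phi> f (\<phi> g y))) = \<nu> (\<lambda>y. k f (\<phi> g (\<phi> ?l y)))"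
      proof (rule C.state_cong[OF \<nu>])
        fix y assume y: "y \<in> topspace X"
        have "g \<otimes> ?l = f \<otimes> g" using g(1) fG by (simp add: m_assoc[symmetric])
        then show "k f (\<phi> f (\<phi> g y)) = k f (\<phi> g (\<phi> ?l y))"
          using act_mult[OF fG g(1) y] act_mult[OF g(1) L.mem_carrier[OF l] y] by simp
      qed
      also have "\<dots> = \<nu> (\<lambda>y. k f (\<phi> g y))" using L(2)[OF l, of "\<lambda>y. k f (\<phi> g y)"] by simp
      finally have eq: "\<nu> (\<lambda>y. k f (\<phi> f (\<phi> g y))) = \<nu> (\<lambda>y. k f (\<phi> g y))" .
      have "\<bar>\<nu> (\<lambda>y. k f (\<phi> g y)) - 0\<bar> < 1/2"
        using g(2)[of "k f"] f k(1,2)[OF f] by (simp add: J_def dirac_def)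
      moreover have "\<bar>\<nu> (\<lambda>y. k f (\<phi> f (\<phi> g y))) - 1\<bar> < 1/2"
        using g(2)[of "\<lambda>y. k f (\<phi> f y)"] f k(3)[OF f] Cont_act[OF fG k(1)[OF f]]
        by (simp add: J_def dirac_def)
      ultimately show False using eq by linarith
    qed
    then show "\<exists>K\<in>V. K \<inter> E = {}" using V(2)[OF g(1)] by blast
  qed
  then show ?thesis using x(1) by blast
qed

text \<open>
  If the Furstenberg URS is a singleton, the stabilizer \<open>S\<close> of a regular point belongs to it together with
  all conjugates of \<open>S\<close>, so \<open>S\<close> is normal. Its fixed points form a non-empty closed invariant set,
  hence \<open>S\<close> acts trivially.
\<close>

lemma normal_F_kernel:
  fixes G (structure)
  assumes "countable (carrier G)" and N: "N \<lhd> G" and F: "class_F (G Mod N)"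
    and Y: "furstenberg_boundary (G Mod N) = (Y, \<psi>)" "is_furstenberg_boundary (G Mod N) Y \<psi>"
  shows "\<exists>y0\<in>topspace Y. \<forall>g\<in>carrier G. \<psi> (N #> g) y0 = y0 \<longrightarrow> (\<forall>y\<in>topspace Y. \<psi> (N #> g) y = y)"
proof -
  have bY: "G_boundary (G Mod N) Y \<psi>" using Y(2) by (simp add: is_furstenberg_boundary_def)
  interpret Y: compact_action "G Mod N" Y \<psi> using G_boundaryD[OF bY] by simp
  let ?Q = "G Mod N"
  note minY = G_boundaryD(3)[OF bY]
  have car: "N #> g \<in> carrier ?Q" if "g \<in> carrier G" for g
    using that by (auto simp: FactGroup_def RCOSETS_def)
  have "carrier ?Q \<subseteq> (\<lambda>g. N #> g) ` carrier G" by (auto simp: FactGroup_def RCOSETS_def)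
  then have "countable (carrier ?Q)" using assms(1) by (meson countable_image countable_subset)
  then obtain y0 where y0: "Y.regular_point (carrier ?Q) y0" using Y.regular_point_exists by blast
  then have y0Y: "y0 \<in> topspace Y" by (simp add: Y.regular_point_def)
  define S where "S = Y.stab_in (carrier ?Q) y0"
  have U: "furstenberg_URS ?Q = Y.stab_URS (carrier ?Q) y0"
    using Y.stabilizer_URS_eq[OF minY y0] by (simp add: furstenberg_URS_def Y(1))
  have SU: "S \<in> furstenberg_URS ?Q" unfolding U S_def by (rule Y.stab_URS_mem[OF Y.carrier_normal y0Y])
  have URSU: "URS ?Q (furstenberg_URS ?Q)"
    unfolding U by (rule Y.stab_URS_is_URS[OF Y.carrier_normal minY y0])
  have cjS: "Y.conjugate C S = S" if "C \<in> carrier ?Q" for C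
  proof -
    have "Y.conjugate C S \<in> furstenberg_URS ?Q" by (rule Y.URS_D(3)[OF URSU that SU])
    then show ?thesis using SU F unfolding class_F_def is_singleton_def by auto
  qed
  define W where "W = {y \<in> topspace Y. S \<subseteq> Y.stab_in (carrier ?Q) y}"
  have SQ: "S \<subseteq> carrier ?Q" by (auto simp: S_def Y.stab_in_def)
  have "closedin Y W"
  proof -
    have "W = topspace Y - (\<Union>s\<in>S. {y \<in> topspace Y. \<psi> s y \<noteq> y})"
      using SQ by (auto simp: W_def Y.stab_in_def)
    also have "closedin Y \<dots>" using SQ Y.open_moved by (intro closedin_diff openin_Union) auto
    finally show ?thesis .
  qed
  moreover have "W \<noteq> {}" using y0Y by (auto simp: W_def S_def)
  moreover have "invariant_set ?Q \<psi> W"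
    unfolding invariant_set_def
  proof (intro ballI subsetI)
    fix C z assume C: "C \<in> carrier ?Q" and "z \<in> \<psi> C ` W"
    then obtain y where y: "y \<in> topspace Y" "S \<subseteq> Y.stab_in (carrier ?Q) y" "z = \<psi> C y" by (auto simp: W_def)
    have "Y.conjugate C S \<subseteq> Y.stab_in (carrier ?Q) z"
      unfolding y(3) Y.stab_in_act[OF Y.carrier_normal C y(1)] by (rule Y.conjugate_mono[OF y(2)])
    then show "z \<in> W" using cjS[OF C] Y.act_closed[OF C y(1)] y(3) by (simp add: W_def)
  qed
  moreover have "W \<subseteq> topspace Y" by (auto simp: W_def)
  ultimately have WY: "W = topspace Y" using minY unfolding minimal_closed_invariant_def by blast
  have "\<psi> (N #> g) y = y" if "g \<in> carrier G" "\<psi> (N #> g) y0 = y0" "y \<in> topspace Y" for g y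
  proof -
    have "N #> g \<in> S" using car[OF that(1)] that(2) by (simp add: S_def Y.stab_in_def)
    moreover have "y \<in> W" using WY that(3) by simp
    ultimately show ?thesis by (auto simp: W_def Y.stab_in_def)
  qed
  then show ?thesis using y0Y by blast
qed

text \<open>
  The notation \<open>X\<close>, \<open>Y\<close>, \<open>Z\<close>, \<open>R\<close>, \<open>V\<close> is that of the introduction, and \<open>U\<close> is the Furstenberg URS
  of \<open>G\<close>. The inclusion is an equality, as the two subgroups can be exchanged.
\<close>

theorem furstenberg_URS_product_constant:
  fixes G (structure)
  assumes G: "group G" and cG: "countable (carrier G)" and NF: "N \<in> normal_F G"
    and H: "H \<in> furstenberg_URS G" and H1: "H1 \<in> furstenberg_URS G"
  shows "H1 <#> N \<subseteq> H <#> N"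
proof -
  have N: "N \<lhd> G" and FQ: "class_F (G Mod N)" using NF by (auto simp: normal_F_def)
  interpret G: group G by (rule G)
  interpret N: normal N G by (rule N)
  let ?N = "G\<lparr>carrier := N\<rparr>"
  obtain X \<phi> where X: "furstenberg_boundary G = (X, \<phi>)" by (cases "furstenberg_boundary G")
  have fX: "is_furstenberg_boundary G X \<phi>" using furstenberg_boundary_exists[OF G] by (simp add: X)
  then have bX: "G_boundary G X \<phi>" by (simp add: is_furstenberg_boundary_def)
  interpret X: compact_action G X \<phi> using G_boundaryD[OF bX] by simp
  note minX = G_boundaryD(3)[OF bX]
  obtain Y \<psi> where Y: "furstenberg_boundary (G Mod N) = (Y, \<psi>)" by (cases "furstenberg_boundary (G Mod N)")
  have fY: "is_furstenberg_boundary (G Mod N) Y \<psi>"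
    using furstenberg_boundary_exists[OF N.factorgroup_is_group] by (simp add: Y)
  then have bY: "G_boundary (G Mod N) Y \<psi>" by (simp add: is_furstenberg_boundary_def)
  obtain Z \<zeta> where Z: "furstenberg_boundary ?N = (Z, \<zeta>)" by (cases "furstenberg_boundary ?N")
  have fZ0: "is_furstenberg_boundary ?N Z \<zeta>"
    using furstenberg_boundary_exists[OF N.subgroup_is_group[OF G]] by (simp add: Z)
  obtain \<tau> where \<tau>: "compact_G_space G Z \<tau>" "\<And>n. n \<in> N \<Longrightarrow> \<tau> n = \<zeta> n"
    using normal_boundary_extends[OF N fZ0] by blast
  interpret Z: compact_action G Z \<tau> by unfold_locales (rule \<tau>(1))
  have fZ: "is_furstenberg_boundary ?N Z \<tau>"
    using is_furstenberg_boundary_cong[OF fZ0 compact_G_space_subgroup[OF \<tau>(1) N.subgroup_axioms]] \<tau>(2)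
    by simp
  then have bNZ: "G_boundary ?N Z \<tau>" by (simp add: is_furstenberg_boundary_def)
  have bZ: "G_boundary G Z \<tau>"
    using N.subset by (intro G_boundary_more_maps[OF bNZ \<tau>(1)]) auto
  define \<rho> where "\<rho> g = \<psi> (N #> g)" for g
  have cY: "compact_G_space G Y \<rho>"
    using compact_G_space_pullback[OF N] bY
    unfolding \<rho>_def G_boundary_def minimal_compact_G_space_def by blast
  have bGY: "G_boundary G Y \<rho>"
    by (rule G_boundary_more_maps[OF bY cY]) (auto simp: \<rho>_def FactGroup_def RCOSETS_def)
  interpret Y: compact_action G Y \<rho> by unfold_locales (rule cY)
  define R where "R = {g \<in> carrier G. \<forall>y\<in>topspace Y. \<rho> g y = y}"
  have R: "R \<lhd> G" unfolding R_def by (rule Y.kernel_normal)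
  interpret R: normal R G by (rule R)
  obtain y0 where y0: "y0 \<in> topspace Y" "\<And>g. g \<in> carrier G \<Longrightarrow> \<rho> g y0 = y0 \<Longrightarrow> g \<in> R"
  proof -
    have "\<exists>y0\<in>topspace Y. \<forall>g\<in>carrier G. \<rho> g y0 = y0 \<longrightarrow> (\<forall>y\<in>topspace Y. \<rho> g y = y)"
      unfolding \<rho>_def by (rule normal_F_kernel[OF cG N FQ Y fY])
    then obtain y0 where y0: "y0 \<in> topspace Y"
      "\<forall>g\<in>carrier G. \<rho> g y0 = y0 \<longrightarrow> (\<forall>y\<in>topspace Y. \<rho> g y = y)" ..
    have y0R: "g \<in> R" if g: "g \<in> carrier G" "\<rho> g y0 = y0" for g
    proof -
      have "\<forall>y\<in>topspace Y. \<rho> g y = y" by (rule y0(2)[THEN bspec, OF g(1), THEN mp, OF g(2)])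
      then show ?thesis unfolding R_def using g(1) by (simp only: mem_Collect_eq simp_thms)
    qed
    show thesis by (rule that[OF y0(1) y0R])
  qed
  define U where "U = furstenberg_URS G"
  obtain x0 where x0: "X.regular_point (carrier G) x0" using X.regular_point_exists[OF cG] by blast
  then have x0X: "x0 \<in> topspace X" by (simp add: X.regular_point_def)
  have Ueq: "U = X.stab_URS (carrier G) x0"
    using X.stabilizer_URS_eq[OF minX x0] by (simp add: U_def furstenberg_URS_def X)
  have URSU: "URS G U" unfolding Ueq by (rule X.stab_URS_is_URS[OF G.carrier_normal minX x0])
  have cjU: "G.conjugate_invariant U" using URSU by (simp add: G.URS_iff)
  have H0U: "X.stab_in (carrier G) x0 \<in> U" unfolding Ueq by (rule X.stab_URS_mem[OF G.carrier_normal x0X])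
  have U_below: "\<exists>K\<in>U. K \<subseteq> X.stab_in (carrier G) x" if "x \<in> topspace X" for x
    by (rule X.subgroup_below_stabilizers[OF minX G.URS_D(1)[OF URSU] cjU H0U order_refl x0X that])
  (* A point x of X over y0 has its stabilizer inside R, and this stabilizer contains a member of U. *)
  have UR: "K \<subseteq> R" if "K \<in> U" for K
  proof -
    obtain \<pi> where \<pi>: "equivariant_quotient G X \<phi> Y \<rho> \<pi>"
      using furstenberg_boundary_universal[OF fX bGY] by blast
    have "y0 \<in> \<pi> ` topspace X" using \<pi> y0(1) by (simp add: equivariant_quotient_def)
    then obtain x where x: "x \<in> topspace X" "\<pi> x = y0" by blast
    obtain K0 where K0: "K0 \<in> U" "K0 \<subseteq> X.stab_in (carrier G) x" using U_below[OF x(1)] by blast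
    have K0R: "K0 \<subseteq> R"
    proof
      fix g assume "g \<in> K0"
      then have g: "g \<in> carrier G" "\<phi> g x = x" using K0(2) by (auto simp: X.stab_in_def)
      then have "\<rho> g y0 = y0" using \<pi> x unfolding equivariant_quotient_def by metis
      then show "g \<in> R" by (rule y0(2)[OF g(1)])
    qed
    define W where "W = {H \<in> U. H \<subseteq> R}"
    have sW: "W \<subseteq> {H. subgroup H G}" using G.URS_D(5)[OF URSU] by (auto simp: W_def)
    have "W = U"
    proof (rule G.URS_D(4)[OF URSU])
      show "W \<noteq> {}" using K0 K0R by (auto simp: W_def)
      show "G.conjugate_invariant W"
        unfolding G.conjugate_invariant_def
      proof (intro ballI)
        fix g K assume g: "g \<in> carrier G" and K: "K \<in> W"
        have "G.conjugate g K \<subseteq> G.conjugate g R" using K by (intro G.conjugate_mono) (simp add: W_def)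
        then show "G.conjugate g K \<in> W"
          using G.conjugate_normal[OF R g] G.URS_D(3)[OF URSU g] K by (simp add: W_def)
      qed
      have "Sub G closure_of W \<subseteq> W"
      proof
        fix K assume K: "K \<in> Sub G closure_of W"
        have "W \<subseteq> U" by (auto simp: W_def)
        then have KU: "K \<in> U" using K closure_of_minimal[OF _ G.URS_D(1)[OF URSU]] by blast
        have "k \<in> R" if k: "k \<in> K" for k
        proof -
          have "{k} \<subseteq> carrier G" using subgroup.mem_carrier[OF G.URS_D(5)[OF URSU KU] k] by simp
          then obtain H where "H \<in> W" "H \<inter> {k} = K \<inter> {k}" using closure_SubE[OF K sW, of "{k}"] by blast
          then show ?thesis using k by (auto simp: W_def)
        qed
        then show "K \<in> W" using KU by (auto simp: W_def)
      qed
      with sW show "closedin (Sub G) W"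
        by (intro closure_of_subset_eq[THEN iffD1] conjI) simp_all
    qed (auto simp: W_def)
    then show ?thesis using that by (auto simp: W_def)
  qed
  have cR: "countable R" using cG R.subset by (rule countable_subset[rotated])
  obtain z0 where z0: "Z.regular_point R z0" using Z.regular_point_exists[OF cR R.subset] by blast
  then have z0Z: "z0 \<in> topspace Z" by (simp add: Z.regular_point_def)
  define V where "V = Z.stab_URS R z0"
  have URSV: "URS G V" unfolding V_def by (rule Z.stab_URS_is_URS[OF R G_boundaryD(3)[OF bZ] z0])
  have cjV: "G.conjugate_invariant V" using URSV by (simp add: G.URS_iff)
  have L0V: "Z.stab_in R z0 \<in> V" unfolding V_def by (rule Z.stab_URS_mem[OF R z0Z])
  (* A point x of X over z0 has its stabilizer inside that of z0. *)
  have "\<exists>K\<in>U. K \<subseteq> Z.stab_in R z0"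
  proof -
    obtain \<pi> where \<pi>: "equivariant_quotient G X \<phi> Z \<tau> \<pi>"
      using furstenberg_boundary_universal[OF fX bZ] by blast
    have "z0 \<in> \<pi> ` topspace X" using \<pi> z0Z by (simp add: equivariant_quotient_def)
    then obtain x where x: "x \<in> topspace X" "\<pi> x = z0" by blast
    obtain K where K: "K \<in> U" "K \<subseteq> X.stab_in (carrier G) x" using U_below[OF x(1)] by blast
    have "g \<in> Z.stab_in R z0" if "g \<in> K" for g
    proof -
      have g: "g \<in> carrier G" "\<phi> g x = x" using K(2) that by (auto simp: X.stab_in_def)
      then have "\<tau> g z0 = z0" using \<pi> x unfolding equivariant_quotient_def by metis
      then show ?thesis using UR[OF K(1)] that by (auto simp: Z.stab_in_def)
    qed
    then show ?thesis using K(1) by blast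
  qed
  then obtain K2 where K2: "K2 \<in> U" "K2 \<subseteq> Z.stab_in R z0" by blast
  (* The elements of R that fix z0 fix the state F z0 on X. *)
  have "\<exists>K\<in>V. K \<subseteq> X.stab_in (carrier G) x0"
  proof -
    obtain F where F: "\<And>z. z \<in> topspace Z \<Longrightarrow> F z \<in> X.P"
      "\<And>g z k. g \<in> carrier G \<Longrightarrow> (\<And>y. y \<in> topspace Y \<Longrightarrow> \<psi> (N #> g) y = y) \<Longrightarrow> z \<in> topspace Z \<Longrightarrow>
        F (\<tau> g z) k = F z (\<lambda>x. k (\<phi> g x))"
      by (rule equivariant_states_exist[OF N X.compact_G fZ \<tau>(1) fY]) blast
    have inv: "F z0 (\<lambda>x. k (\<phi> l x)) = F z0 k" if l: "l \<in> Z.stab_in R z0" for l k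
    proof -
      have lR: "l \<in> R" "\<tau> l z0 = z0" using l by (auto simp: Z.stab_in_def)
      have triv: "\<psi> (N #> l) y = y" if "y \<in> topspace Y" for y
      proof -
        have "\<rho> l y = y" using lR(1) that unfolding R_def by blast
        then show ?thesis by (simp only: \<rho>_def)
      qed
      have "F (\<tau> l z0) k = F z0 (\<lambda>x. k (\<phi> l x))"
        by (rule F(2)[OF R.mem_carrier[OF lR(1)] triv z0Z])
      then show ?thesis by (simp only: lR(2))
    qed
    have sL: "subgroup (Z.stab_in R z0) G" by (rule Z.subgroup_stab_in[OF R.subgroup_axioms z0Z])
    have "\<exists>x\<in>topspace X. \<exists>K\<in>V. K \<subseteq> X.stab_in (carrier G) x"
      by (rule X.stabilizers_limit_in_stabilizer[OF G_boundaryD(2)[OF bX] F(1)[OF z0Z] sL inv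
          G.URS_D(1)[OF URSV] G.URS_D(3)[OF URSV _ L0V]])
    then obtain x K where "x \<in> topspace X" "K \<in> V" "K \<subseteq> X.stab_in (carrier G) x" by blast
    then show ?thesis
      by (intro X.subgroup_below_stabilizers[OF minX G.URS_D(1)[OF URSV] cjV _ _ _ x0X])
  qed
  then obtain K1 where K1: "K1 \<in> V" "K1 \<subseteq> X.stab_in (carrier G) x0" by blast
  have UV: "U = V" by (rule G.URS_antisym[OF URSU URSV H0U K1 K2(1) L0V K2(2)])
  (* Since Z is minimal for N, the N-conjugates of H are dense in V. *)
  have HV: "H \<in> V" "H1 \<in> V" using H H1 UV by (auto simp: U_def)
  have sH: "subgroup H G" "subgroup H1 G" using G.URS_D(5)[OF URSV] HV by auto
  have "H \<in> Sub G closure_of (Z.stab_in R ` topspace Z)"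
    using HV(1) Z.stab_URS_closure[OF R z0Z] unfolding V_def by blast
  then have "H1 \<in> Sub G closure_of {G.conjugate n H | n. n \<in> N}"
    using Z.stab_URS_minimal[OF R N.subgroup_axioms G_boundaryD(3)[OF bNZ] z0] HV(2)
    unfolding V_def by blast
  note approx = closure_SubE[OF this]
  show "H1 <#> N \<subseteq> H <#> N"
  proof
    fix g assume "g \<in> H1 <#> N"
    then obtain h n' where h: "h \<in> H1" "n' \<in> N" "g = h \<otimes> n'" by (auto simp: set_mult_def)
    have hG: "h \<in> carrier G" by (rule subgroup.mem_carrier[OF sH(2) h(1)])
    have "{G.conjugate n H | n. n \<in> N} \<subseteq> {H. subgroup H G}" using G.subgroup_conjugate[OF _ sH(1)] N.mem_carrier by auto
    then obtain K where "K \<in> {G.conjugate n H | n. n \<in> N}" "K \<inter> {h} = H1 \<inter> {h}"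
      using approx[of "{h}"] hG by blast
    then obtain n where n: "n \<in> N" "h \<in> G.conjugate n H" using h(1) by auto
    have nG: "n \<in> carrier G" "n' \<in> carrier G" using N.mem_carrier n h by auto
    (* Move h into H by conjugating with n; the correction terms lie in N. *)
    define h' where "h' = inv n \<otimes> h \<otimes> n"
    have h': "h' \<in> H" "h' \<in> carrier G" using n(2) nG hG by (auto simp: h'_def G.conjugate_def)
    have "inv h' \<otimes> n \<otimes> h' \<in> N" using N.inv_op_closed1[OF h'(2) n(1)] .
    then have mem: "inv h' \<otimes> n \<otimes> h' \<otimes> inv n \<otimes> n' \<in> N" using n h by simp
    have "h' \<otimes> (inv h' \<otimes> n \<otimes> h' \<otimes> inv n \<otimes> n') = n \<otimes> h' \<otimes> inv n \<otimes> n'"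
      using h' nG by (simp add: G.m_assoc[symmetric])
    moreover have "n \<otimes> h' \<otimes> inv n = h"
      using nG hG unfolding h'_def by (simp add: G.m_assoc[symmetric]) (simp add: G.m_assoc)
    ultimately have "g = h' \<otimes> (inv h' \<otimes> n \<otimes> h' \<otimes> inv n \<otimes> n')" by (simp add: h(3))
    then show "g \<in> H <#> N" using h'(1) mem unfolding set_mult_def by blast
  qed
qed

lemma furstenberg_URS_is_URS:
  fixes G (structure)
  assumes G: "group G" and cG: "countable (carrier G)"
  shows "URS G (furstenberg_URS G)"
proof -
  obtain X \<phi> where X: "furstenberg_boundary G = (X, \<phi>)" by (cases "furstenberg_boundary G")
  have bX: "G_boundary G X \<phi>"
    using furstenberg_boundary_exists[OF G] by (simp add: X is_furstenberg_boundary_def)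
  interpret X: compact_action G X \<phi> using G_boundaryD[OF bX] by simp
  obtain x0 where x0: "X.regular_point (carrier G) x0" using X.regular_point_exists[OF cG] by blast
  show ?thesis
    using X.stab_URS_is_URS[OF X.carrier_normal G_boundaryD(3)[OF bX] x0]
      X.stabilizer_URS_eq[OF G_boundaryD(3)[OF bX] x0] by (simp add: furstenberg_URS_def X)
qed

theorem proposition4:
  fixes G :: "('a, 'c) monoid_scheme" and \<N> :: "'a set set"
  assumes "group G" and "countable (carrier G)"
    and "\<N> \<noteq> {}" and "countable \<N>" and "\<N> \<subseteq> normal_F G"
  shows "\<exists>M \<H>\<^sub>0. M \<lhd> G \<and>
           comeager_in (subtopology (Sub G) (furstenberg_URS G)) \<H>\<^sub>0 \<and>
           (\<forall>H\<in>\<H>\<^sub>0. cl G \<N> H = M)"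
proof -
  interpret group G by (rule assms(1))
  have U: "URS G (furstenberg_URS G)" by (rule furstenberg_URS_is_URS[OF assms(1,2)])
  obtain H0 where H0: "H0 \<in> furstenberg_URS G" using URS_D(2)[OF U] by blast
  have const: "H <#>\<^bsub>G\<^esub> N = H0 <#>\<^bsub>G\<^esub> N" if "H \<in> furstenberg_URS G" "N \<in> \<N>" for H N
    using furstenberg_URS_product_constant[OF assms(1,2)] assms(5) that H0 by blast
  have norm: "H0 <#>\<^bsub>G\<^esub> N \<lhd> G" if N: "N \<in> \<N>" for N
    unfolding normal_inv_iff
  proof (intro conjI ballI)
    have nN: "N \<lhd> G" using N assms(5) by (auto simp: normal_F_def)
    interpret N: normal N G by (rule nN)
    have sH0: "subgroup H0 G" by (rule URS_D(5)[OF U H0])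
    show "subgroup (H0 <#>\<^bsub>G\<^esub> N) G"
      using mult_norm_subgroup[OF nN sH0] commut_normal[OF sH0 nN] by simp
    fix x h assume x: "x \<in> carrier G" and "h \<in> H0 <#>\<^bsub>G\<^esub> N"
    then obtain a b where ab: "a \<in> H0" "b \<in> N" "h = a \<otimes>\<^bsub>G\<^esub> b" by (auto simp: set_mult_def)
    have aG: "a \<in> carrier G" "b \<in> carrier G" using ab subgroup.mem_carrier[OF sH0] N.mem_carrier by auto
    have "inv\<^bsub>G\<^esub> x \<otimes>\<^bsub>G\<^esub> (x \<otimes>\<^bsub>G\<^esub> a \<otimes>\<^bsub>G\<^esub> inv\<^bsub>G\<^esub> x) \<otimes>\<^bsub>G\<^esub> x = a"
      using x aG by (simp add: m_assoc[symmetric]) (simp add: m_assoc)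
    then have "x \<otimes>\<^bsub>G\<^esub> a \<otimes>\<^bsub>G\<^esub> inv\<^bsub>G\<^esub> x \<in> conjugate x H0" using x aG ab(1) by (simp add: conjugate_def)
    moreover have "x \<otimes>\<^bsub>G\<^esub> b \<otimes>\<^bsub>G\<^esub> inv\<^bsub>G\<^esub> x \<in> N" using N.inv_op_closed2[OF x ab(2)] .
    moreover have "x \<otimes>\<^bsub>G\<^esub> h \<otimes>\<^bsub>G\<^esub> inv\<^bsub>G\<^esub> x =
        (x \<otimes>\<^bsub>G\<^esub> a \<otimes>\<^bsub>G\<^esub> inv\<^bsub>G\<^esub> x) \<otimes>\<^bsub>G\<^esub> (x \<otimes>\<^bsub>G\<^esub> b \<otimes>\<^bsub>G\<^esub> inv\<^bsub>G\<^esub> x)"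
      using x aG by (simp add: ab(3) m_assoc) (simp add: m_assoc[symmetric])
    ultimately have "x \<otimes>\<^bsub>G\<^esub> h \<otimes>\<^bsub>G\<^esub> inv\<^bsub>G\<^esub> x \<in> conjugate x H0 <#>\<^bsub>G\<^esub> N" unfolding set_mult_def by blast
    then show "x \<otimes>\<^bsub>G\<^esub> h \<otimes>\<^bsub>G\<^esub> inv\<^bsub>G\<^esub> x \<in> H0 <#>\<^bsub>G\<^esub> N"
      using const[OF URS_D(3)[OF U x H0] N] by simp
  qed
  show ?thesis
  proof (intro exI conjI)
    show "cl G \<N> H0 \<lhd> G"
      unfolding normal_inv_iff
    proof (intro conjI ballI)
      have "subgroup (\<Inter>((\<lambda>N. H0 <#>\<^bsub>G\<^esub> N) ` \<N>)) G"
        using norm assms(3) by (intro subgroups_Inter) (auto simp: normal_inv_iff)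
      then show "subgroup (cl G \<N> H0) G" by (simp add: cl_def)
      fix x h assume "x \<in> carrier G" "h \<in> cl G \<N> H0"
      then show "x \<otimes>\<^bsub>G\<^esub> h \<otimes>\<^bsub>G\<^esub> inv\<^bsub>G\<^esub> x \<in> cl G \<N> H0"
        using norm unfolding normal_inv_iff cl_def by blast
    qed
    have "topspace (subtopology (Sub G) (furstenberg_URS G)) = furstenberg_URS G"
      using URS_D(5)[OF U] by auto
    then show "comeager_in (subtopology (Sub G) (furstenberg_URS G)) (furstenberg_URS G)"
      unfolding comeager_in_def by (intro conjI exI[of _ "{}"]) auto
    show "\<forall>H\<in>furstenberg_URS G. cl G \<N> H = cl G \<N> H0"
      using const by (auto simp: cl_def)
  qed
qed

end
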